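(* Fix $\gamma\in\mathbb R$ and fixed $\alpha>1$. Suppose $(\log n)^2\ll k\ll\sqrt n$ and $m=\frac{k^2n}{4\log n}\big(1+\frac{\gamma}{\sqrt{\log n}}\big)$ (rounded to an integer). Let $A=\{\Lambda(G)\ge1\}$ and $B=\{\Delta(G)\ge t^*\}$. Then the symmetric difference $A\triangle B$ satisfies $\mathbb P_0(A\triangle B)=o(1)$ and $\mathbb P_1(A\triangle B)=o(1)$.
   Context: Let $n,m,k$ be positive integers and $N=\binom n2$; all asymptotics are as $n\to\infty$ with $k=k(n)$, $m=m(n)$, and $a\ll b$ means $a/b\to0$. The null distribution $\mathbb P_0$ is the Erdős–Rényi model $G(n,m)$: the uniform distribution over graphs on vertex set $[n]$ with exactly $m$ edges. The planted distribution $\mathbb P_1$ is the law of the random graph obtained as follows: choose a hub vertex $v_*\in[n]$ uniformly at random; choose a uniformly random set $S$ of $k$ of the $n-1$ possible edges incident to $v_*$; then choose a uniformly random set of $m-k$ edges among the $N-k$ possible edges not in $S$; the graph consists of these $m$ edges. $\Lambda(G)=\frac{d\mathbb P_1}{d\mathbb P_0}(G)$ is the likelihood ratio and $\Delta(G)$ the maximum degree of $G$. For a fixed $\alpha>0$, the threshold is $$t^*=\frac{2m}{n}+\sqrt{\frac{2m}{n}\Big(1-\frac mN\Big)}\sqrt{2\log n-\frac1\alpha\log\log n}.$$ *)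

theory Defs
  imports "HOL-Probability.Probability"
begin

text \<open>Simple graphs on the vertex set [n], represented as {0..<n}; an edge is a
2-element subset of the vertex set, a graph is a set of edges.\<close>

definition all_edges :: "nat \<Rightarrow> nat set set" where
  "all_edges n = {e. e \<subseteq> {..<n} \<and> card e = 2}"

definition N_pairs :: "nat \<Rightarrow> nat" where
  "N_pairs n = n choose 2"

definition P0 :: "nat \<Rightarrow> nat \<Rightarrow> nat set set pmf" where
  "P0 n m = pmf_of_set {G. G \<subseteq> all_edges n \<and> card G = m}"

definition incident_edges :: "nat \<Rightarrow> nat \<Rightarrow> nat set set" where
  "incident_edges n v = {e \<in> all_edges n. v \<in> e}"

definition P1 :: "nat \<Rightarrow> nat \<Rightarrow> nat \<Rightarrow> nat set set pmf" where
  "P1 n m k =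
     do { v \<leftarrow> pmf_of_set {..<n};
          S \<leftarrow> pmf_of_set {S. S \<subseteq> incident_edges n v \<and> card S = k};
          R \<leftarrow> pmf_of_set {R. R \<subseteq> all_edges n - S \<and> card R = m - k};
          return_pmf (S \<union> R) }"

definition LR :: "nat \<Rightarrow> nat \<Rightarrow> nat \<Rightarrow> nat set set \<Rightarrow> real" where
  "LR n m k G = pmf (P1 n m k) G / pmf (P0 n m) G"

definition degree :: "nat set set \<Rightarrow> nat \<Rightarrow> nat" where
  "degree G v = card {e \<in> G. v \<in> e}"

definition max_degree :: "nat \<Rightarrow> nat set set \<Rightarrow> nat" where
  "max_degree n G = Max (degree G ` {..<n})"

definition t_star :: "real \<Rightarrow> nat \<Rightarrow> nat \<Rightarrow> real" where
  "t_star \<alpha> n m =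
     2 * real m / real n
     + sqrt (2 * real m / real n * (1 - real m / real (N_pairs n)))
       * sqrt (2 * ln (real n) - (1 / \<alpha>) * ln (ln (real n)))"

end

theory Submission
  imports Defs "HOL-Real_Asymp.Real_Asymp"
begin

text \<open>
The likelihood ratio is a sum \<open>\<Lambda>(G) = \<Sum>v. w(deg v)\<close> with an increasing weight \<open>w\<close>, so planted
probabilities are \<open>P0\<close>-expectations weighted by \<open>\<Lambda>\<close>, and everything reduces to the hypergeometric
law of one degree and the joint law of two degrees under \<open>P0\<close>. With \<open>\<sigma>\<close> the standard deviation of a
degree, \<open>w\<close> tends to 0 below \<open>t* - \<epsilon>\<sigma>\<close> and to infinity above \<open>t* + \<epsilon>\<sigma>\<close>, while the planted hub falls
into the window between with probability \<open>O(\<epsilon>)\<close>. Since \<open>\<alpha> > 1\<close>, a union bound with the sharp Gaussian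
tail gives \<open>P0(B) \<rightarrow> 0\<close>. The part \<open>Y\<close> of \<open>\<Lambda>\<close> carried by degrees below \<open>t* - \<epsilon>\<sigma>\<close> has a mean bounded
away from 1, because the hub exceeds \<open>t*\<close> with probability bounded below, and its variance vanishes
because two degrees are almost independent; hence \<open>P0(A) \<rightarrow> 0\<close>. Finally the planted probability of
\<open>A \<union> B\<close> with a hub below the window is the expectation of \<open>Y\<close> over \<open>A \<union> B\<close>, which is small since \<open>Y\<close> is
bounded in \<open>L\<^sup>2\<close>, and a hub above the window forces both events.
\<close>

subsection \<open>Counting graphs by degrees\<close>

text \<open>The scale of \<open>m\<close> makes the planted shift \<open>k\<close>, in units of
  \<open>sqrt D\<close> with \<open>D = 2m/n\<close>, equal to \<open>sqrt (2 log n) + O(1)\<close>.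
  At degree \<open>D + y * sqrt D\<close> the quantity \<open>n * w\<close> is about
  \<open>exp (\<mu> y - \<mu>^2 / 2)\<close> with \<open>\<mu> = k / sqrt D\<close>, as for a
  Gaussian shift. At \<open>y = sqrt (2 log n)\<close> this is \<open>n\<close> up to a bounded
  factor, and its logarithm has slope \<open>\<mu>\<close>, which tends to infinity; so
  \<open>w\<close> passes from small to large within any fixed fraction of a standard deviation. The
  log log term moves \<open>t*\<close> by only \<open>o(1)\<close> standard deviations; it matters
  for the null mean number of vertices above \<open>t*\<close>, which is at most of order
  \<open>(log n)^(1/(2\<alpha>) - 1/2)\<close>. The obstacle is that the hub is within
  \<open>O(1)\<close> standard deviations of \<open>t*\<close>, so it cannot be placed on one side
  with high probability; both outcomes have to be covered. The condition
  \<open>k >> (log n)^2\<close> controls the Taylor errors of order \<open>k^3 / D^2\<close>. The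
  condition \<open>k << sqrt n\<close> makes \<open>D / n\<close> and \<open>k^2 / n\<close> vanish,
  which gives near independence of degrees and makes sampling without replacement harmless.\<close>

definition graphs :: "nat \<Rightarrow> nat \<Rightarrow> nat set set set" where
  "graphs n m = {G. G \<subseteq> all_edges n \<and> card G = m}"

text \<open>Only meaningful for \<open>d \<le> m\<close>: beyond that, \<open>m - d\<close> is truncated to 0.\<close>

definition hypergeom :: "nat \<Rightarrow> nat \<Rightarrow> nat \<Rightarrow> nat \<Rightarrow> real" where
  "hypergeom N K m d = real (K choose d) * real ((N - K) choose (m - d)) / real (N choose m)"

text \<open>The contribution of a vertex of degree \<open>d\<close> to the likelihood ratio.\<close>

definition hub_weight :: "nat \<Rightarrow> nat \<Rightarrow> nat \<Rightarrow> nat \<Rightarrow> real" where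
  "hub_weight n m k d =
     real (d choose k) * real (N_pairs n choose m)
     / (real n * real ((n - 1) choose k) * real ((N_pairs n - k) choose (m - k)))"

lemma finite_all_edges [simp]: "finite (all_edges n)"
proof -
  have "all_edges n \<subseteq> Pow {..<n}" by (auto simp: all_edges_def)
  then show ?thesis by (rule finite_subset) simp
qed

lemma card_all_edges: "card (all_edges n) = N_pairs n"
  unfolding all_edges_def N_pairs_def using n_subsets[of "{..<n}" 2] by simp

lemma incident_edges_subset: "incident_edges n v \<subseteq> all_edges n"
  by (auto simp: incident_edges_def)

lemma finite_incident_edges [simp]: "finite (incident_edges n v)"
  using finite_subset[OF incident_edges_subset] by simp

lemma incident_edges_eq_image:
  assumes "v < n"
  shows "incident_edges n v = (\<lambda>u. {u, v}) ` ({..<n} - {v})"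
proof (intro equalityI subsetI)
  fix e assume "e \<in> incident_edges n v"
  then have e: "e \<subseteq> {..<n}" "card e = 2" "v \<in> e"
    by (auto simp: incident_edges_def all_edges_def)
  then obtain x y where xy: "e = {x, y}" "x \<noteq> y" by (meson card_2_iff)
  with e show "e \<in> (\<lambda>u. {u, v}) ` ({..<n} - {v})" by auto
qed (use assms in \<open>auto simp: incident_edges_def all_edges_def\<close>)

lemma card_incident_edges:
  assumes "v < n"
  shows "card (incident_edges n v) = n - 1"
proof -
  have "inj_on (\<lambda>u. {u, v}) ({..<n} - {v})"
    by (auto simp: inj_on_def doubleton_eq_iff)
  then show ?thesis
    using assms by (simp add: incident_edges_eq_image card_image)
qed

lemma incident_edges_inter:
  assumes "u < n" "v < n" "u \<noteq> v"
  shows "incident_edges n u \<inter> incident_edges n v = {{u, v}}"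
  using assms by (auto simp: incident_edges_eq_image doubleton_eq_iff)

lemma degree_eq_card_inter:
  assumes "G \<subseteq> all_edges n"
  shows "degree G v = card (G \<inter> incident_edges n v)"
proof -
  have "{e \<in> G. v \<in> e} = G \<inter> incident_edges n v"
    using assms by (auto simp: incident_edges_def)
  then show ?thesis by (simp add: degree_def)
qed

lemma degree_le:
  assumes "G \<subseteq> all_edges n" "v < n"
  shows "degree G v \<le> n - 1"
  using card_mono[of "incident_edges n v" "G \<inter> incident_edges n v"] assms
  by (simp add: degree_eq_card_inter card_incident_edges)

lemma finite_graphs [simp]: "finite (graphs n m)"
proof -
  have "graphs n m \<subseteq> Pow (all_edges n)" by (auto simp: graphs_def)
  then show ?thesis by (rule finite_subset) simp
qed

lemma card_graphs: "card (graphs n m) = N_pairs n choose m"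
  unfolding graphs_def using n_subsets[of "all_edges n" m] by (simp add: card_all_edges)

text \<open>The parts inside and outside \<open>A\<close> are chosen independently. The arbitrary
  predicate \<open>P\<close> on the outside part lets further blocks be peeled off by the same
  lemma.\<close>

lemma card_subsets_split:
  assumes "finite E" "A \<subseteq> E" "a \<le> m"
  shows "card {G. G \<subseteq> E \<and> card G = m \<and> card (G \<inter> A) = a \<and> P (G - A)}
       = (card A choose a) * card {R. R \<subseteq> E - A \<and> card R = m - a \<and> P R}"
    (is "card ?L = _ * card ?R")
proof -
  let ?T = "{T. T \<subseteq> A \<and> card T = a}"
  have finA: "finite A" using assms finite_subset by blast
  have "bij_betw (\<lambda>(T, R). T \<union> R) (?T \<times> ?R) ?L"
  proof (rule bij_betw_byWitness[where f' = "\<lambda>G. (G \<inter> A, G - A)"])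
    show "\<forall>x\<in>?T \<times> ?R. (\<lambda>G. (G \<inter> A, G - A)) ((\<lambda>(T, R). T \<union> R) x) = x" by auto
    show "\<forall>G\<in>?L. (\<lambda>(T, R). T \<union> R) (G \<inter> A, G - A) = G" by auto
    show "(\<lambda>(T, R). T \<union> R) ` (?T \<times> ?R) \<subseteq> ?L"
    proof safe
      fix T R assume T: "T \<subseteq> A" "a = card T" and R: "R \<subseteq> E - A" "card R = m - card T" "P R"
      have fin: "finite T" "finite R" using T R assms finA by (auto intro: finite_subset)
      have "T \<inter> R = {}" using T R by auto
      then show "card (T \<union> R) = m" using fin T R assms by (simp add: card_Un_disjoint)
      have "(T \<union> R) \<inter> A = T" "T \<union> R - A = R" using T R by auto
      then show "card ((T \<union> R) \<inter> A) = card T" "P (T \<union> R - A)" using R by auto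
    qed (use assms in auto)
    show "(\<lambda>G. (G \<inter> A, G - A)) ` ?L \<subseteq> ?T \<times> ?R"
    proof safe
      fix G assume G: "G \<subseteq> E" "a = card (G \<inter> A)"
      have "finite G" using G assms finite_subset by blast
      then show "card (G - A) = card G - card (G \<inter> A)"
        by (simp add: card_Diff_subset_Int)
    qed auto
  qed
  then have "card ?L = card (?T \<times> ?R)" by (simp add: bij_betw_same_card)
  also have "\<dots> = (card A choose a) * card ?R"
    using n_subsets[OF finA, of a] by (simp add: card_cartesian_product)
  finally show ?thesis .
qed

text \<open>Meant for two vertices: \<open>C\<close> is the edge joining them, \<open>A\<close> and
  \<open>B\<close> are the other edges at each. Disjointness keeps a later block intact when an
  earlier one is removed, so the split applies three times.\<close>

lemma card_subsets_three_blocks: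
  assumes "finite E" "A \<subseteq> E" "B \<subseteq> E" "C \<subseteq> E" "A \<inter> B = {}" "A \<inter> C = {}" "B \<inter> C = {}"
    and "a + b + c \<le> m"
  shows "card {G. G \<subseteq> E \<and> card G = m \<and> card (G \<inter> C) = c \<and> card (G \<inter> A) = a \<and> card (G \<inter> B) = b}
       = (card C choose c) * (card A choose a) * (card B choose b)
         * (card (E - C - A - B) choose (m - c - a - b))"
proof -
  have 1: "(G - C) \<inter> A = G \<inter> A" "(G - C) \<inter> B = G \<inter> B" "(G - A) \<inter> B = G \<inter> B" for G
    using assms by auto
  have "card {G. G \<subseteq> E \<and> card G = m \<and> card (G \<inter> C) = c \<and> card (G \<inter> A) = a \<and> card (G \<inter> B) = b}
      = card {G. G \<subseteq> E \<and> card G = m \<and> card (G \<inter> C) = c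
          \<and> (card ((G - C) \<inter> A) = a \<and> card ((G - C) \<inter> B) = b)}"
    by (simp only: 1)
  also have "\<dots> = (card C choose c) * card {R. R \<subseteq> E - C \<and> card R = m - c
          \<and> (card (R \<inter> A) = a \<and> card (R \<inter> B) = b)}"
    using assms by (intro card_subsets_split) auto
  also have "card {R. R \<subseteq> E - C \<and> card R = m - c \<and> (card (R \<inter> A) = a \<and> card (R \<inter> B) = b)}
      = card {R. R \<subseteq> E - C \<and> card R = m - c \<and> card (R \<inter> A) = a \<and> card ((R - A) \<inter> B) = b}"
    by (simp only: 1)
  also have "\<dots> = (card A choose a)
      * card {R. R \<subseteq> E - C - A \<and> card R = m - c - a \<and> card (R \<inter> B) = b}"
    using assms by (intro card_subsets_split) auto
  also have "card {R. R \<subseteq> E - C - A \<and> card R = m - c - a \<and> card (R \<inter> B) = b}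
      = (card B choose b) * card {R. R \<subseteq> E - C - A - B \<and> card R = m - c - a - b}"
  proof -
    have "B \<subseteq> E - C - A" "b \<le> m - c - a" using assms by auto
    then show ?thesis
      using card_subsets_split[of "E - C - A" B b "m - c - a" "\<lambda>_. True"] assms by simp
  qed
  also have "card {R. R \<subseteq> E - C - A - B \<and> card R = m - c - a - b}
      = card (E - C - A - B) choose (m - c - a - b)"
    using assms by (intro n_subsets) auto
  finally show ?thesis by (simp add: mult.assoc)
qed

lemma card_graphs_degree:
  assumes "v < n" "a \<le> m"
  shows "card {G \<in> graphs n m. degree G v = a}
       = ((n - 1) choose a) * ((N_pairs n - (n - 1)) choose (m - a))"
proof -
  have "{G \<in> graphs n m. degree G v = a}
      = {G. G \<subseteq> all_edges n \<and> card G = m \<and> card (G \<inter> incident_edges n v) = a \<and> True}"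
    by (auto simp: graphs_def degree_eq_card_inter)
  also have "card \<dots> = (card (incident_edges n v) choose a)
      * card {R. R \<subseteq> all_edges n - incident_edges n v \<and> card R = m - a \<and> True}"
    using assms incident_edges_subset by (intro card_subsets_split) auto
  also have "card {R. R \<subseteq> all_edges n - incident_edges n v \<and> card R = m - a \<and> True}
      = card (all_edges n - incident_edges n v) choose (m - a)"
    using n_subsets[of "all_edges n - incident_edges n v" "m - a"] by simp
  finally show ?thesis
    using assms by (simp add: card_incident_edges card_Diff_subset incident_edges_subset card_all_edges)
qed

text \<open>The two summands are the graphs without and with the edge between \<open>u\<close> and
  \<open>v\<close>; exactly \<open>2 * n - 3\<close> pairs meet \<open>{u, v}\<close>. The guard on
  zero degrees matters because \<open>a - 1\<close> would truncate to 0 and its binomial coefficient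
  would be 1.\<close>

lemma card_graphs_degree_pair:
  assumes "u < n" "v < n" "u \<noteq> v" "a + b \<le> m"
  shows "card {G \<in> graphs n m. degree G u = a \<and> degree G v = b}
       = ((n - 2) choose a) * ((n - 2) choose b) * ((N_pairs n - (2 * n - 3)) choose (m - a - b))
       + (if a = 0 \<or> b = 0 then 0
          else ((n - 2) choose (a - 1)) * ((n - 2) choose (b - 1))
               * ((N_pairs n - (2 * n - 3)) choose (m - (a + b - 1))))"
    (is "_ = ?X + ?Y")
proof -
  define C A B where "C = {{u, v}}" and "A = incident_edges n u - C" and "B = incident_edges n v - C"
  have int: "incident_edges n u \<inter> incident_edges n v = C"
    unfolding C_def using assms by (intro incident_edges_inter)
  have n: "n \<ge> 2" using assms by auto
  have CU: "C \<subseteq> incident_edges n u" "C \<subseteq> incident_edges n v" using int by auto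
  have cC: "card C = 1" by (simp add: C_def)
  have cA: "card A = n - 2" "card B = n - 2"
    unfolding A_def B_def using CU assms cC n
    by (subst card_Diff_subset; simp add: C_def card_incident_edges)+
  have sub: "A \<subseteq> all_edges n" "B \<subseteq> all_edges n" "C \<subseteq> all_edges n"
    using CU incident_edges_subset[of n u] incident_edges_subset[of n v] by (auto simp: A_def B_def)
  have disj: "A \<inter> B = {}" "A \<inter> C = {}" "B \<inter> C = {}" using int by (auto simp: A_def B_def)
  have finABC: "finite A" "finite B" "finite C" using sub finite_subset by (auto simp: A_def B_def C_def)
  have rest: "card (all_edges n - C - A - B) = N_pairs n - (2 * n - 3)"
  proof -
    have "all_edges n - C - A - B = all_edges n - (C \<union> A \<union> B)" by auto
    moreover have "card (C \<union> A \<union> B) = 2 * n - 3"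
      using finABC disj cC cA n
      by (subst card_Un_disjoint; (subst card_Un_disjoint)?; auto)
    ultimately show ?thesis using sub finABC by (simp add: card_Diff_subset card_all_edges)
  qed
  let ?S = "\<lambda>c a b. {G. G \<subseteq> all_edges n \<and> card G = m \<and> card (G \<inter> C) = c
                        \<and> card (G \<inter> A) = a \<and> card (G \<inter> B) = b}"
  have deg: "degree G u = card (G \<inter> C) + card (G \<inter> A)" "degree G v = card (G \<inter> C) + card (G \<inter> B)"
    if "G \<subseteq> all_edges n" for G
  proof -
    have "G \<inter> incident_edges n u = (G \<inter> C) \<union> (G \<inter> A)" "G \<inter> incident_edges n v = (G \<inter> C) \<union> (G \<inter> B)"
      using CU by (auto simp: A_def B_def)
    moreover have "finite G" using that finite_all_edges finite_subset by blast
    ultimately show "degree G u = card (G \<inter> C) + card (G \<inter> A)" "degree G v = card (G \<inter> C) + card (G \<inter> B)"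
      using that disj by (simp_all add: degree_eq_card_inter) (subst card_Un_disjoint; auto)+
  qed
  have c01: "card (G \<inter> C) = 0 \<or> card (G \<inter> C) = 1" for G
    unfolding C_def by (cases "{u, v} \<in> G") auto
  have eq: "{G \<in> graphs n m. degree G u = a \<and> degree G v = b}
      = ?S 0 a b \<union> (if a = 0 \<or> b = 0 then {} else ?S 1 (a - 1) (b - 1))"
  proof (intro set_eqI iffI)
    fix G assume G: "G \<in> {G \<in> graphs n m. degree G u = a \<and> degree G v = b}"
    then show "G \<in> ?S 0 a b \<union> (if a = 0 \<or> b = 0 then {} else ?S 1 (a - 1) (b - 1))"
      using c01[of G] deg[of G] by (auto simp: graphs_def)
  next
    fix G assume "G \<in> ?S 0 a b \<union> (if a = 0 \<or> b = 0 then {} else ?S 1 (a - 1) (b - 1))"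
    then show "G \<in> {G \<in> graphs n m. degree G u = a \<and> degree G v = b}"
      using deg[of G] by (auto simp: graphs_def split: if_splits)
  qed
  have S0: "card (?S 0 a b) = ?X"
    using card_subsets_three_blocks[of "all_edges n" A B C a b 0 m] sub disj assms
    by (simp add: cA rest)
  show ?thesis
  proof (cases "a = 0 \<or> b = 0")
    case True
    then show ?thesis using S0 by (simp only: eq if_True Un_empty_right add_0_right)
  next
    case False
    have "a - 1 + (b - 1) + 1 \<le> m" using assms False by linarith
    then have "card (?S 1 (a - 1) (b - 1)) = ?Y"
      using card_subsets_three_blocks[of "all_edges n" A B C "a - 1" "b - 1" 1 m] sub disj assms False
      by (simp add: cA rest cC)
    moreover have "card (?S 0 a b \<union> ?S 1 (a - 1) (b - 1)) = card (?S 0 a b) + card (?S 1 (a - 1) (b - 1))"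
      by (rule card_Un_disjoint) (auto intro: finite_subset[of _ "Pow (all_edges n)"])
    ultimately show ?thesis using S0 False by (simp only: eq if_False)
  qed
qed

subsection \<open>Distributions with Poisson-like ratios\<close>

text \<open>Telescoping: the hypothesis says \<open>\<tau> * h d \<le> h d - h (Suc d)\<close>. The
  length \<open>j\<close> is arbitrary, so a whole upper tail is bounded.\<close>

lemma decay_sum_le:
  fixes h :: "nat \<Rightarrow> real"
  assumes "\<And>d. d \<ge> a \<Longrightarrow> h (Suc d) \<le> (1 - \<tau>) * h d" "\<And>d. h d \<ge> 0" "\<tau> > 0"
  shows "(\<Sum>d\<in>{a..<a + j}. h d) \<le> h a / \<tau>"
proof -
  have "\<tau> * (\<Sum>d\<in>{a..<a + j}. h d) \<le> h a - h (a + j)"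
  proof (induction j)
    case (Suc j)
    have "h (Suc (a + j)) \<le> (1 - \<tau>) * h (a + j)" using assms(1) by simp
    with Suc show ?case by (simp add: algebra_simps)
  qed simp
  also have "\<dots> \<le> h a" using assms(2) by simp
  finally show ?thesis using assms(3) by (simp add: field_simps)
qed

text \<open>The mirror image for a lower tail. The inductive bound survives a step because
  \<open>(1 + \<tau>) * (1 - \<tau>) \<le> 1\<close>.\<close>

lemma growth_sum_le:
  fixes h :: "nat \<Rightarrow> real"
  assumes "\<And>d. d < a \<Longrightarrow> h d \<le> (1 - \<tau>) * h (Suc d)" "\<And>d. h d \<ge> 0" "\<tau> > 0"
  shows "(\<Sum>d<a. h d) \<le> h a / \<tau>"
proof -
  have "\<tau> * (\<Sum>d<j. h d) \<le> h j" if "j \<le> a" for j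
    using that
  proof (induction j)
    case (Suc j)
    have "\<tau> * (\<Sum>d<Suc j. h d) \<le> (1 + \<tau>) * h j"
      using Suc by (simp add: algebra_simps)
    also have "\<dots> \<le> (1 + \<tau>) * ((1 - \<tau>) * h (Suc j))"
      using assms(1)[of j] assms(3) Suc by (intro mult_left_mono) auto
    also have "\<dots> = h (Suc j) - \<tau>\<^sup>2 * h (Suc j)" by (simp add: algebra_simps power2_eq_square)
    also have "\<dots> \<le> h (Suc j)" using assms(2) by simp
    finally show ?case .
  qed (simp add: assms)
  from this[of a] show ?thesis using assms(3) by (simp add: field_simps)
qed

text \<open>The ratios of consecutive weights are compared with those of a Poisson law of mean \<open>D\<close>. This
alone yields a Gaussian profile at scale \<open>sqrt D\<close> with matching upper and lower bounds, without
Stirling's formula.\<close>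

locale gaussian_shape =
  fixes h :: "nat \<Rightarrow> real" and D r A :: real and M :: nat
  assumes nonneg: "h d \<ge> 0"
    and total: "(\<Sum>d\<le>M. h d) = 1"
    and zero: "d > M \<Longrightarrow> h d = 0"
    and D_eq: "D = r * r" and r_ge: "r \<ge> 2" and A_ge: "A \<ge> 1"
    and above: "real d \<ge> D \<Longrightarrow> (real d + 1) * h (Suc d) \<le> D * h d"
    and below: "real d + 1 \<le> D \<Longrightarrow> D * h d \<le> (real d + 1) * h (Suc d)"
    and near: "D - 1 \<le> real d \<Longrightarrow> real d \<le> D + A * r
                \<Longrightarrow> (1 - 1 / r) * D * h d \<le> (real d + 1) * h (Suc d)"
begin

definition d0 where "d0 = nat \<lceil>D\<rceil>"

lemma D_ge: "D \<ge> 4"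
  using mult_mono[OF r_ge r_ge] r_ge by (simp add: D_eq)

lemma d0: "D \<le> real d0" "real d0 < D + 1"
  using D_ge unfolding d0_def by linarith+

lemma sum_le_one: "finite S \<Longrightarrow> sum h S \<le> 1"
proof -
  assume S: "finite S"
  have "sum h S = sum h (S \<inter> {..M})"
    using S zero by (intro sum.mono_neutral_right) (auto simp: not_le[symmetric])
  also have "\<dots> \<le> (\<Sum>d\<le>M. h d)" by (intro sum_mono2) (auto simp: nonneg)
  finally show ?thesis using total by simp
qed

text \<open>The function \<open>h\<close> decreases beyond \<open>d0\<close> and increases up to
  \<open>d0 - 1\<close>. Only the step from \<open>d0 - 1\<close> to \<open>d0\<close> can straddle
  \<open>D\<close>, where neither \<open>above\<close> nor \<open>below\<close> applies; there
  \<open>near\<close> loses a factor 2 from \<open>1 - 1 / r\<close> and another from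
  \<open>d0 \<le> 2 * D\<close>.\<close>

lemma le_mode: "h d \<le> 4 * h d0"
proof -
  have up: "h (d0 + i) \<le> h d0" for i
  proof (induction i)
    case (Suc i)
    have "D \<le> real (d0 + i)" using d0 by simp
    then have "(real (d0 + i) + 1) * h (Suc (d0 + i)) \<le> D * h (d0 + i)" by (rule above)
    also have "\<dots> \<le> (real (d0 + i) + 1) * h (d0 + i)"
      using d0 nonneg by (intro mult_right_mono) auto
    finally have "h (Suc (d0 + i)) \<le> h (d0 + i)" by (subst (asm) mult_le_cancel_left_pos) auto
    with Suc show ?case by simp
  qed simp
  have d0pos: "d0 \<ge> 4" using d0 D_ge by linarith
  have base: "h (d0 - 1) \<le> 4 * h d0"
  proof -
    have re: "real (d0 - 1) = real d0 - 1" using d0pos by simp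
    have "(1 - 1 / r) * D * h (d0 - 1) \<le> (real (d0 - 1) + 1) * h (Suc (d0 - 1))"
    proof (rule near)
      have "0 \<le> A * r" using A_ge r_ge by simp
      then show "D - 1 \<le> real (d0 - 1)" "real (d0 - 1) \<le> D + A * r"
        using d0 re by linarith+
    qed
    then have 1: "(1 - 1 / r) * D * h (d0 - 1) \<le> real d0 * h d0" using d0pos by simp
    have "1 / r \<le> 1 / 2" using r_ge by (simp add: field_simps)
    then have "1 / 2 * D * h (d0 - 1) \<le> (1 - 1 / r) * D * h (d0 - 1)"
      using D_ge nonneg by (intro mult_right_mono) auto
    also note 1
    also have "real d0 * h d0 \<le> 2 * D * h d0" using d0 D_ge nonneg by (intro mult_right_mono) auto
    finally show ?thesis using D_ge by simp
  qed
  have down: "h (d0 - 1 - i) \<le> 4 * h d0" if "i \<le> d0 - 1" for i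
    using that
  proof (induction i)
    case (Suc i)
    let ?d = "d0 - 1 - Suc i"
    have sd: "Suc ?d = d0 - 1 - i" using Suc by simp
    have "real (Suc ?d) \<le> real d0 - 1" unfolding sd using d0pos by simp
    then have dd: "real ?d + 1 \<le> D" using d0 by simp
    have "D * h ?d \<le> (real ?d + 1) * h (Suc ?d)" using dd by (rule below)
    also have "\<dots> \<le> D * h (Suc ?d)" using dd nonneg by (intro mult_right_mono) auto
    finally have "h ?d \<le> h (Suc ?d)" using D_ge by (subst (asm) mult_le_cancel_left_pos) auto
    then show ?case using Suc sd by simp
  qed (use base in simp)
  show ?thesis
  proof (cases "d \<ge> d0")
    case True
    then show ?thesis using up[of "d - d0"] nonneg[of d0] by simp
  next
    case False
    then show ?thesis using down[of "d0 - 1 - d"] by simp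
  qed
qed

text \<open>Each step multiplies \<open>h\<close> by at least
  \<open>(1 - 1 / r) / (1 + (A + 1) / r)\<close>, hence by at least
  \<open>exp (- (A + 3) / r)\<close>, and there are at most \<open>A * r\<close> steps.\<close>

lemma ge_mode:
  assumes "real i \<le> A * r"
  shows "exp (- (A + 3) * A) * h d0 \<le> h (d0 + i)"
proof -
  have "exp (- (A + 3) * real i / r) * h d0 \<le> h (d0 + i)"
    using assms
  proof (induction i)
    case (Suc i)
    let ?d = "d0 + i"
    have iA: "real i + 1 \<le> A * r" using Suc by simp
    have dD: "D - 1 \<le> real ?d" "real ?d \<le> D + A * r" "real ?d + 1 \<le> D + A * r + 1"
      using d0 iA by (simp_all; linarith)+
    have 1: "(1 - 1 / r) * D * h ?d \<le> (real ?d + 1) * h (Suc ?d)"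
      using dD by (intro near) auto
    have bnd: "real ?d + 1 \<le> D * (1 + (A + 1) / r)"
    proof -
      have "D * (1 + (A + 1) / r) = D + A * r + r" using r_ge by (simp add: D_eq field_simps)
      then show ?thesis using dD r_ge by linarith
    qed
    have z: "0 < 1 / r" "1 / r \<le> 1 / 2" using r_ge by (auto simp: field_simps)
    have e1: "exp (- (2 / r)) \<le> 1 - 1 / r"
    proof -
      have "1 \<le> (1 - 1 / r) * (1 + 2 * (1 / r))"
      proof -
        have "0 \<le> (1 / r) * (1 - 2 * (1 / r))" using z by (intro mult_nonneg_nonneg) auto
        moreover have "(1 - 1 / r) * (1 + 2 * (1 / r)) = 1 + (1 / r) * (1 - 2 * (1 / r))" by algebra
        ultimately show ?thesis by linarith
      qed
      also have "\<dots> \<le> (1 - 1 / r) * exp (2 / r)"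
        using z exp_ge_add_one_self[of "2 / r"] by (intro mult_left_mono) auto
      finally have "exp (- (2 / r)) * 1 \<le> exp (- (2 / r)) * ((1 - 1 / r) * exp (2 / r))"
        by (intro mult_left_mono) auto
      also have "\<dots> = 1 - 1 / r" by (simp add: exp_minus)
      finally show ?thesis by simp
    qed
    have e2: "exp (- ((A + 1) / r)) * (1 + (A + 1) / r) \<le> 1"
    proof -
      have "exp (- ((A + 1) / r)) * (1 + (A + 1) / r) \<le> exp (- ((A + 1) / r)) * exp ((A + 1) / r)"
        by (intro mult_left_mono exp_ge_add_one_self) auto
      then show ?thesis by (simp add: exp_minus)
    qed
    have hh: "0 \<le> D * h ?d" using D_ge nonneg by simp
    have "- (2 / r) + - ((A + 1) / r) = - (A + 3) / r" using r_ge by (simp add: field_simps)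
    then have "exp (- (A + 3) / r) = exp (- (2 / r)) * exp (- ((A + 1) / r))"
      by (simp only: mult_exp_exp)
    then have "(real ?d + 1) * (exp (- (A + 3) / r) * h ?d)
        = exp (- (2 / r)) * exp (- ((A + 1) / r)) * (real ?d + 1) * h ?d" by simp
    also have "\<dots> \<le> exp (- (2 / r)) * exp (- ((A + 1) / r)) * (D * (1 + (A + 1) / r)) * h ?d"
      using bnd nonneg by (intro mult_right_mono mult_left_mono) auto
    also have "\<dots> = exp (- (2 / r)) * (exp (- ((A + 1) / r)) * (1 + (A + 1) / r)) * (D * h ?d)" by simp
    also have "\<dots> \<le> exp (- (2 / r)) * 1 * (D * h ?d)"
      using e2 hh by (intro mult_right_mono mult_left_mono) auto
    also have "\<dots> \<le> (1 - 1 / r) * (D * h ?d)"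
      using e1 hh by (simp add: mult_right_mono)
    also have "\<dots> \<le> (real ?d + 1) * h (Suc ?d)" using 1 by simp
    finally have step: "exp (- (A + 3) / r) * h ?d \<le> h (Suc ?d)"
      by (subst (asm) mult_le_cancel_left_pos) auto
    have "exp (- (A + 3) * real (Suc i) / r) * h d0
        = exp (- (A + 3) / r) * (exp (- (A + 3) * real i / r) * h d0)"
    proof -
      have "- (A + 3) * real (Suc i) / r = - (A + 3) / r + - (A + 3) * real i / r"
        using r_ge by (simp add: field_simps)
      then show ?thesis by (simp only: exp_add mult.assoc)
    qed
    also have "\<dots> \<le> exp (- (A + 3) / r) * h ?d" using Suc by (intro mult_left_mono) auto
    finally show ?case using step by simp
  qed simp
  moreover have "exp (- (A + 3) * A) \<le> exp (- (A + 3) * real i / r)"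
  proof -
    have "real i / r \<le> A" using assms r_ge by (simp add: field_simps)
    then have "(A + 3) * (real i / r) \<le> (A + 3) * A" using A_ge by (intro mult_left_mono) auto
    moreover have "- (A + 3) * real i / r = - ((A + 3) * (real i / r))"
      by (simp only: minus_mult_left times_divide_eq_right)
    moreover have "- (A + 3) * A = - ((A + 3) * A)" by (simp only: minus_mult_left)
    ultimately show ?thesis by (simp only: exp_le_cancel_iff neg_le_iff_le)
  qed
  ultimately show ?thesis using nonneg[of d0] by (meson mult_right_mono order_trans)
qed

text \<open>By \<open>ge_mode\<close> at least \<open>r\<close> consecutive values are comparable
  with \<open>h d0\<close>, and their sum is at most 1. The factor 4 is that of
  \<open>le_mode\<close>.\<close>

lemma pmf_le: "h d \<le> 4 * exp ((A + 3) * A) / r"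
proof -
  let ?c = "exp (- (A + 3) * A)"
  let ?S = "(\<lambda>i. d0 + i) ` {..nat \<lfloor>r\<rfloor>}"
  have rA: "r \<le> A * r" using A_ge r_ge by simp
  have "r * (?c * h d0) \<le> real (card {..nat \<lfloor>r\<rfloor>}) * (?c * h d0)"
    using r_ge nonneg[of d0] by (intro mult_right_mono) (auto, linarith)
  also have "\<dots> = (\<Sum>i\<le>nat \<lfloor>r\<rfloor>. ?c * h d0)" by simp
  also have "\<dots> \<le> (\<Sum>i\<le>nat \<lfloor>r\<rfloor>. h (d0 + i))"
  proof (intro sum_mono ge_mode)
    fix i assume "i \<in> {..nat \<lfloor>r\<rfloor>}"
    then have "real i \<le> r" using r_ge by (simp add: le_nat_floor le_floor_iff nat_le_iff) linarith
    then show "real i \<le> A * r" using rA by simp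
  qed
  also have "\<dots> = sum h ?S" by (subst sum.reindex) (auto simp: inj_on_def)
  also have "\<dots> \<le> 1" by (intro sum_le_one) simp
  finally have "exp ((A + 3) * A) * (r * (?c * h d0)) \<le> exp ((A + 3) * A) * 1"
    by (intro mult_left_mono) auto
  moreover have "exp ((A + 3) * A) * (r * (?c * h d0)) = r * h d0"
    using exp_add[of "(A + 3) * A" "- (A + 3) * A"] by (simp add: algebra_simps)
  ultimately have "r * h d0 \<le> exp ((A + 3) * A)" by linarith
  then have "4 * h d0 \<le> 4 * exp ((A + 3) * A) / r" using r_ge by (simp add: field_simps)
  with le_mode[of d] show ?thesis by simp
qed

text \<open>At distance \<open>r\<close> from \<open>D\<close> consecutive values differ by a factor
  of about \<open>1 - 1 / r\<close>, so each outer part sums to \<open>O(r)\<close> times its edge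
  value, and about \<open>2 * r\<close> values lie between. The total is
  \<open>(16 * r + 12) * h d0\<close>, and \<open>12 \<le> 6 * r\<close>.\<close>

lemma mode_ge: "1 \<le> 22 * r * h d0"
proof -
  define a1 where "a1 = nat \<lfloor>D - r\<rfloor>"
  define b1 where "b1 = nat \<lceil>D + r\<rceil>"
  have rD: "2 * r \<le> D" using r_ge by (simp add: D_eq)
  have a1: "real a1 \<le> D - r" "D - r < real a1 + 1" unfolding a1_def using rD r_ge by linarith+
  have b1: "D + r \<le> real b1" "real b1 < D + r + 1" unfolding b1_def using rD r_ge by linarith+
  have left: "(\<Sum>d<a1. h d) \<le> h a1 / (1 / r)"
  proof (rule growth_sum_le)
    fix d assume "d < a1"
    then have d: "real d + 1 \<le> D - r" using a1 by linarith
    have "D * h d \<le> (real d + 1) * h (Suc d)" using d r_ge by (intro below) linarith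
    also have "\<dots> \<le> (D - r) * h (Suc d)" using d nonneg by (intro mult_right_mono) auto
    also have "D - r = D * (1 - 1 / r)" using r_ge by (simp add: D_eq field_simps)
    finally show "h d \<le> (1 - 1 / r) * h (Suc d)"
      using D_ge by (simp only: mult.assoc mult_le_cancel_left_pos)
  qed (use nonneg r_ge in auto)
  have right: "(\<Sum>d\<in>{b1..<b1 + M}. h d) \<le> h b1 / (1 / (r + 1))"
  proof (rule decay_sum_le)
    fix d assume "d \<ge> b1"
    then have d: "D + r \<le> real d" using b1 by linarith
    have "(D + r) * h (Suc d) \<le> (real d + 1) * h (Suc d)" using d nonneg by (intro mult_right_mono) auto
    also have "\<dots> \<le> D * h d" using d r_ge by (intro above) linarith
    also have "\<dots> = (D + r) * (1 - 1 / (r + 1)) * h d" using r_ge by (simp add: D_eq field_simps)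
    finally show "h (Suc d) \<le> (1 - 1 / (r + 1)) * h d"
      using D_ge r_ge by (simp only: mult.assoc) (subst (asm) mult_le_cancel_left_pos, auto)
  qed (use nonneg r_ge in auto)
  have ab: "a1 \<le> b1" using a1 b1 r_ge by linarith
  have mid: "(\<Sum>d\<in>{a1..<b1}. h d) \<le> (2 * r + 2) * (4 * h d0)"
  proof -
    have "(\<Sum>d\<in>{a1..<b1}. h d) \<le> real (card {a1..<b1}) * (4 * h d0)"
      using le_mode by (intro sum_bounded_above) auto
    also have "\<dots> \<le> (2 * r + 2) * (4 * h d0)"
      using a1 b1 ab nonneg[of d0] by (intro mult_right_mono) (auto simp: of_nat_diff)
    finally show ?thesis .
  qed
  have "1 = (\<Sum>d\<le>M. h d)" using total by simp
  also have "\<dots> \<le> sum h ({..<a1} \<union> {a1..<b1} \<union> {b1..<b1 + M})"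
  proof -
    have "(\<Sum>d\<le>M. h d) = sum h ({..M} \<union> {..<b1 + M})"
      using zero by (intro sum.mono_neutral_left) (auto)
    also have "{..M} \<union> {..<b1 + M} = {..<b1 + M}"
      using b1 rD r_ge by auto
    also have "\<dots> = {..<a1} \<union> {a1..<b1} \<union> {b1..<b1 + M}" using ab by auto
    finally show ?thesis by simp
  qed
  also have "\<dots> = (\<Sum>d<a1. h d) + (\<Sum>d\<in>{a1..<b1}. h d) + (\<Sum>d\<in>{b1..<b1 + M}. h d)"
    using ab by (subst sum.union_disjoint; (subst sum.union_disjoint)?; auto)
  also have "\<dots> \<le> r * h a1 + (2 * r + 2) * (4 * h d0) + (r + 1) * h b1"
    using left right mid by (simp add: mult.commute)
  also have "\<dots> \<le> r * (4 * h d0) + (2 * r + 2) * (4 * h d0) + (r + 1) * (4 * h d0)"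
    using le_mode r_ge by (intro add_mono mult_left_mono) auto
  also have "\<dots> = (16 * r + 12) * h d0" by (simp add: algebra_simps)
  also have "\<dots> \<le> (22 * r) * h d0" using r_ge nonneg by (intro mult_right_mono) auto
  finally show ?thesis .
qed

lemma pmf_ge:
  assumes "D + 1 \<le> real d" "real d \<le> D + A * r"
  shows "exp (- (A + 3) * A) / (22 * r) \<le> h d"
proof -
  have "d0 \<le> d" using assms d0 by linarith
  moreover have "exp (- (A + 3) * A) * h d0 \<le> h (d0 + (d - d0))"
    using assms d0 calculation by (intro ge_mode) (auto simp: of_nat_diff)
  moreover have "exp (- (A + 3) * A) / (22 * r) \<le> exp (- (A + 3) * A) * h d0"
    using mode_ge r_ge by (simp add: field_simps)
  ultimately show ?thesis by simp
qed

text \<open>A Gaussian tail with its Mills factor: beyond \<open>D + Y\<close> the decay is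
  geometric of rate \<open>Y / (2 * D)\<close>, so the tail is its first term times
  \<open>2 * D / Y\<close>. Together with \<open>1 / r\<close> this is of order
  \<open>sqrt D / Y\<close>, the saving on which the union bound relies.\<close>

lemma tail_le:
  assumes "Y \<ge> 1" "Y + 1 \<le> D"
  shows "sum h {d. d \<le> M \<and> D + Y \<le> real d}
       \<le> 4 * exp ((A + 3) * A) / r * (2 * D / Y) * exp (- (Y * (Y - 1) / (2 * D)) + (Y + 1) ^ 3 / D\<^sup>2)"
proof -
  \<comment> \<open>With \<open>z = (j + 1) / D\<close>, each step multiplies by at most
    \<open>1 / (1 + z) \<le> exp (- z + z^2)\<close>. The linear terms add up to
    \<open>j * (j + 1) / (2 * D)\<close>, and the squares stay below
    \<open>j^3 / D^2\<close>.\<close>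
  have chain: "h (d0 + j) \<le> h d0 * exp (- (real j * (real j + 1) / (2 * D)) + real j ^ 3 / D\<^sup>2)"
    if "real j \<le> D" for j
    using that
  proof (induction j)
    case (Suc j)
    let ?z = "(real j + 1) / D"
    let ?e = "\<lambda>j::real. exp (- (j * (j + 1) / (2 * D)) + j ^ 3 / D\<^sup>2)"
    have z: "0 \<le> ?z" "?z \<le> 1" using Suc D_ge by auto
    have "D * (1 + ?z) * h (Suc (d0 + j)) \<le> (real (d0 + j) + 1) * h (Suc (d0 + j))"
      using d0 D_ge nonneg by (intro mult_right_mono) (auto simp: field_simps)
    also have "\<dots> \<le> D * h (d0 + j)" using d0 by (intro above) auto
    finally have 1: "(1 + ?z) * h (Suc (d0 + j)) \<le> h (d0 + j)"
      using D_ge by (simp only: mult.assoc mult_le_cancel_left_pos)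
    have "exp (?z - ?z\<^sup>2) \<le> 1 + ?z"
      using ln_one_plus_pos_lower_bound[OF z] z by (metis add_pos_nonneg exp_le_cancel_iff exp_ln zero_less_one)
    then have "exp (?z - ?z\<^sup>2) * h (Suc (d0 + j)) \<le> (1 + ?z) * h (Suc (d0 + j))"
      using nonneg by (intro mult_right_mono) auto
    with 1 have 2: "exp (?z - ?z\<^sup>2) * h (Suc (d0 + j)) \<le> h (d0 + j)" by linarith
    have "h (Suc (d0 + j)) = exp (- ?z + ?z\<^sup>2) * (exp (?z - ?z\<^sup>2) * h (Suc (d0 + j)))"
      by (simp add: mult.assoc[symmetric] mult_exp_exp)
    also have "\<dots> \<le> exp (- ?z + ?z\<^sup>2) * h (d0 + j)" using 2 by (intro mult_left_mono) auto
    also have "\<dots> \<le> exp (- ?z + ?z\<^sup>2) * (h d0 * ?e (real j))"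
      using Suc by (intro mult_left_mono) auto
    also have "\<dots> = h d0 * exp (- ?z + ?z\<^sup>2 + (- (real j * (real j + 1) / (2 * D)) + real j ^ 3 / D\<^sup>2))"
      by (simp only: exp_add mult_ac)
    also have "\<dots> \<le> h d0 * ?e (real (Suc j))"
    proof (intro mult_left_mono nonneg, subst exp_le_cancel_iff)
      have sj: "real (Suc j) = real j + 1" by simp
      have "real j ^ 3 + (real j + 1)\<^sup>2 \<le> (real j + 1) ^ 3"
        by (simp add: power2_eq_square power3_eq_cube algebra_simps)
      then have "real j ^ 3 / D\<^sup>2 + ?z\<^sup>2 \<le> (real j + 1) ^ 3 / D\<^sup>2"
        unfolding power_divide add_divide_distrib[symmetric] by (intro divide_right_mono) auto
      moreover have "?z + real j * (real j + 1) / (2 * D) = (real j + 1) * (real j + 1 + 1) / (2 * D)"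
        using D_ge by (simp add: field_simps)
      ultimately show "- ?z + ?z\<^sup>2 + (- (real j * (real j + 1) / (2 * D)) + real j ^ 3 / D\<^sup>2)
          \<le> - (real (Suc j) * (real (Suc j) + 1) / (2 * D)) + real (Suc j) ^ 3 / D\<^sup>2"
        unfolding sj by linarith
    qed
    finally show ?case by simp
  qed simp
  \<comment> \<open>Rounding both \<open>D\<close> and \<open>D + Y\<close> up changes their
    distance by at most 1, whence \<open>Y - 1\<close> and \<open>Y + 1\<close> in the
    bound.\<close>
  define t0 where "t0 = nat \<lceil>D + Y\<rceil>"
  have t0: "D + Y \<le> real t0" "real t0 < D + Y + 1" unfolding t0_def using assms D_ge by linarith+
  have dt: "d0 \<le> t0" using d0 t0 assms by linarith
  let ?T = "t0 - d0"
  have T: "Y - 1 \<le> real ?T" "real ?T \<le> Y + 1" using dt d0 t0 by (auto simp: of_nat_diff)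
  let ?E = "exp (- (Y * (Y - 1) / (2 * D)) + (Y + 1) ^ 3 / D\<^sup>2)"
  let ?C = "4 * exp ((A + 3) * A) / r"
  have "h t0 \<le> h d0 * exp (- (real ?T * (real ?T + 1) / (2 * D)) + real ?T ^ 3 / D\<^sup>2)"
    using chain[of ?T] T assms dt by simp
  also have "\<dots> \<le> h d0 * ?E"
  proof (intro mult_left_mono nonneg, subst exp_le_cancel_iff)
    have "(Y - 1) * Y \<le> real ?T * (real ?T + 1)" using T assms by (intro mult_mono) auto
    then have "Y * (Y - 1) / (2 * D) \<le> real ?T * (real ?T + 1) / (2 * D)"
      using D_ge by (intro divide_right_mono) (auto simp: mult.commute)
    moreover have "real ?T ^ 3 / D\<^sup>2 \<le> (Y + 1) ^ 3 / D\<^sup>2"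
      using T by (intro divide_right_mono power_mono) auto
    ultimately show "- (real ?T * (real ?T + 1) / (2 * D)) + real ?T ^ 3 / D\<^sup>2
        \<le> - (Y * (Y - 1) / (2 * D)) + (Y + 1) ^ 3 / D\<^sup>2" by linarith
  qed
  also have "\<dots> \<le> ?C * ?E" using pmf_le by (intro mult_right_mono) auto
  finally have ht: "h t0 \<le> ?C * ?E" .
  have "sum h {d. d \<le> M \<and> D + Y \<le> real d} \<le> (\<Sum>d\<in>{t0..<t0 + Suc M}. h d)"
  proof (intro sum_mono2 nonneg)
    show "{d. d \<le> M \<and> D + Y \<le> real d} \<subseteq> {t0..<t0 + Suc M}" by (auto simp: t0_def)
  qed auto
  also have "\<dots> \<le> h t0 / (Y / (2 * D))"
  proof (rule decay_sum_le)
    fix d assume "d \<ge> t0"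
    then have d: "D + Y \<le> real d" using t0 by linarith
    have "(D + Y) * h (Suc d) \<le> (real d + 1) * h (Suc d)" using d nonneg by (intro mult_right_mono) auto
    also have "\<dots> \<le> D * h d" using d assms by (intro above) linarith
    also have "\<dots> \<le> (D + Y) * (1 - Y / (2 * D)) * h d"
    proof (intro mult_right_mono nonneg)
      have "Y * Y \<le> Y * D" using assms by (intro mult_left_mono) auto
      then show "D \<le> (D + Y) * (1 - Y / (2 * D))" using D_ge by (simp add: field_simps)
    qed
    finally show "h (Suc d) \<le> (1 - Y / (2 * D)) * h d"
      using D_ge assms by (simp only: mult.assoc) (subst (asm) mult_le_cancel_left_pos, auto)
  qed (use nonneg D_ge assms in auto)
  also have "\<dots> = h t0 * (2 * D / Y)" using D_ge assms by (simp add: field_simps)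
  also have "\<dots> \<le> ?C * ?E * (2 * D / Y)" using ht assms D_ge by (intro mult_right_mono) auto
  finally show ?thesis by (simp add: mult_ac)
qed

end

subsection \<open>The hypergeometric law and the likelihood ratio\<close>

lemma hypergeom_nonneg: "hypergeom N K m d \<ge> 0"
  by (simp add: hypergeom_def)

lemma hypergeom_eq_0: "d > K \<Longrightarrow> hypergeom N K m d = 0"
  by (simp add: hypergeom_def)

lemma sum_hypergeom:
  assumes "K \<le> m" "m \<le> N"
  shows "(\<Sum>d\<le>K. hypergeom N K m d) = 1"
proof -
  have "(\<Sum>d\<le>K. (K choose d) * ((N - K) choose (m - d)))
      = (\<Sum>d\<le>m. (K choose d) * ((N - K) choose (m - d)))"
    using assms by (intro sum.mono_neutral_left) auto
  also have "\<dots> = N choose m" using vandermonde[of K "N - K" m] assms by simp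
  finally have "real (\<Sum>d\<le>K. (K choose d) * ((N - K) choose (m - d))) = real (N choose m)" by simp
  then show ?thesis using assms
    by (simp add: hypergeom_def sum_divide_distrib[symmetric])
qed

lemma Suc_times_binomial_Suc: "Suc d * (K choose Suc d) = (K - d) * (K choose d)"
  by (simp only: binomial_absorption binomial_absorb_comp)

lemma hypergeom_step:
  assumes "K \<le> m" "K + m \<le> N" "d < K"
  shows "(real d + 1) * (real N - real K - real m + real d + 1) * hypergeom N K m (Suc d)
       = (real K - real d) * (real m - real d) * hypergeom N K m d"
proof -
  have 1: "(real d + 1) * real (K choose Suc d) = (real K - real d) * real (K choose d)"
  proof -
    have "real (Suc d * (K choose Suc d)) = real ((K - d) * (K choose d))"
      by (simp only: Suc_times_binomial_Suc)
    then show ?thesis using assms by (simp add: of_nat_diff algebra_simps)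
  qed
  have 2: "(real N - real K - real m + real d + 1) * real ((N - K) choose (m - Suc d))
      = (real m - real d) * real ((N - K) choose (m - d))"
  proof -
    have s: "Suc (m - Suc d) = m - d" using assms by simp
    have "real (Suc (m - Suc d) * ((N - K) choose Suc (m - Suc d)))
        = real ((N - K - (m - Suc d)) * ((N - K) choose (m - Suc d)))"
      by (simp only: Suc_times_binomial_Suc)
    then have "real (m - d) * real ((N - K) choose (m - d))
        = real (N - K - (m - Suc d)) * real ((N - K) choose (m - Suc d))"
      unfolding s by (simp only: of_nat_mult)
    moreover have "real (N - K - (m - Suc d)) = real N - real K - real m + real d + 1"
      using assms by (simp add: of_nat_diff)
    moreover have "real (m - d) = real m - real d" using assms by (simp add: of_nat_diff)
    ultimately show ?thesis by simp
  qed
  have "(real d + 1) * (real N - real K - real m + real d + 1) * hypergeom N K m (Suc d)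
      = ((real d + 1) * real (K choose Suc d))
        * ((real N - real K - real m + real d + 1) * real ((N - K) choose (m - Suc d))) / real (N choose m)"
    by (simp only: hypergeom_def times_divide_eq_right mult_ac)
  also have "\<dots> = (real K - real d) * (real m - real d) * hypergeom N K m d"
    unfolding 1 2 by (simp only: hypergeom_def times_divide_eq_right mult_ac)
  finally show ?thesis .
qed

text \<open>Since \<open>K * m = D * N\<close>, the ratio
  \<open>(K - d) * (m - d) / (N - K - m + d)\<close> equals \<open>D\<close> exactly at
  \<open>d = D\<close>, and it decreases in \<open>d\<close>; this settles \<open>above\<close> and
  \<open>below\<close> up to the \<open>+ 1\<close> of the exact recursion. The factor
  \<open>3 * A + 4\<close> makes the population so large that moving \<open>d\<close> by
  \<open>A * r\<close> hardly changes the ratio, which is \<open>near\<close>.\<close>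

lemma hypergeom_gaussian_shape:
  fixes A D r :: real
  assumes "K \<le> m" "K + m \<le> N" "real K * real m = D * real N" "D = r * r" "r \<ge> 2" "A \<ge> 1"
    and K: "(3 * A + 4) * D \<le> real K" and S: "(3 * A + 4) * D \<le> real N - real K - real m"
  shows "gaussian_shape (hypergeom N K m) D r A K"
proof
  have D_ge: "D \<ge> 4" using mult_mono[of 2 r 2 r] assms by simp
  have rD: "r \<le> D" using assms by simp
  have id: "(real K - D) * (real m - D) = D * (real N - real K - real m + D)"
    using assms(3) by (simp add: algebra_simps)
  have AD: "3 * D \<le> 3 * A * D" using assms D_ge by simp
  have AD4: "(3 * A + 4) * D = 3 * A * D + 4 * D" by algebra
  have DK: "D \<le> real K" using K AD D_ge AD4 by linarith
  have Km: "real K \<le> real m" using assms by simp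
  have Spos: "0 \<le> real N - real K - real m" using S AD D_ge AD4 by linarith
  show "hypergeom N K m d \<ge> 0" for d by (rule hypergeom_nonneg)
  show "(\<Sum>d\<le>K. hypergeom N K m d) = 1" using assms by (intro sum_hypergeom) auto
  show "hypergeom N K m d = 0" if "d > K" for d using that by (rule hypergeom_eq_0)
  show "D = r * r" "r \<ge> 2" "A \<ge> 1" by fact+
  fix d
  let ?h = "hypergeom N K m"
  let ?Q = "real N - real K - real m + real d + 1"
  have Q: "?Q > 0" using Spos by simp
  note step = hypergeom_step[OF assms(1,2), of d]
  show "(real d + 1) * ?h (Suc d) \<le> D * ?h d" if d: "real d \<ge> D"
  proof (cases "d < K")
    case True
    have "(real K - real d) * (real m - real d) \<le> (real K - D) * (real m - D)"
      using d True Km by (intro mult_mono) auto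
    also have "\<dots> \<le> D * ?Q" unfolding id using d D_ge by (intro mult_left_mono) auto
    finally have "(real K - real d) * (real m - real d) * ?h d \<le> D * ?Q * ?h d"
      by (intro mult_right_mono hypergeom_nonneg)
    then have "?Q * ((real d + 1) * ?h (Suc d)) \<le> ?Q * (D * ?h d)"
      using step[OF True] by (simp only: mult_ac)
    then show ?thesis using Q by (simp only: mult_le_cancel_left_pos)
  next
    case False
    then show ?thesis using hypergeom_nonneg[of N K m d] D_ge by (simp add: hypergeom_eq_0)
  qed
  show "D * ?h d \<le> (real d + 1) * ?h (Suc d)" if d: "real d + 1 \<le> D"
  proof -
    have dK: "d < K" using d DK by linarith
    have "D * ?Q \<le> (real K - D) * (real m - D)" unfolding id using d D_ge by (intro mult_left_mono) auto
    also have "\<dots> \<le> (real K - real d) * (real m - real d)"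
      using d DK Km by (intro mult_mono) auto
    finally have "D * ?Q * ?h d \<le> (real K - real d) * (real m - real d) * ?h d"
      by (intro mult_right_mono hypergeom_nonneg)
    then have "?Q * (D * ?h d) \<le> ?Q * ((real d + 1) * ?h (Suc d))"
      using step[OF dK] by (simp only: mult_ac)
    then show ?thesis using Q by (simp only: mult_le_cancel_left_pos)
  qed
  show "(1 - 1 / r) * D * ?h d \<le> (real d + 1) * ?h (Suc d)"
    if d: "D - 1 \<le> real d" "real d \<le> D + A * r"
  proof -
    define y where "y = max 0 (real d - D)"
    have Ar: "0 \<le> A * r" "A * r \<le> A * D" using assms rD by (auto intro: mult_left_mono)
    have y: "0 \<le> y" "y \<le> A * r" "real d \<le> D + y" using d Ar by (auto simp: y_def)
    \<comment> \<open>These are the three factors of the ratio at \<open>d = D\<close>. Each changes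
      by a relative \<open>1 / (3 * r)\<close> at most, a third of the loss \<open>1 / r\<close>
      that is allowed.\<close>
    define P R S where "P = real K - D" and "R = real m - D" and "S = real N - real K - real m + D"
    have PRS: "P * R = D * S" using id by (simp add: P_def R_def S_def)
    have P: "3 * A * D \<le> P" "P \<le> R" using K D_ge Km AD4 unfolding P_def R_def by linarith+
    have AD5: "(3 * A + 5) * D = 3 * A * D + 5 * D" by algebra
    have S1: "(3 * A + 5) * D \<le> S" using S AD4 AD5 unfolding S_def by linarith
    have Ppos: "P > 0" using P AD D_ge by linarith
    have Spos: "S > 0" using Spos D_ge by (simp add: S_def)
    have y1: "3 * r * y \<le> P"
    proof -
      have "3 * r * y \<le> 3 * r * (A * r)" using y assms by (intro mult_left_mono) auto
      also have "\<dots> = 3 * A * D" by (simp add: assms(4))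
      finally show ?thesis using P by linarith
    qed
    have y2: "3 * r * (y + 1) \<le> S"
    proof -
      have "3 * r * y \<le> 3 * r * (A * r)" using y assms by (intro mult_left_mono) auto
      also have "\<dots> = 3 * A * D" by (simp add: assms(4))
      finally have "3 * r * (y + 1) \<le> 3 * A * D + 3 * D" using rD by (simp add: algebra_simps)
      also have "\<dots> \<le> (3 * A + 5) * D" using D_ge AD5 by linarith
      finally show ?thesis using S1 by linarith
    qed
    have yP: "y \<le> P / (3 * r)" "y \<le> R / (3 * r)" "y + 1 \<le> S / (3 * r)"
      using y1 y2 P assms by (auto simp: field_simps)
    have r0: "r > 0" using assms by simp
    have dK: "d < K"
    proof -
      have "A * D + D < (3 * A + 4) * D" using AD4 D_ge AD by linarith
      then show ?thesis using K Ar y by linarith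
    qed
    have "(1 - 1 / r) * D * ?Q \<le> (1 - 1 / r) * D * (S + (y + 1))"
      using y assms D_ge by (intro mult_left_mono) (auto simp: S_def)
    also have "\<dots> \<le> (1 - 1 / r) * D * (S + S / (3 * r))"
      using yP assms D_ge by (intro mult_left_mono add_mono) auto
    also have "\<dots> = D * S * ((1 - 1 / r) * (1 + 1 / (3 * r)))"
      by (simp add: algebra_simps)
    also have "\<dots> \<le> D * S * (1 - 2 / (3 * r))"
    proof (intro mult_left_mono)
      have "(1 - 1 / r) * (1 + 1 / (3 * r)) = 1 - 2 / (3 * r) - 1 / (3 * r * r)"
        using r0 by (simp add: field_simps)
      then show "(1 - 1 / r) * (1 + 1 / (3 * r)) \<le> 1 - 2 / (3 * r)" using r0 by simp
    qed (use D_ge Spos in auto)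
    also have "\<dots> = P * R - (P / (3 * r)) * R - P * (R / (3 * r))"
      unfolding PRS[symmetric] by (simp add: algebra_simps)
    also have "\<dots> \<le> P * R - y * R - P * y"
      using yP P Ppos by (intro diff_mono mult_right_mono mult_left_mono) auto
    also have "\<dots> \<le> (P - y) * (R - y)" using y by (simp add: algebra_simps)
    also have "\<dots> \<le> (real K - real d) * (real m - real d)"
    proof (intro mult_mono)
      have "P / (3 * r) \<le> P" using Ppos assms by (simp add: field_simps)
      moreover have "R / (3 * r) \<le> R" using Ppos P assms by (simp add: field_simps)
      ultimately show "0 \<le> R - y" using yP by linarith
      show "0 \<le> real K - real d" using dK by simp
    qed (use y in \<open>auto simp: P_def R_def\<close>)
    finally have "(1 - 1 / r) * D * ?Q * ?h d \<le> (real K - real d) * (real m - real d) * ?h d"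
      by (intro mult_right_mono hypergeom_nonneg)
    then have "?Q * ((1 - 1 / r) * D * ?h d) \<le> ?Q * ((real d + 1) * ?h (Suc d))"
      using step[OF dK] by (simp only: mult_ac)
    then show ?thesis using Q by (simp only: mult_le_cancel_left_pos)
  qed
qed

section \<open>Null expectations and the formula for the likelihood ratio\<close>

definition graph_mean :: "nat \<Rightarrow> nat \<Rightarrow> (nat set set \<Rightarrow> real) \<Rightarrow> real" where
  "graph_mean n m f = (\<Sum>G\<in>graphs n m. f G) / real (N_pairs n choose m)"

lemma prob_P0:
  assumes "m \<le> N_pairs n"
  shows "measure_pmf.prob (P0 n m) X = graph_mean n m (indicator X)"
proof -
  have "card (graphs n m) \<noteq> 0" using assms by (simp add: card_graphs)
  then have ne: "graphs n m \<noteq> {}" by auto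
  have "measure_pmf.prob (P0 n m) X = card (graphs n m \<inter> X) / card (graphs n m)"
    unfolding P0_def graphs_def[symmetric] by (rule measure_pmf_of_set[OF ne finite_graphs])
  also have "real (card (graphs n m \<inter> X)) = (\<Sum>G\<in>graphs n m. indicator X G)"
    by (simp add: indicator_def sum.If_cases Int_def)
  finally show ?thesis by (simp add: graph_mean_def card_graphs)
qed

text \<open>For fixed \<open>S\<close> the equation \<open>S \<union> R = G\<close> has the single
  solution \<open>R = G - S\<close> if \<open>S \<subseteq> G\<close>, and none otherwise. So each
  hub contributes the number of \<open>k\<close>-subsets of its edges in \<open>G\<close>, all with
  the same probability.\<close>

lemma pmf_P1:
  assumes "n \<ge> 1" "k \<le> n - 1" "k \<le> m" "m \<le> N_pairs n"
  shows "pmf (P1 n m k) G =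
    (if G \<in> graphs n m then (\<Sum>v<n. real (degree G v choose k))
       / (real n * real ((n - 1) choose k) * real ((N_pairs n - k) choose (m - k))) else 0)"
proof -
  define SS where "SS v = {S. S \<subseteq> incident_edges n v \<and> card S = k}" for v
  define RR where "RR S = {R. R \<subseteq> all_edges n - S \<and> card R = m - k}" for S
  have finSS: "finite (SS v)" for v
    unfolding SS_def by (rule finite_subset[of _ "Pow (incident_edges n v)"]) auto
  have finRR: "finite (RR S)" for S
    unfolding RR_def by (rule finite_subset[of _ "Pow (all_edges n)"]) auto
  have cSS: "card (SS v) = (n - 1) choose k" if "v < n" for v
    unfolding SS_def using n_subsets[of "incident_edges n v" k] that by (simp add: card_incident_edges)
  have S: "S \<subseteq> all_edges n" "card S = k" "finite S" if "S \<in> SS v" for S v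
    using that incident_edges_subset[of n v] by (auto simp: SS_def intro: finite_subset)
  have cRR: "card (RR S) = (N_pairs n - k) choose (m - k)" if "S \<in> SS v" for S v
    unfolding RR_def using n_subsets[of "all_edges n - S" "m - k"] S[OF that]
    by (simp add: card_Diff_subset card_all_edges)
  have neSS: "SS v \<noteq> {}" if "v < n" for v
  proof -
    have "card (SS v) \<noteq> 0" using assms that by (simp add: cSS)
    then show ?thesis by auto
  qed
  have neRR: "RR S \<noteq> {}" if "S \<in> SS v" for S v
  proof -
    have "card (RR S) \<noteq> 0" using assms that by (simp add: cRR)
    then show ?thesis by auto
  qed
  let ?a = "real ((n - 1) choose k)" and ?b = "real ((N_pairs n - k) choose (m - k))"
  have inner: "pmf (pmf_of_set (RR S) \<bind> (\<lambda>R. return_pmf (S \<union> R))) G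
      = (if G \<in> graphs n m \<and> S \<subseteq> G then 1 / ?b else 0)" if "S \<in> SS v" for S v
  proof -
    note S = S[OF that]
    have "pmf (pmf_of_set (RR S) \<bind> (\<lambda>R. return_pmf (S \<union> R))) G
        = (\<Sum>R\<in>RR S. indicator {R. S \<union> R = G} R) / real (card (RR S))"
      by (subst pmf_bind, subst integral_pmf_of_set[OF neRR[OF that] finRR])
         (auto intro!: sum.cong arg_cong2[where f = "(/)"] simp: indicator_def)
    also have "(\<Sum>R\<in>RR S. indicator {R. S \<union> R = G} R) = real (card (RR S \<inter> {R. S \<union> R = G}))"
      using finRR by (simp add: indicator_def sum.If_cases Int_def)
    also have "RR S \<inter> {R. S \<union> R = G} = (if G \<in> graphs n m \<and> S \<subseteq> G then {G - S} else {})"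
    proof (cases "G \<in> graphs n m \<and> S \<subseteq> G")
      case True
      then have "card (G - S) = m - k" using S by (simp add: card_Diff_subset graphs_def)
      then show ?thesis using True S by (auto simp: RR_def graphs_def)
    next
      case False
      have "G \<in> graphs n m \<and> S \<subseteq> G" if R: "R \<in> RR S" "S \<union> R = G" for R
      proof -
        have "finite R" "S \<inter> R = {}" using R(1) by (auto simp: RR_def intro: finite_subset)
        then have "card (S \<union> R) = card S + card R" using S by (simp add: card_Un_disjoint)
        then have "card (S \<union> R) = m" using S R(1) assms by (simp add: RR_def)
        then show ?thesis using R S by (auto simp: graphs_def RR_def)
      qed
      with False show ?thesis by auto
    qed
    finally show ?thesis by (simp add: cRR[OF that])
  qed
  have mid: "pmf (pmf_of_set (SS v) \<bind> (\<lambda>S. pmf_of_set (RR S) \<bind> (\<lambda>R. return_pmf (S \<union> R)))) G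
      = (if G \<in> graphs n m then real (degree G v choose k) / (?a * ?b) else 0)" if v: "v < n" for v
  proof -
    have cS: "G \<in> graphs n m \<Longrightarrow> card {S \<in> SS v. S \<subseteq> G} = degree G v choose k"
    proof -
      assume G: "G \<in> graphs n m"
      have "{S \<in> SS v. S \<subseteq> G} = {S. S \<subseteq> G \<inter> incident_edges n v \<and> card S = k}"
        by (auto simp: SS_def)
      moreover have "degree G v = card (G \<inter> incident_edges n v)"
        using G by (intro degree_eq_card_inter) (simp add: graphs_def)
      ultimately show ?thesis using n_subsets[of "G \<inter> incident_edges n v" k] by simp
    qed
    have "pmf (pmf_of_set (SS v) \<bind> (\<lambda>S. pmf_of_set (RR S) \<bind> (\<lambda>R. return_pmf (S \<union> R)))) G
        = (\<Sum>S\<in>SS v. if G \<in> graphs n m \<and> S \<subseteq> G then 1 / ?b else 0) / ?a"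
      by (subst pmf_bind, subst integral_pmf_of_set[OF neSS[OF v] finSS])
         (simp add: inner cSS[OF v] cong: sum.cong)
    also have "\<dots> = (if G \<in> graphs n m then real (card {S \<in> SS v. S \<subseteq> G}) / (?a * ?b) else 0)"
      using finSS by (simp add: sum.If_cases Int_def)
    finally show ?thesis using cS by simp
  qed
  have P1_eq: "P1 n m k = pmf_of_set {..<n} \<bind> (\<lambda>v. pmf_of_set (SS v)
          \<bind> (\<lambda>S. pmf_of_set (RR S) \<bind> (\<lambda>R. return_pmf (S \<union> R))))"
    by (simp add: P1_def SS_def RR_def)
  let ?q = "\<lambda>v. pmf_of_set (SS v) \<bind> (\<lambda>S. pmf_of_set (RR S) \<bind> (\<lambda>R. return_pmf (S \<union> R)))"
  have "pmf (P1 n m k) G = measure_pmf.expectation (pmf_of_set {..<n}) (\<lambda>v. pmf (?q v) G)"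
    unfolding P1_eq by (rule pmf_bind)
  also have "\<dots> = (\<Sum>v<n. pmf (?q v) G) / real (card {..<n})"
    using assms by (intro integral_pmf_of_set) (auto simp: lessThan_empty_iff)
  also have "(\<Sum>v<n. pmf (?q v) G)
      = (\<Sum>v<n. if G \<in> graphs n m then real (degree G v choose k) / (?a * ?b) else 0)"
    using mid by (intro sum.cong) auto
  finally show ?thesis by (simp add: sum_divide_distrib mult_ac)
qed

lemma LR_eq:
  assumes "n \<ge> 1" "k \<le> n - 1" "k \<le> m" "m \<le> N_pairs n" "G \<in> graphs n m"
  shows "LR n m k G = (\<Sum>v<n. hub_weight n m k (degree G v))"
proof -
  have ne: "graphs n m \<noteq> {}" using assms by auto
  have "pmf (P0 n m) G = 1 / real (N_pairs n choose m)"
    unfolding P0_def graphs_def[symmetric] using assms ne by (simp add: card_graphs)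
  then show ?thesis
    using assms by (simp add: LR_def pmf_P1 hub_weight_def sum_distrib_right sum_divide_distrib)
qed

lemma prob_P1:
  assumes "n \<ge> 1" "k \<le> n - 1" "k \<le> m" "m \<le> N_pairs n"
  shows "measure_pmf.prob (P1 n m k) X = (\<Sum>v<n. graph_mean n m (\<lambda>G. hub_weight n m k (degree G v) * indicator X G))"
proof -
  have sub: "set_pmf (P1 n m k) \<subseteq> graphs n m"
    using pmf_P1[OF assms] by (auto simp: set_pmf_eq split: if_splits)
  have "measure_pmf.prob (P1 n m k) X = measure_pmf.prob (P1 n m k) (graphs n m \<inter> X)"
  proof -
    have "X \<inter> set_pmf (P1 n m k) = (graphs n m \<inter> X) \<inter> set_pmf (P1 n m k)" using sub by auto
    then show ?thesis
      using measure_Int_set_pmf[of "P1 n m k" X] measure_Int_set_pmf[of "P1 n m k" "graphs n m \<inter> X"] by simp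
  qed
  also have "\<dots> = (\<Sum>G\<in>graphs n m \<inter> X. pmf (P1 n m k) G)"
    by (simp add: measure_measure_pmf_finite)
  also have "\<dots> = (\<Sum>G\<in>graphs n m. pmf (P1 n m k) G * indicator X G)"
    by (simp add: indicator_def sum.inter_restrict if_distrib cong: if_cong)
  also have "\<dots> = (\<Sum>G\<in>graphs n m. \<Sum>v<n. hub_weight n m k (degree G v) * indicator X G / real (N_pairs n choose m))"
    using assms by (intro sum.cong refl)
      (simp add: pmf_P1 hub_weight_def sum_distrib_right sum_divide_distrib mult.assoc)
  also have "\<dots> = (\<Sum>v<n. \<Sum>G\<in>graphs n m. hub_weight n m k (degree G v) * indicator X G / real (N_pairs n choose m))"
    by (rule sum.swap)
  finally show ?thesis unfolding graph_mean_def sum_divide_distrib .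
qed

lemma graph_mean_degree:
  assumes "v < n" "n - 1 \<le> m"
  shows "graph_mean n m (\<lambda>G. f (degree G v)) = (\<Sum>d\<le>n - 1. hypergeom (N_pairs n) (n - 1) m d * f d)"
proof -
  have "(\<Sum>G\<in>graphs n m. f (degree G v))
      = (\<Sum>d\<le>n - 1. \<Sum>G\<in>{G \<in> graphs n m. degree G v = d}. f (degree G v))"
    using assms degree_le by (intro sum.group[symmetric]) (auto simp: graphs_def)
  also have "\<dots> = (\<Sum>d\<le>n - 1. real (card {G \<in> graphs n m. degree G v = d}) * f d)"
    by (intro sum.cong refl) simp
  also have "\<dots> = (\<Sum>d\<le>n - 1. real ((n - 1) choose d) * real ((N_pairs n - (n - 1)) choose (m - d)) * f d)"
    using assms by (intro sum.cong refl) (simp add: card_graphs_degree)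
  finally show ?thesis
    by (simp add: graph_mean_def hypergeom_def sum_divide_distrib)
qed

text \<open>Given the hub, its degree is \<open>k\<close> plus the number of hub edges among
  \<open>m - k\<close> edges drawn from the remaining \<open>N - k\<close> pairs. Weighting the null
  law produces exactly this shifted law; the algebra is the identity for choosing a subset of a
  subset.\<close>

lemma hub_weight_hypergeom:
  assumes "k \<le> d" "d \<le> n - 1" "n \<ge> 1" "n - 1 \<le> m" "m \<le> N_pairs n"
  shows "real n * (hypergeom (N_pairs n) (n - 1) m d * hub_weight n m k d)
       = hypergeom (N_pairs n - k) (n - 1 - k) (m - k) (d - k)"
proof -
  have "((n - 1) choose d) * (d choose k) = ((n - 1) choose k) * ((n - 1 - k) choose (d - k))"
    using assms by (intro choose_mult) auto
  then have c: "real ((n - 1) choose d) * real (d choose k)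
      = real ((n - 1) choose k) * real ((n - 1 - k) choose (d - k))"
    unfolding of_nat_mult[symmetric] by simp
  have pos: "real (N_pairs n choose m) > 0" "real ((n - 1) choose k) > 0" "real n > 0"
    using assms by auto
  have e: "N_pairs n - k - (n - 1 - k) = N_pairs n - (n - 1)" "m - k - (d - k) = m - d"
    using assms by auto
  have "real n * (hypergeom (N_pairs n) (n - 1) m d * hub_weight n m k d)
     = (real ((n - 1) choose d) * real (d choose k)) * real ((N_pairs n - (n - 1)) choose (m - d))
       / (real ((n - 1) choose k) * real ((N_pairs n - k) choose (m - k)))"
    using pos by (simp add: hypergeom_def hub_weight_def)
  also have "\<dots> = hypergeom (N_pairs n - k) (n - 1 - k) (m - k) (d - k)"
    unfolding c hypergeom_def e using pos by simp
  finally show ?thesis .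
qed

lemma hub_weight_eq_0: "d < k \<Longrightarrow> hub_weight n m k d = 0"
  by (simp add: hub_weight_def)

lemma hub_weight_nonneg: "hub_weight n m k d \<ge> 0"
  by (simp add: hub_weight_def)

lemma hub_weight_mono: "d \<le> d' \<Longrightarrow> hub_weight n m k d \<le> hub_weight n m k d'"
  unfolding hub_weight_def by (intro divide_right_mono mult_right_mono) (auto simp: binomial_right_mono)

subsection \<open>Approximate independence of two degrees\<close>

lemma graph_mean_mono:
  assumes "\<And>G. G \<in> graphs n m \<Longrightarrow> f G \<le> g G"
  shows "graph_mean n m f \<le> graph_mean n m g"
  unfolding graph_mean_def using assms by (intro divide_right_mono sum_mono) auto

lemma graph_mean_add: "graph_mean n m (\<lambda>G. f G + g G) = graph_mean n m f + graph_mean n m g"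
  by (simp add: graph_mean_def sum.distrib add_divide_distrib)

lemma graph_mean_cmult: "graph_mean n m (\<lambda>G. c * f G) = c * graph_mean n m f"
  by (simp add: graph_mean_def sum_distrib_left)

lemma graph_mean_sum: "graph_mean n m (\<lambda>G. \<Sum>i\<in>I. f i G) = (\<Sum>i\<in>I. graph_mean n m (f i))"
  unfolding graph_mean_def by (subst sum.swap) (simp add: sum_divide_distrib)

lemma graph_mean_const:
  assumes "m \<le> N_pairs n"
  shows "graph_mean n m (\<lambda>_. c) = c"
  using assms by (simp add: graph_mean_def card_graphs)

section \<open>Cross ratios of binomial coefficients\<close>

lemma binomial_shift_step:
  assumes "j < m" "m \<le> X"
  shows "(real X - real m + real j + 1) * real (X choose (m - Suc j)) = (real m - real j) * real (X choose (m - j))"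
proof -
  have s: "Suc (m - Suc j) = m - j" using assms by simp
  have "real (Suc (m - Suc j) * (X choose Suc (m - Suc j))) = real ((X - (m - Suc j)) * (X choose (m - Suc j)))"
    by (simp only: Suc_times_binomial_Suc)
  then have "real (m - j) * real (X choose (m - j)) = real (X - (m - Suc j)) * real (X choose (m - Suc j))"
    unfolding s by (simp only: of_nat_mult)
  moreover have "real (X - (m - Suc j)) = real X - real m + real j + 1"
    using assms by (simp add: of_nat_diff)
  moreover have "real (m - j) = real m - real j" using assms by (simp add: of_nat_diff)
  ultimately show ?thesis by simp
qed

text \<open>The quotient \<open>e (Suc j) / e j\<close> is \<open>(m - j) / (X - m + j + 1)\<close>,
  which decreases in \<open>j\<close>. The first part is therefore log-concavity; the second says
  how far it is from equality when the two indices are \<open>i\<close> apart.\<close>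

lemma binomial_shift_cross:
  fixes X m :: nat
  defines "e \<equiv> \<lambda>j. real (X choose (m - j))"
  assumes "m \<le> X" "j + i < m"
  shows "e j * e (Suc (j + i)) \<le> e (Suc j) * e (j + i)"
    and "e (Suc j) * e (j + i)
       \<le> ((1 + real i / (real m - real (j + i))) * (1 + real i / (real X - real m + 1))) * (e j * e (Suc (j + i)))"
proof -
  define a b a' b' where "a = real m - real j" and "b = real X - real m + real j + 1"
    and "a' = real m - real (j + i)" and "b' = real X - real m + real (j + i) + 1"
  have pos: "a > 0" "b > 0" "a' > 0" "b' > 0" using assms by (auto simp: a_def b_def a'_def b'_def)
  have epos: "e l > 0" for l using assms by (simp add: e_def)
  have 1: "b * e (Suc j) = a * e j"
    unfolding a_def b_def e_def using assms by (intro binomial_shift_step) auto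
  have 2: "b' * e (Suc (j + i)) = a' * e (j + i)"
    unfolding a'_def b'_def e_def using assms by (intro binomial_shift_step) auto
  have e1: "e (Suc j) = a / b * e j" and e2: "e (Suc (j + i)) = a' / b' * e (j + i)"
    using 1 2 pos by (simp_all add: field_simps)
  have aa: "a = a' + real i" "b' = b + real i" by (auto simp: a_def a'_def b_def b'_def)
  have "a' / b' \<le> a / b" using pos aa by (intro frac_le) auto
  then have "(a' / b') * (e j * e (j + i)) \<le> (a / b) * (e j * e (j + i))"
    using epos by (intro mult_right_mono) (auto intro: less_imp_le)
  then show "e j * e (Suc (j + i)) \<le> e (Suc j) * e (j + i)"
    unfolding e1 e2 by (simp add: mult_ac)
  have "1 + real i / a' = a / a'" "1 + real i / b = b' / b" using pos aa by (simp_all add: field_simps)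
  then have "a / b = (1 + real i / a') * (1 + real i / b) * (a' / b')"
    using pos by simp
  also have "\<dots> \<le> (1 + real i / a') * (1 + real i / (real X - real m + 1)) * (a' / b')"
    using pos assms by (intro mult_right_mono mult_left_mono add_left_mono divide_left_mono mult_pos_pos)
      (auto simp: b_def)
  finally have "(a / b) * (e j * e (j + i))
      \<le> (1 + real i / a') * (1 + real i / (real X - real m + 1)) * (a' / b') * (e j * e (j + i))"
    using epos by (intro mult_right_mono) (auto intro: less_imp_le)
  then show "e (Suc j) * e (j + i)
       \<le> ((1 + real i / (real m - real (j + i))) * (1 + real i / (real X - real m + 1))) * (e j * e (Suc (j + i)))"
    unfolding e1 e2 a'_def[symmetric] by (simp add: mult_ac)
qed

text \<open>The joint count of two degrees depends on \<open>a + b\<close> through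
  \<open>e (a + b)\<close>, and this cross ratio measures its distance from a product. If
  \<open>a\<close>, \<open>a'\<close> and \<open>b\<close>, \<open>b'\<close> are ordered alike, the
  left side has the more spread indices and log-concavity (\<open>lc\<close>) suffices. If they are
  ordered oppositely, log-concavity points the wrong way and \<open>up\<close> reverses it at a cost
  of \<open>\<Theta>\<close> for each of at most \<open>c\<close> steps.\<close>

lemma binomial_shift_rectangle:
  fixes X m c :: nat
  defines "e \<equiv> \<lambda>j. real (X choose (m - j))"
    and "\<Theta> \<equiv> (1 + real c / (real m - 2 * real c)) * (1 + real c / (real X - real m + 1))"
  assumes "m \<le> X" "2 * c < m" "a \<le> c" "b \<le> c" "a' \<le> c" "b' \<le> c"
  shows "e (a + b) * e (a' + b') \<le> \<Theta> ^ c * (e (a + b') * e (a' + b))"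
proof -
  have epos: "e l > 0" for l using assms by (simp add: e_def)
  have Theta: "\<Theta> \<ge> 1"
  proof -
    have "1 * 1 \<le> \<Theta>" unfolding \<Theta>_def using assms by (intro mult_mono) auto
    then show ?thesis by simp
  qed
  have lc: "e j * e (j + i + l) \<le> e (j + l) * e (j + i)" if "j + i + l \<le> m" for i j l
    using that
  proof (induction l)
    case (Suc l)
    have "e (j + l) * e (Suc (j + l + i)) \<le> e (Suc (j + l)) * e (j + l + i)"
      unfolding e_def using Suc assms by (intro binomial_shift_cross) auto
    moreover have "e j * e (j + i + l) \<le> e (j + l) * e (j + i)" using Suc by simp
    ultimately have "(e j * e (j + i + l)) * (e (j + l) * e (Suc (j + l + i)))
        \<le> (e (j + l) * e (j + i)) * (e (Suc (j + l)) * e (j + l + i))"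
      using epos by (intro mult_mono[of "e j * e (j + i + l)"]) (auto intro: less_imp_le)
    then have "(e (j + i + l) * e (j + l)) * (e j * e (j + i + Suc l))
        \<le> (e (j + i + l) * e (j + l)) * (e (j + Suc l) * e (j + i))"
      by (simp add: mult_ac add_ac)
    then show ?case using epos by (subst (asm) mult_le_cancel_left_pos) auto
  qed (simp add: mult.commute)
  have up: "e (j + l) * e (j + i) \<le> \<Theta> ^ l * (e j * e (j + i + l))" if "j + i + l \<le> 2 * c" "i \<le> c" for i j l
    using that
  proof (induction l)
    case (Suc l)
    have "e (Suc (j + l)) * e (j + l + i)
       \<le> ((1 + real i / (real m - real (j + l + i))) * (1 + real i / (real X - real m + 1)))
         * (e (j + l) * e (Suc (j + l + i)))"
      unfolding e_def using Suc assms by (intro binomial_shift_cross) auto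
    also have "\<dots> \<le> \<Theta> * (e (j + l) * e (Suc (j + l + i)))"
    proof (intro mult_right_mono)
      have "real (j + l + i) \<le> 2 * real c" using Suc.prems by linarith
      moreover have "2 * real c < real m" using assms by linarith
      ultimately show "(1 + real i / (real m - real (j + l + i))) * (1 + real i / (real X - real m + 1)) \<le> \<Theta>"
        unfolding \<Theta>_def using Suc.prems assms
        by (intro mult_mono add_left_mono frac_le add_nonneg_nonneg divide_nonneg_nonneg) auto
    qed (use epos in \<open>auto intro: less_imp_le\<close>)
    finally have s: "e (Suc (j + l)) * e (j + l + i) \<le> \<Theta> * (e (j + l) * e (Suc (j + l + i)))" .
    have "e (j + l) * e (j + i) \<le> \<Theta> ^ l * (e j * e (j + i + l))" using Suc by simp
    then have "(e (Suc (j + l)) * e (j + l + i)) * (e (j + l) * e (j + i))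
        \<le> (\<Theta> * (e (j + l) * e (Suc (j + l + i)))) * (\<Theta> ^ l * (e j * e (j + i + l)))"
      using s epos Theta
      by (intro mult_mono[of "e (Suc (j + l)) * e (j + l + i)"]) (auto intro: less_imp_le)
    then have "(e (j + i + l) * e (j + l)) * (e (j + Suc l) * e (j + i))
        \<le> (e (j + i + l) * e (j + l)) * (\<Theta> ^ Suc l * (e j * e (j + i + Suc l)))"
      by (simp add: mult_ac add_ac)
    then show ?case using epos by (subst (asm) mult_le_cancel_left_pos) auto
  qed simp
  have Tc: "\<Theta> ^ l \<le> \<Theta> ^ c" if "l \<le> c" for l using Theta that by (intro power_increasing)
  have T1: "1 \<le> \<Theta> ^ c" using Theta by (rule one_le_power)
  have conc: "e (a + b) * e (a' + b') \<le> \<Theta> ^ c * (e (a + b') * e (a' + b))"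
    if "a \<le> a'" "a \<le> c" "b \<le> c" "a' \<le> c" "b' \<le> c" for a b a' b'
  proof (cases "b \<le> b'")
    case True
    have "e (a + b) * e (a + b + (a' - a) + (b' - b)) \<le> e (a + b + (b' - b)) * e (a + b + (a' - a))"
      using that True assms by (intro lc) auto
    then have "e (a + b) * e (a' + b') \<le> 1 * (e (a + b') * e (a' + b))"
      using that True by (simp add: add_ac)
    also have "\<dots> \<le> \<Theta> ^ c * (e (a + b') * e (a' + b))"
      using T1 epos by (intro mult_right_mono) (auto intro: less_imp_le)
    finally show ?thesis .
  next
    case False
    have "e (a + b' + (b - b')) * e (a + b' + (a' - a))
        \<le> \<Theta> ^ (b - b') * (e (a + b') * e (a + b' + (a' - a) + (b - b')))"
      using that False assms by (intro up) auto
    then have "e (a + b) * e (a' + b') \<le> \<Theta> ^ (b - b') * (e (a + b') * e (a' + b))"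
      using that False by (simp add: add_ac)
    also have "\<dots> \<le> \<Theta> ^ c * (e (a + b') * e (a' + b))"
      using that epos by (intro mult_right_mono Tc) (auto intro: less_imp_le)
    finally show ?thesis .
  qed
  show ?thesis
  proof (cases "a \<le> a'")
    case True
    then show ?thesis using assms by (intro conc) auto
  next
    case False
    then have "e (a' + b') * e (a + b) \<le> \<Theta> ^ c * (e (a' + b) * e (a + b'))"
      using assms by (intro conc) auto
    then show ?thesis by (simp add: mult_ac)
  qed
qed

text \<open>Multiplicative error in the approximate independence of two degrees that are at most \<open>c\<close>.\<close>

definition pair_error :: "nat \<Rightarrow> nat \<Rightarrow> nat \<Rightarrow> real" where
  "pair_error n m c =
     (1 + (real c)\<^sup>2 * real (N_pairs n) / ((real n - 2 - real c)\<^sup>2 * (real m - 2 * real c)))\<^sup>2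
     * ((1 + real c / (real m - 2 * real c)) * (1 + real c / (real (N_pairs n) - 2 * real n - real m))) ^ c"

definition pair_count :: "nat \<Rightarrow> nat \<Rightarrow> nat \<Rightarrow> nat \<Rightarrow> nat \<Rightarrow> nat \<Rightarrow> real" where
  "pair_count n m u v a b = real (card {G \<in> graphs n m. degree G u = a \<and> degree G v = b})"

text \<open>A bound on cross ratios gives approximate independence after summation over \<open>a'\<close> and \<open>b'\<close>,
so that the joint law never has to be compared with the normalised marginals.\<close>

lemma pair_count_rectangle:
  assumes "u < n" "v < n" "u \<noteq> v" "2 * c < m" "m + 2 * n < N_pairs n" "c + 2 < n"
    and "a \<le> c" "b \<le> c" "a' \<le> c" "b' \<le> c"
  shows "pair_count n m u v a b * pair_count n m u v a' b'
       \<le> pair_error n m c * (pair_count n m u v a b' * pair_count n m u v a' b)"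
proof -
  define X where "X = N_pairs n - (2 * n - 3)"
  define e where "e j = real (X choose (m - j))" for j
  define C where "C a = real ((n - 2) choose a)" for a
  \<comment> \<open>This bounds the graphs containing the edge between \<open>u\<close> and
    \<open>v\<close> relative to those without it: a factor \<open>c / (n - 2 - c)\<close> from each
    of the two stars and \<open>N / (m - 2 * c)\<close> from the other edges.\<close>
  define \<delta> where "\<delta> = (real c)\<^sup>2 * real (N_pairs n) / ((real n - 2 - real c)\<^sup>2 * (real m - 2 * real c))"
  define \<Theta> where "\<Theta> = (1 + real c / (real m - 2 * real c)) * (1 + real c / (real X - real m + 1))"
  let ?J = "pair_count n m u v"
  have X: "m \<le> X" "X \<le> N_pairs n" "real (N_pairs n) - 2 * real n - real m \<le> real X - real m + 1"
    using assms by (auto simp: X_def of_nat_diff)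
  have pos: "real n - 2 - real c > 0" "real m - 2 * real c > 0" using assms by linarith+
  have d0: "\<delta> \<ge> 0" using pos by (simp add: \<delta>_def)
  have main: "C a * C b * e (a + b) \<le> ?J a b \<and> ?J a b \<le> (1 + \<delta>) * (C a * C b * e (a + b))"
    if ab: "a \<le> c" "b \<le> c" for a b
  proof -
    have abm: "a + b \<le> m" using ab assms by linarith
    have J: "?J a b = C a * C b * e (a + b)
        + (if a = 0 \<or> b = 0 then 0 else C (a - 1) * C (b - 1) * e (a + b - 1))"
      unfolding pair_count_def card_graphs_degree_pair[OF assms(1-3) abm]
      by (simp add: C_def e_def X_def)
    have nn: "C a \<ge> 0" "C b \<ge> 0" "e (a + b) \<ge> 0" by (auto simp: C_def e_def)
    show ?thesis
    proof (cases "a = 0 \<or> b = 0")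
      case True
      then have "?J a b = C a * C b * e (a + b)" using J by auto
      moreover have "0 \<le> \<delta> * (C a * C b * e (a + b))" using d0 nn by (intro mult_nonneg_nonneg)
      ultimately show ?thesis by (simp add: distrib_right)
    next
      case False
      then obtain a1 b1 where [simp]: "a = Suc a1" "b = Suc b1" by (meson not0_implies_Suc)
      have Cs: "C x = (real x + 1) / (real n - 2 - real x) * C (Suc x)" if "Suc x \<le> c" for x
      proof -
        have "real (Suc x * ((n - 2) choose Suc x)) = real ((n - 2 - x) * ((n - 2) choose x))"
          by (simp only: Suc_times_binomial_Suc)
        moreover have "real (n - 2 - x) = real n - 2 - real x" "real (Suc x) = real x + 1"
          using that assms by (simp_all add: of_nat_diff)
        ultimately have "(real x + 1) * C (Suc x) = (real n - 2 - real x) * C x"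
          unfolding C_def by (simp only: of_nat_mult)
        moreover have "real n - 2 - real x > 0" using that pos by linarith
        ultimately show ?thesis by (simp add: field_simps)
      qed
      have Cb: "C x \<le> real c / (real n - 2 - real c) * C (Suc x)" if "Suc x \<le> c" for x
      proof -
        have "(real x + 1) / (real n - 2 - real x) \<le> real c / (real n - 2 - real c)"
          using that pos by (intro frac_le) auto
        then show ?thesis unfolding Cs[OF that] by (intro mult_right_mono) (auto simp: C_def)
      qed
      define j where "j = a1 + b1 + 1"
      have jm: "Suc j \<le> 2 * c" using ab by (simp add: j_def)
      have "(real X - real m + real j + 1) * e (Suc j) = (real m - real j) * e j"
        unfolding e_def using jm assms X by (intro binomial_shift_step) auto
      moreover have mj: "real m - real j > 0" "real m - 2 * real c \<le> real m - real j" using jm assms by linarith+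
      ultimately have "e j = (real X - real m + real j + 1) / (real m - real j) * e (Suc j)"
        by (simp add: field_simps)
      also have "\<dots> \<le> real (N_pairs n) / (real m - 2 * real c) * e (Suc j)"
      proof (intro mult_right_mono frac_le)
        have "Suc j \<le> m" using jm assms by linarith
        then show "real X - real m + real j + 1 \<le> real (N_pairs n)" using X by linarith
      qed (use pos mj in \<open>auto simp: e_def\<close>)
      finally have eb: "e j \<le> real (N_pairs n) / (real m - 2 * real c) * e (Suc j)" .
      have "C a1 * C b1 * e j
          \<le> (real c / (real n - 2 - real c) * C a) * (real c / (real n - 2 - real c) * C b)
            * (real (N_pairs n) / (real m - 2 * real c) * e (Suc j))"
        using Cb[of a1] Cb[of b1] eb ab pos nn
        by (intro mult_mono mult_nonneg_nonneg) (auto simp: C_def e_def)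
      also have "\<dots> = \<delta> * (C a * C b * e (a + b))"
        by (simp add: \<delta>_def j_def power2_eq_square)
      finally have "C a1 * C b1 * e j \<le> \<delta> * (C a * C b * e (a + b))" .
      moreover have "?J a b = C a * C b * e (a + b) + C a1 * C b1 * e j"
        using J by (simp add: j_def)
      moreover have "C a1 * C b1 * e j \<ge> 0" by (simp add: C_def e_def)
      ultimately show ?thesis by (simp add: distrib_right)
    qed
  qed
  have rect: "e (a + b) * e (a' + b') \<le> \<Theta> ^ c * (e (a + b') * e (a' + b))"
    unfolding e_def \<Theta>_def using assms X by (intro binomial_shift_rectangle) auto
  have nn: "C x \<ge> 0" "e x \<ge> 0" for x by (auto simp: C_def e_def)
  have Jn: "?J x y \<ge> 0" for x y by (simp add: pair_count_def)
  have "?J a b * ?J a' b' \<le> ((1 + \<delta>) * (C a * C b * e (a + b))) * ((1 + \<delta>) * (C a' * C b' * e (a' + b')))"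
    using main assms d0 nn Jn by (intro mult_mono) auto
  also have "\<dots> = (1 + \<delta>)\<^sup>2 * (C a * C b * C a' * C b') * (e (a + b) * e (a' + b'))"
    by (simp add: power2_eq_square mult_ac)
  also have "\<dots> \<le> (1 + \<delta>)\<^sup>2 * (C a * C b * C a' * C b') * (\<Theta> ^ c * (e (a + b') * e (a' + b)))"
    using rect nn by (intro mult_left_mono) auto
  also have "\<dots> = (1 + \<delta>)\<^sup>2 * \<Theta> ^ c * ((C a * C b' * e (a + b')) * (C a' * C b * e (a' + b)))"
    by (simp add: mult_ac)
  also have "\<dots> \<le> (1 + \<delta>)\<^sup>2 * \<Theta> ^ c * (?J a b' * ?J a' b)"
  proof (intro mult_left_mono mult_mono)
    show "0 \<le> (1 + \<delta>)\<^sup>2 * \<Theta> ^ c" using pos X by (simp add: \<Theta>_def)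
  qed (use main assms nn Jn in auto)
  also have "\<dots> \<le> pair_error n m c * (?J a b' * ?J a' b)"
  proof (intro mult_right_mono)
    have "real (N_pairs n) - 2 * real n - real m > 0" using assms by linarith
    then have "\<Theta> \<le> (1 + real c / (real m - 2 * real c)) * (1 + real c / (real (N_pairs n) - 2 * real n - real m))"
      unfolding \<Theta>_def using X pos by (intro mult_left_mono add_left_mono frac_le) auto
    then show "(1 + \<delta>)\<^sup>2 * \<Theta> ^ c \<le> pair_error n m c"
      unfolding pair_error_def \<delta>_def using pos X
      by (intro mult_left_mono power_mono) (auto simp: \<Theta>_def)
  qed (use Jn in auto)
  finally show ?thesis .
qed

lemma sum_graphs_pair:
  assumes "\<And>a b. \<not> (a \<le> c \<and> b \<le> c) \<Longrightarrow> F a b = 0"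
  shows "(\<Sum>G\<in>graphs n m. F (degree G u) (degree G v)) = (\<Sum>a\<le>c. \<Sum>b\<le>c. F a b * pair_count n m u v a b)"
proof -
  let ?S = "{G \<in> graphs n m. degree G u \<le> c \<and> degree G v \<le> c}"
  have "(\<Sum>G\<in>graphs n m. F (degree G u) (degree G v)) = (\<Sum>G\<in>?S. F (degree G u) (degree G v))"
    using assms by (intro sum.mono_neutral_right) auto
  also have "\<dots> = (\<Sum>p\<in>{..c} \<times> {..c}. \<Sum>G\<in>{G \<in> ?S. (degree G u, degree G v) = p}. F (degree G u) (degree G v))"
    by (intro sum.group[symmetric]) auto
  also have "\<dots> = (\<Sum>p\<in>{..c} \<times> {..c}. F (fst p) (snd p) * pair_count n m u v (fst p) (snd p))"
  proof (intro sum.cong refl)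
    fix p assume p: "p \<in> {..c} \<times> {..c}"
    have "{G \<in> ?S. (degree G u, degree G v) = p} = {G \<in> graphs n m. degree G u = fst p \<and> degree G v = snd p}"
      using p by auto
    moreover have "(\<Sum>G\<in>{G \<in> graphs n m. degree G u = fst p \<and> degree G v = snd p}. F (degree G u) (degree G v))
        = (\<Sum>G\<in>{G \<in> graphs n m. degree G u = fst p \<and> degree G v = snd p}. F (fst p) (snd p))"
      by (intro sum.cong) auto
    ultimately show "(\<Sum>G\<in>{G \<in> ?S. (degree G u, degree G v) = p}. F (degree G u) (degree G v))
        = F (fst p) (snd p) * pair_count n m u v (fst p) (snd p)"
      by (simp add: pair_count_def)
  qed
  also have "\<dots> = (\<Sum>a\<le>c. \<Sum>b\<le>c. F a b * pair_count n m u v a b)"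
    by (simp add: sum.cartesian_product split_beta)
  finally show ?thesis .
qed

text \<open>\<open>T\<close> counts the graphs in which both degrees are at most \<open>c\<close>.
  It replaces the normalising constant and falls short of it by a fraction \<open>2 * \<tau>\<close>
  at most. In \<open>U * T\<close>, read as a sum over pairs of graphs,
  \<open>pair_count_rectangle\<close> exchanges the two degrees of \<open>v\<close>, after which the
  sums separate.\<close>

lemma graph_mean_pair_le:
  assumes "u < n" "v < n" "u \<noteq> v" "2 * c < m" "m + 2 * n < N_pairs n" "c + 2 < n"
    and f: "\<And>d. f d \<ge> 0" "\<And>d. d > c \<Longrightarrow> f d = 0" and g: "\<And>d. g d \<ge> 0" "\<And>d. d > c \<Longrightarrow> g d = 0"
    and \<tau>: "\<And>w. w < n \<Longrightarrow> graph_mean n m (\<lambda>G. indicator {c<..} (degree G w)) \<le> \<tau>"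
  shows "(1 - 2 * \<tau>) * graph_mean n m (\<lambda>G. f (degree G u) * g (degree G v))
       \<le> pair_error n m c * (graph_mean n m (\<lambda>G. f (degree G u)) * graph_mean n m (\<lambda>G. g (degree G v)))"
proof -
  let ?Z = "real (N_pairs n choose m)"
  have Z: "?Z > 0" using assms by simp
  let ?J = "pair_count n m u v"
  define T where "T = (\<Sum>b'\<le>c. \<Sum>a'\<le>c. ?J a' b')"
  define U where "U = (\<Sum>G\<in>graphs n m. f (degree G u) * g (degree G v))"
  have Un: "U \<ge> 0" unfolding U_def using f g by (intro sum_nonneg mult_nonneg_nonneg) auto
  have pe: "pair_error n m c \<ge> 0"
  proof -
    have "real m - 2 * real c \<ge> 0" "real (N_pairs n) - 2 * real n - real m \<ge> 0" using assms by linarith+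
    then show ?thesis by (simp add: pair_error_def)
  qed
  have T_ge: "(1 - 2 * \<tau>) * ?Z \<le> T"
  proof -
    have "T = (\<Sum>a'\<le>c. \<Sum>b'\<le>c. ?J a' b')" unfolding T_def by (rule sum.swap)
    also have "\<dots> = (\<Sum>G\<in>graphs n m. indicator {..c} (degree G u) * indicator {..c} (degree G v))"
      using sum_graphs_pair[of c "\<lambda>a b. indicator {..c} a * indicator {..c} b" u v n m] by (simp add: indicator_def)
    also have "\<dots> = ?Z * graph_mean n m (\<lambda>G. indicator {..c} (degree G u) * indicator {..c} (degree G v))"
      using Z by (simp add: graph_mean_def)
    finally have T: "T = ?Z * graph_mean n m (\<lambda>G. indicator {..c} (degree G u) * indicator {..c} (degree G v))" .
    have "1 - 2 * \<tau> \<le> graph_mean n m (\<lambda>G. indicator {..c} (degree G u) * indicator {..c} (degree G v))"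
    proof -
      have "1 = graph_mean n m (\<lambda>G. 1)" using assms by (simp add: graph_mean_const)
      also have "\<dots> \<le> graph_mean n m (\<lambda>G. (indicator {..c} (degree G u) * indicator {..c} (degree G v)
          + indicator {c<..} (degree G u)) + indicator {c<..} (degree G v))"
        by (intro graph_mean_mono) (auto simp: indicator_def)
      also have "\<dots> \<le> graph_mean n m (\<lambda>G. indicator {..c} (degree G u) * indicator {..c} (degree G v)) + \<tau> + \<tau>"
        unfolding graph_mean_add using \<tau>[of u] \<tau>[of v] assms by (intro add_mono) auto
      finally show ?thesis by simp
    qed
    then show ?thesis unfolding T using Z by (subst mult.commute) (intro mult_left_mono, auto)
  qed
  have "U * T = (\<Sum>a\<le>c. \<Sum>b\<le>c. f a * g b * ?J a b) * T"
    unfolding U_def using f g by (subst sum_graphs_pair[of c]) auto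
  also have "\<dots> = (\<Sum>a\<le>c. \<Sum>b\<le>c. \<Sum>b'\<le>c. \<Sum>a'\<le>c. f a * g b * ?J a b * ?J a' b')"
    unfolding T_def by (simp only: sum_distrib_right) (simp only: sum_distrib_left)
  also have "\<dots> \<le> (\<Sum>a\<le>c. \<Sum>b\<le>c. \<Sum>b'\<le>c. \<Sum>a'\<le>c. pair_error n m c * ((f a * ?J a b') * (g b * ?J a' b)))"
  proof (intro sum_mono)
    fix a b b' a' assume "a \<in> {..c}" "b \<in> {..c}" "b' \<in> {..c}" "a' \<in> {..c}"
    then have "(f a * g b) * (?J a b * ?J a' b') \<le> (f a * g b) * (pair_error n m c * (?J a b' * ?J a' b))"
      using f g assms by (intro mult_left_mono pair_count_rectangle) auto
    then show "f a * g b * ?J a b * ?J a' b' \<le> pair_error n m c * ((f a * ?J a b') * (g b * ?J a' b))"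
      by (simp only: mult_ac)
  qed
  also have "\<dots> = pair_error n m c * ((\<Sum>a\<le>c. \<Sum>b'\<le>c. f a * ?J a b') * (\<Sum>b\<le>c. \<Sum>a'\<le>c. g b * ?J a' b))"
  proof -
    have "(\<Sum>a\<le>c. \<Sum>b'\<le>c. f a * ?J a b') * (\<Sum>b\<le>c. \<Sum>a'\<le>c. g b * ?J a' b)
        = (\<Sum>a\<le>c. \<Sum>b\<le>c. \<Sum>b'\<le>c. \<Sum>a'\<le>c. (f a * ?J a b') * (g b * ?J a' b))"
      by (simp only: sum_product)
    then show ?thesis by (simp only: sum_distrib_left)
  qed
  also have "\<dots> \<le> pair_error n m c * ((\<Sum>G\<in>graphs n m. f (degree G u)) * (\<Sum>G\<in>graphs n m. g (degree G v)))"
  proof (intro mult_left_mono mult_mono pe)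
    have "a \<le> c \<longrightarrow> \<not> b \<le> c \<Longrightarrow> f a * indicator {..c} b = 0" for a b
      using f(2)[of a] by (cases "a \<le> c") auto
    then have "(\<Sum>a\<le>c. \<Sum>b'\<le>c. f a * ?J a b') = (\<Sum>G\<in>graphs n m. f (degree G u) * indicator {..c} (degree G v))"
      using sum_graphs_pair[of c "\<lambda>a b. f a * indicator {..c} b" u v n m] by (simp add: indicator_def)
    also have "\<dots> \<le> (\<Sum>G\<in>graphs n m. f (degree G u))"
      using f by (intro sum_mono) (auto simp: indicator_def)
    finally show "(\<Sum>a\<le>c. \<Sum>b'\<le>c. f a * ?J a b') \<le> (\<Sum>G\<in>graphs n m. f (degree G u))" .
    have gz: "a \<le> c \<longrightarrow> \<not> b \<le> c \<Longrightarrow> indicator {..c} a * g b = 0" for a b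
      using g(2)[of b] by (cases "b \<le> c") auto
    have "(\<Sum>b\<le>c. \<Sum>a'\<le>c. g b * ?J a' b) = (\<Sum>a'\<le>c. \<Sum>b\<le>c. g b * ?J a' b)" by (rule sum.swap)
    also have "\<dots> = (\<Sum>G\<in>graphs n m. indicator {..c} (degree G u) * g (degree G v))"
      using gz sum_graphs_pair[of c "\<lambda>a b. indicator {..c} a * g b" u v n m] by (simp add: indicator_def)
    also have "\<dots> \<le> (\<Sum>G\<in>graphs n m. g (degree G v))"
      using g by (intro sum_mono) (auto simp: indicator_def)
    finally show "(\<Sum>b\<le>c. \<Sum>a'\<le>c. g b * ?J a' b) \<le> (\<Sum>G\<in>graphs n m. g (degree G v))" .
    show "0 \<le> (\<Sum>G\<in>graphs n m. f (degree G u))" using f by (intro sum_nonneg) auto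
    show "0 \<le> (\<Sum>b\<le>c. \<Sum>a'\<le>c. g b * ?J a' b)" using g by (intro sum_nonneg) (auto simp: pair_count_def)
  qed
  finally have UT: "U * T \<le> pair_error n m c * ((\<Sum>G\<in>graphs n m. f (degree G u)) * (\<Sum>G\<in>graphs n m. g (degree G v)))" .
  have "U * ((1 - 2 * \<tau>) * ?Z) \<le> U * T" using T_ge Un by (intro mult_left_mono)
  with UT have "U * ((1 - 2 * \<tau>) * ?Z) / (?Z * ?Z)
      \<le> pair_error n m c * ((\<Sum>G\<in>graphs n m. f (degree G u)) * (\<Sum>G\<in>graphs n m. g (degree G v))) / (?Z * ?Z)"
    using Z by (intro divide_right_mono) auto
  then show ?thesis using Z by (simp add: graph_mean_def U_def[symmetric] mult_ac)
qed

subsection \<open>Non-asymptotic error bounds\<close>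

lemma max_degree_ge_iff:
  assumes "n \<ge> 1"
  shows "t \<le> real (max_degree n G) \<longleftrightarrow> (\<exists>v<n. t \<le> real (degree G v))"
proof -
  have fin: "finite (degree G ` {..<n})" "degree G ` {..<n} \<noteq> {}" using assms by (auto simp: lessThan_empty_iff)
  have "max_degree n G \<in> degree G ` {..<n}" unfolding max_degree_def using fin by (rule Max_in)
  moreover have "degree G v \<le> max_degree n G" if "v < n" for v
    unfolding max_degree_def using fin that by (intro Max_ge) auto
  ultimately show ?thesis by (auto intro: order_trans)
qed

text \<open>The law of the degree of the hub under the planted distribution.\<close>

definition hub_law :: "nat \<Rightarrow> nat \<Rightarrow> nat \<Rightarrow> nat \<Rightarrow> real" where
  "hub_law n m k d = real n * (hypergeom (N_pairs n) (n - 1) m d * hub_weight n m k d)"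

lemma hub_law_nonneg: "hub_law n m k d \<ge> 0"
  by (simp add: hub_law_def hypergeom_nonneg hub_weight_nonneg)

lemma sum_hub_law:
  assumes "n \<ge> 1" "k \<le> n - 1" "n - 1 \<le> m" "m \<le> N_pairs n"
  shows "(\<Sum>d\<le>n - 1. hub_law n m k d) = 1"
proof -
  have "(\<Sum>d\<le>n - 1. hub_law n m k d) = (\<Sum>d\<in>{k..n - 1}. hub_law n m k d)"
    by (intro sum.mono_neutral_right) (auto simp: hub_law_def hub_weight_eq_0)
  also have "\<dots> = (\<Sum>d\<in>{k..n - 1}. hypergeom (N_pairs n - k) (n - 1 - k) (m - k) (d - k))"
    unfolding hub_law_def using assms by (intro sum.cong refl hub_weight_hypergeom) auto
  also have "\<dots> = (\<Sum>d\<le>n - 1 - k. hypergeom (N_pairs n - k) (n - 1 - k) (m - k) d)"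
    using assms by (intro sum.reindex_bij_witness[of _ "\<lambda>d. d + k" "\<lambda>d. d - k"]) auto
  also have "\<dots> = 1" using assms by (intro sum_hypergeom) auto
  finally show ?thesis .
qed

text \<open>Change of measure for a function of one degree: all vertices contribute equally, and the
  \<open>n\<close> equal terms add up to the law of the hub.\<close>

lemma sum_graph_mean_hub_weight:
  assumes "n - 1 \<le> m"
  shows "(\<Sum>v<n. graph_mean n m (\<lambda>G. hub_weight n m k (degree G v) * \<phi> (degree G v)))
       = (\<Sum>d\<le>n - 1. hub_law n m k d * \<phi> d)"
proof -
  have "(\<Sum>v<n. graph_mean n m (\<lambda>G. hub_weight n m k (degree G v) * \<phi> (degree G v)))
      = (\<Sum>v<n. \<Sum>d\<le>n - 1. hypergeom (N_pairs n) (n - 1) m d * (hub_weight n m k d * \<phi> d))"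
    using assms by (intro sum.cong refl graph_mean_degree[where f = "\<lambda>d. hub_weight n m k d * \<phi> d"]) auto
  then show ?thesis by (simp add: hub_law_def sum_distrib_left mult_ac)
qed

text \<open>Vertices of degree below \<open>s\<close> are individually negligible and concentrate in sum; a single vertex
of degree at least \<open>s'\<close> forces both events; the window between carries little planted mass.\<close>

locale likelihood_bounds =
  fixes n m k c :: nat and s t s' \<omega> \<tau> \<beta> \<kappa> c0 :: real
  assumes k: "k \<le> n - 1" and nm: "n - 1 \<le> m" and cm: "2 * c < m" and mN: "m + 2 * n < N_pairs n"
    and cn: "c + 2 < n" and st: "s \<le> t" "t \<le> s'"
    and low: "real d < s \<Longrightarrow> hub_weight n m k d \<le> \<omega>" and low_c: "real d < s \<Longrightarrow> d \<le> c"
    and high: "s' \<le> real d \<Longrightarrow> 1 \<le> hub_weight n m k d"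
    and beta: "real n * (\<Sum>d\<le>n - 1. hypergeom (N_pairs n) (n - 1) m d * indicator {d. t \<le> real d} d) \<le> \<beta>"
    and tau: "(\<Sum>d\<le>n - 1. hypergeom (N_pairs n) (n - 1) m d * indicator {c<..} d) \<le> \<tau>" "\<tau> < 1 / 2"
    and kappa: "(\<Sum>d\<le>n - 1. hub_law n m k d * indicator {d. s \<le> real d \<and> real d < s'} d) \<le> \<kappa>"
    and c0: "c0 > 0" "c0 \<le> (\<Sum>d\<le>n - 1. hub_law n m k d * indicator {d. t \<le> real d} d)"
    and omega: "\<omega> \<ge> 0"
begin

abbreviation "E \<equiv> graph_mean n m"
abbreviation "w \<equiv> hub_weight n m k"
definition "A = {G. LR n m k G \<ge> 1}"
definition "B = {G. real (max_degree n G) \<ge> t}"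
definition "Y G = (\<Sum>v<n. w (degree G v) * indicator {d. real d < s} (degree G v))"
definition "W G = (\<Sum>v<n. w (degree G v) * indicator {d. s \<le> real d \<and> real d < s'} (degree G v))"
definition "p = (\<Sum>d\<le>n - 1. hub_law n m k d * indicator {d. real d < s} d)"
text \<open>An upper bound for the null variance of \<open>Y\<close> rather than the variance
  itself: \<open>\<omega>\<close> pays for the diagonal, the rest for the correlation of distinct
  degrees.\<close>

definition "var = \<omega> + pair_error n m c / (1 - 2 * \<tau>) - 1"

lemma n1: "n \<ge> 1" using cn by simp

lemma mN': "m \<le> N_pairs n" using mN by simp

lemma km: "k \<le> m" using k nm by simp

lemma Y_nonneg: "Y G \<ge> 0"
  unfolding Y_def by (intro sum_nonneg mult_nonneg_nonneg hub_weight_nonneg) auto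

lemma W_nonneg: "W G \<ge> 0"
  unfolding W_def by (intro sum_nonneg mult_nonneg_nonneg hub_weight_nonneg) auto

lemma LR: "G \<in> graphs n m \<Longrightarrow> LR n m k G = (\<Sum>v<n. w (degree G v))"
  using n1 k km mN' by (intro LR_eq)

lemma mean_Y: "E Y = p"
  unfolding Y_def p_def by (subst graph_mean_sum, rule sum_graph_mean_hub_weight[OF nm])

lemma mean_W: "E W \<le> \<kappa>"
  unfolding W_def by (subst graph_mean_sum, subst sum_graph_mean_hub_weight[OF nm], rule kappa)

lemma p_nonneg: "p \<ge> 0"
  unfolding p_def by (intro sum_nonneg mult_nonneg_nonneg hub_law_nonneg) auto

text \<open>The hub law has total mass 1, and the mass above \<open>t\<close> is missing from
  \<open>Y\<close>. This gap is what \<open>prob_A\<close> exploits: outside \<open>B\<close>, a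
  likelihood ratio of 1 requires a deviation of fixed size \<open>c0\<close>.\<close>

lemma p_le: "p \<le> 1 - c0"
proof -
  have "p + c0 \<le> (\<Sum>d\<le>n - 1. hub_law n m k d * indicator {d. real d < s} d)
      + (\<Sum>d\<le>n - 1. hub_law n m k d * indicator {d. t \<le> real d} d)"
    unfolding p_def using c0 by simp
  also have "\<dots> \<le> (\<Sum>d\<le>n - 1. hub_law n m k d)"
    unfolding sum.distrib[symmetric] using st hub_law_nonneg
    by (intro sum_mono) (auto simp: indicator_def)
  also have "\<dots> = 1" using n1 k nm mN' by (rule sum_hub_law)
  finally show ?thesis by simp
qed

lemma prob_B: "E (indicator B) \<le> \<beta>"
proof -
  have "E (indicator B) \<le> E (\<lambda>G. \<Sum>v<n. indicator {d. t \<le> real d} (degree G v))"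
  proof (intro graph_mean_mono)
    fix G
    show "indicator B G \<le> (\<Sum>v<n. indicator {d. t \<le> real d} (degree G v) :: real)"
    proof (cases "G \<in> B")
      case True
      then obtain v where v: "v < n" "t \<le> real (degree G v)"
        using max_degree_ge_iff[OF n1] by (auto simp: B_def)
      then have "(1::real) = indicator {d. t \<le> real d} (degree G v)" by simp
      also have "\<dots> \<le> (\<Sum>v<n. indicator {d. t \<le> real d} (degree G v))"
        using v by (intro member_le_sum) auto
      finally show ?thesis using True by simp
    qed (simp add: sum_nonneg)
  qed
  also have "\<dots> = (\<Sum>v<n. \<Sum>d\<le>n - 1. hypergeom (N_pairs n) (n - 1) m d * indicator {d. t \<le> real d} d)"
    unfolding graph_mean_sum using nm by (intro sum.cong refl graph_mean_degree) auto
  also have "\<dots> \<le> \<beta>" using beta by simp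
  finally show ?thesis .
qed

lemma pair_error_ge_1: "pair_error n m c \<ge> 1"
proof -
  have pos: "real m - 2 * real c > 0" "real (N_pairs n) - 2 * real n - real m > 0"
    using cm mN by linarith+
  have "1 * 1 \<le> pair_error n m c"
    unfolding pair_error_def
  proof (intro mult_mono one_le_power)
    have "1 * 1 \<le> (1 + real c / (real m - 2 * real c)) * (1 + real c / (real (N_pairs n) - 2 * real n - real m))"
      using pos by (intro mult_mono) auto
    then show "1 \<le> (1 + real c / (real m - 2 * real c)) * (1 + real c / (real (N_pairs n) - 2 * real n - real m))"
      by simp
  qed (use pos in auto)
  then show ?thesis by simp
qed

lemma tau_nonneg: "\<tau> \<ge> 0"
  using tau(1) by (rule order_trans[rotated]) (auto intro!: sum_nonneg mult_nonneg_nonneg hypergeom_nonneg)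

lemma theta_ge_1: "1 \<le> pair_error n m c / (1 - 2 * \<tau>)"
  using pair_error_ge_1 tau tau_nonneg by (simp add: field_simps)

text \<open>Below \<open>s\<close> every weight is at most \<open>\<omega>\<close>, so the diagonal
  is at most \<open>\<omega>\<close> times the mean. Off the diagonal
  \<open>graph_mean_pair_le\<close> applies, since \<open>low_c\<close> puts all degrees that matter
  at or below \<open>c\<close>.\<close>

lemma second_moment: "E (\<lambda>G. (Y G)\<^sup>2) \<le> \<omega> + pair_error n m c / (1 - 2 * \<tau>) * p\<^sup>2"
proof -
  define g where "g d = w d * indicator {d. real d < s} d" for d
  define \<mu> where "\<mu> = (\<Sum>d\<le>n - 1. hypergeom (N_pairs n) (n - 1) m d * g d)"
  let ?\<theta> = "pair_error n m c / (1 - 2 * \<tau>)"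
  have g0: "g d \<ge> 0" for d by (simp add: g_def hub_weight_nonneg)
  have gc: "d > c \<Longrightarrow> g d = 0" for d using low_c[of d] by (auto simp: g_def indicator_def)
  have gw: "g d \<le> \<omega>" for d using low[of d] omega by (auto simp: g_def indicator_def)
  have Eg: "E (\<lambda>G. g (degree G v)) = \<mu>" if "v < n" for v
    unfolding \<mu>_def using that nm by (intro graph_mean_degree)
  have mu0: "\<mu> \<ge> 0" unfolding \<mu>_def by (intro sum_nonneg mult_nonneg_nonneg hypergeom_nonneg g0)
  have Yg: "Y G = (\<Sum>v<n. g (degree G v))" for G by (simp add: Y_def g_def)
  have pmu: "p = real n * \<mu>"
    unfolding mean_Y[symmetric] Yg graph_mean_sum using Eg by simp
  have tauE: "E (\<lambda>G. indicator {c<..} (degree G v)) \<le> \<tau>" if "v < n" for v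
    using tau(1) graph_mean_degree[OF that nm, of "indicator {c<..}"] by simp
  \<comment> \<open>The product term is granted to the diagonal as well, so that the double sum
    yields exactly \<open>p\<^sup>2\<close>.\<close>
  have E2: "E (\<lambda>G. g (degree G u) * g (degree G v)) \<le> (if u = v then \<omega> * \<mu> else 0) + ?\<theta> * (\<mu> * \<mu>)"
    if uv: "u < n" "v < n" for u v
  proof (cases "u = v")
    case True
    have "E (\<lambda>G. g (degree G u) * g (degree G v)) \<le> E (\<lambda>G. \<omega> * g (degree G v))"
      using True g0 gw by (intro graph_mean_mono mult_right_mono) auto
    also have "\<dots> = \<omega> * \<mu>" using uv by (simp add: graph_mean_cmult Eg)
    also have "\<dots> \<le> \<omega> * \<mu> + ?\<theta> * (\<mu> * \<mu>)"
    proof -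
      have "0 \<le> ?\<theta> * (\<mu> * \<mu>)" using theta_ge_1 mu0 by (intro mult_nonneg_nonneg) auto
      then show ?thesis by linarith
    qed
    finally show ?thesis using True by simp
  next
    case False
    have "(1 - 2 * \<tau>) * E (\<lambda>G. g (degree G u) * g (degree G v))
        \<le> pair_error n m c * (E (\<lambda>G. g (degree G u)) * E (\<lambda>G. g (degree G v)))"
      using uv False cm mN cn g0 gc tauE by (intro graph_mean_pair_le) auto
    then show ?thesis using tau False uv by (simp add: Eg field_simps)
  qed
  have "E (\<lambda>G. (Y G)\<^sup>2) = (\<Sum>u<n. \<Sum>v<n. E (\<lambda>G. g (degree G u) * g (degree G v)))"
    by (simp add: Yg power2_eq_square sum_product graph_mean_sum)
  also have "\<dots> \<le> (\<Sum>u<n. \<Sum>v<n. (if u = v then \<omega> * \<mu> else 0) + ?\<theta> * (\<mu> * \<mu>))"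
    using E2 by (intro sum_mono) auto
  also have "\<dots> = \<omega> * p + ?\<theta> * p\<^sup>2"
    by (simp add: sum.distrib pmu power2_eq_square distrib_left mult_ac)
  also have "\<dots> \<le> \<omega> * 1 + ?\<theta> * p\<^sup>2"
    using omega p_le c0 by (intro add_right_mono mult_left_mono) auto
  finally show ?thesis by simp
qed

lemma p_sq_le: "pair_error n m c / (1 - 2 * \<tau>) * p\<^sup>2 \<le> p\<^sup>2 + (pair_error n m c / (1 - 2 * \<tau>) - 1)"
proof -
  let ?\<theta> = "pair_error n m c / (1 - 2 * \<tau>)"
  have "p\<^sup>2 \<le> 1" using p_nonneg p_le c0 by (intro power_le_one) auto
  then have "(?\<theta> - 1) * p\<^sup>2 \<le> (?\<theta> - 1) * 1" using theta_ge_1 by (intro mult_left_mono) auto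
  then show ?thesis by (simp add: algebra_simps)
qed

lemma second_moment': "E (\<lambda>G. (Y G)\<^sup>2) \<le> p\<^sup>2 + var"
  using second_moment p_sq_le unfolding var_def by linarith

lemma variance: "E (\<lambda>G. (Y G - p)\<^sup>2) \<le> var"
proof -
  have "E (\<lambda>G. (Y G - p)\<^sup>2) = E (\<lambda>G. (Y G)\<^sup>2 + ((- 2 * p) * Y G + p\<^sup>2))"
    by (intro arg_cong[where f = E] ext) (simp add: power2_eq_square algebra_simps)
  also have "\<dots> = E (\<lambda>G. (Y G)\<^sup>2) - 2 * p * p + p\<^sup>2"
    unfolding graph_mean_add graph_mean_cmult mean_Y graph_mean_const[OF mN'] by simp
  also have "\<dots> \<le> var" using second_moment' by (simp add: power2_eq_square)
  finally show ?thesis .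
qed

text \<open>Outside \<open>B\<close> no degree reaches \<open>t\<close>, so the likelihood ratio is
  \<open>Y + W\<close>; if it is at least 1, then \<open>W \<ge> c0 / 2\<close> or
  \<open>Y - p \<ge> c0 / 2\<close>. Markov and Chebyshev are combined into one pointwise inequality
  between functions of \<open>G\<close>.\<close>

lemma prob_A: "E (indicator A) \<le> \<beta> + 2 / c0 * \<kappa> + 4 / c0\<^sup>2 * var"
proof -
  have "E (indicator A) \<le> E (\<lambda>G. indicator B G + (2 / c0 * W G + 4 / c0\<^sup>2 * (Y G - p)\<^sup>2))"
  proof (intro graph_mean_mono)
    fix G assume G: "G \<in> graphs n m"
    have nonneg: "0 \<le> 2 / c0 * W G" "0 \<le> 4 / c0\<^sup>2 * (Y G - p)\<^sup>2" using c0 W_nonneg by auto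
    show "indicator A G \<le> indicator B G + (2 / c0 * W G + 4 / c0\<^sup>2 * (Y G - p)\<^sup>2)"
    proof (cases "G \<in> A \<and> G \<notin> B")
      case True
      have dt: "real (degree G v) < t" if "v < n" for v
        using True that max_degree_ge_iff[OF n1, of t G] by (auto simp: B_def not_le)
      have "1 \<le> (\<Sum>v<n. w (degree G v))" using True LR[OF G] by (simp add: A_def)
      also have "\<dots> = Y G + W G"
        unfolding Y_def W_def sum.distrib[symmetric]
      proof (intro sum.cong refl)
        fix v assume "v \<in> {..<n}"
        then have "real (degree G v) < t" using dt by simp
        then show "w (degree G v) = w (degree G v) * indicator {d. real d < s} (degree G v)
            + w (degree G v) * indicator {d. s \<le> real d \<and> real d < s'} (degree G v)"
          using st by (auto simp: indicator_def)
      qed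
      finally have YW: "1 \<le> Y G + W G" .
      have "1 \<le> 2 / c0 * W G + 4 / c0\<^sup>2 * (Y G - p)\<^sup>2"
      proof (cases "W G \<ge> c0 / 2")
        case True
        then have "1 \<le> 2 / c0 * W G" using c0 by (simp add: field_simps)
        then show ?thesis using nonneg by linarith
      next
        case False
        then have "c0 / 2 \<le> Y G - p" using YW p_le by simp
        then have "(c0 / 2)\<^sup>2 \<le> (Y G - p)\<^sup>2" using c0 by (intro power_mono) auto
        then have "1 \<le> 4 / c0\<^sup>2 * (Y G - p)\<^sup>2" using c0 by (simp add: field_simps power2_eq_square)
        then show ?thesis using nonneg by linarith
      qed
      then show ?thesis using True by simp
    qed (use nonneg in \<open>auto simp: indicator_def\<close>)
  qed
  also have "\<dots> = E (indicator B) + (2 / c0 * E W + 4 / c0\<^sup>2 * E (\<lambda>G. (Y G - p)\<^sup>2))"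
    by (simp only: graph_mean_add graph_mean_cmult)
  also have "\<dots> \<le> \<beta> + (2 / c0 * \<kappa> + 4 / c0\<^sup>2 * var)"
    using prob_B mean_W variance c0 by (intro add_mono mult_left_mono) auto
  finally show ?thesis by simp
qed

lemma P0_sym_diff:
  "measure_pmf.prob (P0 n m) ((A - B) \<union> (B - A)) \<le> 2 * \<beta> + 2 / c0 * \<kappa> + 4 / c0\<^sup>2 * var"
proof -
  have "measure_pmf.prob (P0 n m) ((A - B) \<union> (B - A)) \<le> E (\<lambda>G. indicator A G + indicator B G)"
    unfolding prob_P0[OF mN'] by (intro graph_mean_mono) (auto simp: indicator_def)
  then show ?thesis using prob_A prob_B unfolding graph_mean_add by linarith
qed

text \<open>A vertex of degree at least \<open>s'\<close> puts the graph into both events, so on the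
  symmetric difference the likelihood ratio is \<open>Y + W\<close>. There
  \<open>Y \<le> M + Y\<^sup>2 / M\<close>: the first term is charged to the null probabilities of
  \<open>A\<close> and \<open>B\<close>, the second to the second moment. The free \<open>M\<close>
  balances the two.\<close>

lemma P1_sym_diff:
  assumes "M > 0"
  shows "measure_pmf.prob (P1 n m k) ((A - B) \<union> (B - A))
       \<le> M * (2 * \<beta> + 2 / c0 * \<kappa> + 4 / c0\<^sup>2 * var) + (1 + var) / M + \<kappa>"
proof -
  let ?D = "(A - B) \<union> (B - A)"
  have "measure_pmf.prob (P1 n m k) ?D = E (\<lambda>G. \<Sum>v<n. w (degree G v) * indicator ?D G)"
    unfolding graph_mean_sum using n1 k km mN' by (intro prob_P1)
  also have "\<dots> \<le> E (\<lambda>G. (M * (indicator A G + indicator B G) + 1 / M * (Y G)\<^sup>2) + W G)"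
  proof (intro graph_mean_mono)
    fix G assume G: "G \<in> graphs n m"
    show "(\<Sum>v<n. w (degree G v) * indicator ?D G)
        \<le> (M * (indicator A G + indicator B G) + 1 / M * (Y G)\<^sup>2) + W G"
    proof (cases "G \<in> ?D")
      case True
      have ds: "real (degree G v) < s'" if v: "v < n" for v
      proof (rule ccontr)
        assume "\<not> real (degree G v) < s'"
        then have d: "s' \<le> real (degree G v)" by simp
        have "1 \<le> w (degree G v)" using d by (rule high)
        also have "\<dots> \<le> (\<Sum>v<n. w (degree G v))"
          using v by (intro member_le_sum) (auto simp: hub_weight_nonneg)
        finally have "G \<in> A" using LR[OF G] by (simp add: A_def)
        moreover have "t \<le> real (degree G v)" using d st by linarith
        then have "G \<in> B" using v max_degree_ge_iff[OF n1, of t G] by (auto simp: B_def)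
        ultimately show False using True by auto
      qed
      have "(\<Sum>v<n. w (degree G v) * indicator ?D G) = (\<Sum>v<n. w (degree G v))" using True by simp
      also have "\<dots> = Y G + W G"
        unfolding Y_def W_def sum.distrib[symmetric]
      proof (intro sum.cong refl)
        fix v assume "v \<in> {..<n}"
        then have "real (degree G v) < s'" using ds by simp
        then show "w (degree G v) = w (degree G v) * indicator {d. real d < s} (degree G v)
            + w (degree G v) * indicator {d. s \<le> real d \<and> real d < s'} (degree G v)"
          by (auto simp: indicator_def)
      qed
      finally have sum_eq: "(\<Sum>v<n. w (degree G v) * indicator ?D G) = Y G + W G" .
      have "Y G \<le> M + 1 / M * (Y G)\<^sup>2"
      proof (cases "Y G \<le> M")
        case True
        then show ?thesis using assms by (simp add: add_increasing2)
      next
        case False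
        then have "M * Y G \<le> Y G * Y G" using Y_nonneg by (intro mult_right_mono) auto
        then have "Y G \<le> 1 / M * (Y G)\<^sup>2" using assms by (simp add: field_simps power2_eq_square)
        then show ?thesis using assms by simp
      qed
      moreover have "M \<le> M * (indicator A G + indicator B G)"
        using True assms by (auto simp: indicator_def)
      ultimately show ?thesis unfolding sum_eq by linarith
    next
      case False
      then show ?thesis using assms W_nonneg by simp
    qed
  qed
  also have "\<dots> = M * (E (indicator A) + E (indicator B)) + 1 / M * E (\<lambda>G. (Y G)\<^sup>2) + E W"
    by (simp only: graph_mean_add graph_mean_cmult)
  also have "\<dots> \<le> M * (2 * \<beta> + 2 / c0 * \<kappa> + 4 / c0\<^sup>2 * var) + 1 / M * (1 + var) + \<kappa>"
  proof -
    have "M * (E (indicator A) + E (indicator B)) \<le> M * (2 * \<beta> + 2 / c0 * \<kappa> + 4 / c0\<^sup>2 * var)"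
      using prob_A prob_B assms by (intro mult_left_mono) linarith+
    moreover have "p\<^sup>2 \<le> 1" using p_nonneg p_le c0 by (intro power_le_one) auto
    then have "1 / M * E (\<lambda>G. (Y G)\<^sup>2) \<le> 1 / M * (1 + var)"
      using second_moment' assms by (intro mult_left_mono) auto
    ultimately show ?thesis using mean_W by linarith
  qed
  finally show ?thesis by simp
qed

end

subsection \<open>The asymptotic regime\<close>

lemma real_N_pairs: "real (N_pairs n) = real n * (real n - 1) / 2"
proof (cases "n = 0")
  case False
  have "even (n * (n - 1))" by auto
  then have "real (n * (n - 1) div 2) = real (n * (n - 1)) / real 2" by (rule real_of_nat_div)
  with False show ?thesis by (simp add: N_pairs_def choose_two of_nat_diff)
qed (simp add: N_pairs_def)

locale planted_regime =
  fixes \<gamma> \<alpha> :: real and k m :: "nat \<Rightarrow> nat"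
  assumes alpha: "\<alpha> > 1" and k_pos: "k n > 0"
    and k_large: "(\<lambda>n. (ln (real n))\<^sup>2 / real (k n)) \<longlonglongrightarrow> 0"
    and k_small: "(\<lambda>n. real (k n) / sqrt (real n)) \<longlonglongrightarrow> 0"
    and m_eq: "m n = nat (round (real (k n) ^ 2 * real n / (4 * ln (real n)) * (1 + \<gamma> / sqrt (ln (real n)))))"
begin

abbreviation "L n \<equiv> ln (real n)"
abbreviation "K n \<equiv> real (k n)"
abbreviation "N n \<equiv> real (N_pairs n)"
definition "D n = 2 * real (m n) / real n"
text \<open>The ratio of \<open>D\<close> to the critical value \<open>K\<^sup>2 / (2 * L)\<close>.
  The assumption on \<open>m\<close> says that it is \<open>1 + \<gamma> / sqrt L\<close> up to
  rounding.\<close>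

definition "\<rho> n = 2 * L n * D n / (K n)\<^sup>2"
definition "pp n = real (m n) / N n"
definition "x n = sqrt (2 * L n - (1 / \<alpha>) * ln (L n))"
definition "\<sigma> n = sqrt (D n * (1 - pp n))"
text \<open>The planted shift of the hub's degree in units of \<open>sqrt D\<close>, to be compared
  with the normalised threshold \<open>x\<close>.\<close>

definition "\<mu> n = K n / sqrt (D n)"

lemma t_star_eq: "t_star \<alpha> n (m n) = D n + \<sigma> n * x n"
  by (simp add: t_star_def D_def \<sigma>_def x_def pp_def)

lemma L_at_top: "filterlim L at_top sequentially"
  by (rule filterlim_compose[OF ln_at_top filterlim_real_sequentially])

lemma ev_L: "eventually (\<lambda>n. L n \<ge> c) sequentially"
  using L_at_top by (simp add: filterlim_at_top)

lemma ev_n: "eventually (\<lambda>n. real n \<ge> c) sequentially"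
  using filterlim_real_sequentially by (simp add: filterlim_at_top)

lemma K_pos: "K n \<ge> 1" using k_pos[of n] by simp

lemma ev_K: "\<delta> > 0 \<Longrightarrow> eventually (\<lambda>n. (L n)\<^sup>2 \<le> \<delta> * K n) sequentially"
  using order_tendstoD(2)[OF k_large, of \<delta>]
  by (auto elim!: eventually_mono simp: divide_less_eq k_pos less_imp_le)

lemma K_sq_over_n: "(\<lambda>n. (K n)\<^sup>2 / real n) \<longlonglongrightarrow> 0"
  using tendsto_power[OF k_small, of 2] by (simp add: power_divide)

text \<open>Only the rounding of \<open>m\<close> separates \<open>\<rho>\<close> from
  \<open>1 + \<gamma> / sqrt L\<close>. Its effect is bounded very crudely by
  \<open>2 * L\<^sup>2 / K\<close>, because that quantity vanishes by assumption.\<close>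

lemma rho_lim: "(\<lambda>n. sqrt (L n) * (\<rho> n - 1)) \<longlonglongrightarrow> \<gamma>"
proof -
  define q where "q n = (K n)\<^sup>2 * real n / (4 * L n) * (1 + \<gamma> / sqrt (L n))" for n
  have lim: "(\<lambda>n. 2 * ((L n)\<^sup>2 / K n)) \<longlonglongrightarrow> 0" using tendsto_mult_right_zero[OF k_large, of 2] by simp
  have ev: "eventually (\<lambda>n. \<bar>sqrt (L n) * (\<rho> n - 1) - \<gamma>\<bar> \<le> 2 * ((L n)\<^sup>2 / K n)) sequentially"
    using ev_L[of "max 1 (\<gamma>\<^sup>2)"] ev_n[of 1]
  proof eventually_elim
    case (elim n)
    have L1: "L n \<ge> 1" "L n \<ge> \<gamma>\<^sup>2" using elim by auto
    have n1: "real n \<ge> 1" using elim by simp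
    have sL: "sqrt (L n) \<ge> \<bar>\<gamma>\<bar>" using real_sqrt_le_mono[OF L1(2)] by simp
    have sL1: "sqrt (L n) \<ge> 1" "sqrt (L n) * sqrt (L n) = L n" using L1 by auto
    \<comment> \<open>For negative \<open>\<gamma>\<close> the argument of \<open>nat\<close> in
      \<open>m\<close> could be negative and be truncated; \<open>L \<ge> \<gamma>\<^sup>2\<close>
      excludes this.\<close>
    have "- \<gamma> \<le> sqrt (L n)" using sL by linarith
    then have "1 + \<gamma> / sqrt (L n) \<ge> 0" using sL1 by (simp add: field_simps)
    then have q0: "q n \<ge> 0" unfolding q_def using L1 by (intro mult_nonneg_nonneg divide_nonneg_nonneg) auto
    have "0 \<le> round (q n)" using q0 by (metis round_0 round_mono)
    then have mq: "real (m n) = real_of_int (round (q n))" by (simp add: m_eq q_def)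
    define err where "err = real (m n) - q n"
    have err: "\<bar>err\<bar> \<le> 1 / 2" unfolding err_def mq by (rule of_int_round_abs_le)
    have "\<rho> n = 4 * L n * real (m n) / ((K n)\<^sup>2 * real n)" by (simp add: \<rho>_def D_def mult_ac)
    also have "\<dots> = 4 * L n * q n / ((K n)\<^sup>2 * real n) + 4 * L n * err / ((K n)\<^sup>2 * real n)"
      by (simp add: err_def add_divide_distrib[symmetric] algebra_simps)
    also have "4 * L n * q n / ((K n)\<^sup>2 * real n) = 1 + \<gamma> / sqrt (L n)"
    proof -
      have "n \<noteq> Suc 0" using L1 by auto
      then show ?thesis using L1 n1 K_pos[of n] by (simp add: q_def)
    qed
    finally have "sqrt (L n) * (\<rho> n - 1) - \<gamma> = sqrt (L n) * (4 * L n * err / ((K n)\<^sup>2 * real n))"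
      using sL1 by (simp add: distrib_left)
    then have "\<bar>sqrt (L n) * (\<rho> n - 1) - \<gamma>\<bar> = sqrt (L n) * (4 * L n * \<bar>err\<bar>) / ((K n)\<^sup>2 * real n)"
      using L1 by (simp add: abs_mult)
    also have "\<dots> \<le> L n * (4 * L n * (1 / 2)) / ((K n)\<^sup>2 * real n)"
    proof (intro divide_right_mono mult_mono)
      show "sqrt (L n) \<le> L n" using mult_left_mono[OF sL1(1), of "sqrt (L n)"] sL1 by simp
    qed (use err L1 in auto)
    also have "\<dots> \<le> L n * (4 * L n * (1 / 2)) / (K n)"
    proof (intro divide_left_mono)
      have "K n * 1 \<le> K n * (K n * real n)" using K_pos[of n] n1 mult_mono[of 1 "K n" 1 "real n"]
        by (intro mult_left_mono) auto
      then show "K n \<le> (K n)\<^sup>2 * real n" by (simp add: power2_eq_square mult_ac)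
      show "0 < (K n)\<^sup>2 * real n * K n" using K_pos[of n] n1 by auto
    qed (use L1 in auto)
    finally show ?case by (simp add: power2_eq_square mult_ac)
  qed
  have "(\<lambda>n. sqrt (L n) * (\<rho> n - 1) - \<gamma>) \<longlonglongrightarrow> 0"
    by (rule Lim_null_comparison[OF _ lim]) (use ev in simp)
  then show ?thesis by (simp add: LIM_zero_iff)
qed

lemma ev_rho: "eventually (\<lambda>n. \<bar>sqrt (L n) * (\<rho> n - 1)\<bar> \<le> \<bar>\<gamma>\<bar> + 1) sequentially"
  using order_tendstoD(2)[OF tendsto_rabs[OF rho_lim], of "\<bar>\<gamma>\<bar> + 1"]
  by (auto elim!: eventually_mono simp: less_imp_le)

lemma ev_rho_near: "eventually (\<lambda>n. 1 / 2 \<le> \<rho> n \<and> \<rho> n \<le> 2) sequentially"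
  using ev_rho ev_L[of "4 * (\<bar>\<gamma>\<bar> + 1)\<^sup>2"]
proof eventually_elim
  case (elim n)
  have "sqrt (L n) \<ge> sqrt (4 * (\<bar>\<gamma>\<bar> + 1)\<^sup>2)" using elim(2) by simp
  then have s: "sqrt (L n) \<ge> 2 * (\<bar>\<gamma>\<bar> + 1)" by (simp add: real_sqrt_mult)
  have "2 * (\<bar>\<gamma>\<bar> + 1) * \<bar>\<rho> n - 1\<bar> \<le> sqrt (L n) * \<bar>\<rho> n - 1\<bar>" using s by (intro mult_right_mono) auto
  also have "\<dots> \<le> \<bar>\<gamma>\<bar> + 1" using elim(1) s by (simp add: abs_mult)
  finally have "(\<bar>\<gamma>\<bar> + 1) * (2 * \<bar>\<rho> n - 1\<bar>) \<le> (\<bar>\<gamma>\<bar> + 1) * 1" by (simp add: algebra_simps)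
  then have "2 * \<bar>\<rho> n - 1\<bar> \<le> 1" by (subst (asm) mult_le_cancel_left_pos) auto
  then have r: "\<bar>\<rho> n - 1\<bar> \<le> 1 / 2" by simp
  show ?case using abs_le_D1[OF r] abs_le_D2[OF r] by simp
qed

lemma D_rho: "L n > 0 \<Longrightarrow> D n = \<rho> n * (K n)\<^sup>2 / (2 * L n)"
  using K_pos[of n] by (simp add: \<rho>_def)

lemma ev_D: "eventually (\<lambda>n. (K n)\<^sup>2 \<le> 4 * L n * D n \<and> L n * D n \<le> (K n)\<^sup>2) sequentially"
  using ev_rho_near ev_L[of 1]
proof eventually_elim
  case (elim n)
  have e: "2 * L n * D n = \<rho> n * (K n)\<^sup>2" using D_rho[of n] elim by simp
  have "1 / 2 * (K n)\<^sup>2 \<le> \<rho> n * (K n)\<^sup>2" "\<rho> n * (K n)\<^sup>2 \<le> 2 * (K n)\<^sup>2"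
    using elim by (intro mult_right_mono; simp)+
  with e show ?case by linarith
qed

lemma D_nonneg: "D n \<ge> 0" by (simp add: D_def)

lemma ev_D_ge_L: "eventually (\<lambda>n. D n \<ge> L n / 4) sequentially"
  using ev_D ev_K[OF zero_less_one] ev_L[of 1]
proof eventually_elim
  case (elim n)
  have "L n * 1 \<le> L n * L n" using elim by (intro mult_left_mono) auto
  then have "L n \<le> K n" using elim(2) unfolding power2_eq_square by linarith
  then have "L n * L n \<le> (K n)\<^sup>2" using elim unfolding power2_eq_square by (intro mult_mono) auto
  also have "\<dots> \<le> L n * (4 * D n)" using elim by simp
  finally have "L n \<le> 4 * D n" using elim by (subst (asm) mult_le_cancel_left_pos) auto
  then show ?case by simp
qed

lemma ev_D_ge: "eventually (\<lambda>n. D n \<ge> c) sequentially"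
  using ev_D_ge_L ev_L[of "4 * c"] by eventually_elim simp

lemma LD_over_n: "(\<lambda>n. L n * D n / real n) \<longlonglongrightarrow> 0"
proof (rule tendsto_sandwich[OF _ _ tendsto_const K_sq_over_n])
  show "eventually (\<lambda>n. 0 \<le> L n * D n / real n) sequentially"
    using ev_L[of 1] by eventually_elim (simp add: D_nonneg)
  show "eventually (\<lambda>n. L n * D n / real n \<le> (K n)\<^sup>2 / real n) sequentially"
    using ev_D by eventually_elim (simp add: divide_right_mono)
qed

lemma ev_LD:
  assumes "\<delta> > 0"
  shows "eventually (\<lambda>n. L n * D n \<le> \<delta> * real n) sequentially"
  using order_tendstoD(2)[OF LD_over_n assms] ev_n[of 1]
  by eventually_elim (simp add: divide_less_eq)

lemma ev_Dn:
  assumes "\<delta> > 0"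
  shows "eventually (\<lambda>n. D n \<le> \<delta> * real n) sequentially"
  using ev_LD[OF assms] ev_L[of 1]
proof eventually_elim
  case (elim n)
  have "1 * D n \<le> L n * D n" using elim D_nonneg by (intro mult_right_mono) auto
  then show ?case using elim by simp
qed

lemma ev_Kn:
  assumes "\<delta> > 0"
  shows "eventually (\<lambda>n. (K n)\<^sup>2 \<le> \<delta> * real n) sequentially"
  using order_tendstoD(2)[OF K_sq_over_n assms] ev_n[of 1]
  by eventually_elim (simp add: divide_less_eq)

lemma m_D: "real n > 0 \<Longrightarrow> real (m n) = D n * real n / 2"
  by (simp add: D_def)

lemma pp_eq: "real n \<ge> 2 \<Longrightarrow> pp n = D n / (real n - 1)"
  by (simp add: pp_def D_def real_N_pairs field_simps)

lemma pp_nonneg: "pp n \<ge> 0" by (simp add: pp_def)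

lemma ev_pp:
  assumes "\<delta> > 0"
  shows "eventually (\<lambda>n. L n * pp n \<le> \<delta>) sequentially"
proof -
  have "\<delta> / 2 > 0" using assms by simp
  from ev_LD[OF this] ev_n[of 2] ev_L[of 1] show ?thesis
  proof eventually_elim
    case (elim n)
    have "L n * pp n = L n * D n / (real n - 1)" using elim by (simp add: pp_eq)
    also have "\<dots> \<le> (\<delta> / 2 * real n) / (real n / 2)"
      using elim assms D_nonneg[of n] by (intro frac_le) auto
    also have "\<dots> = \<delta>" using elim by simp
    finally show ?case .
  qed
qed

lemma ev_pp_half: "eventually (\<lambda>n. pp n \<le> 1 / 2) sequentially"
  using ev_pp[of "1/2", simplified] ev_L[of 1]
proof eventually_elim
  case (elim n)
  have "1 * pp n \<le> L n * pp n" using elim pp_nonneg by (intro mult_right_mono) auto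
  then show ?case using elim by simp
qed

text \<open>The cubic Taylor error is negligible exactly because \<open>k \<gg> (log n)\<^sup>2\<close>.\<close>

lemma ev_K3:
  assumes "\<delta> > 0"
  shows "eventually (\<lambda>n. K n ^ 3 \<le> \<delta> * (D n)\<^sup>2) sequentially"
proof -
  have "\<delta> / 16 > 0" using assms by simp
  from ev_K[OF this] ev_D ev_L[of 1] show ?thesis
  proof eventually_elim
    case (elim n)
    have "(K n)\<^sup>2 * (K n)\<^sup>2 \<le> (4 * L n * D n) * (4 * L n * D n)"
      using elim D_nonneg[of n] by (intro mult_mono) auto
    also have "\<dots> = 16 * (L n)\<^sup>2 * (D n)\<^sup>2" by (simp add: power2_eq_square)
    also have "\<dots> \<le> 16 * (\<delta> / 16 * K n) * (D n)\<^sup>2" using elim by (intro mult_right_mono mult_left_mono) auto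
    finally have "K n * K n ^ 3 \<le> K n * (\<delta> * (D n)\<^sup>2)"
      by (simp add: power2_eq_square power3_eq_cube mult_ac)
    then show ?case using K_pos[of n] by (subst (asm) mult_le_cancel_left_pos) auto
  qed
qed

lemma ev_KD:
  assumes "\<delta> > 0"
  shows "eventually (\<lambda>n. K n \<le> \<delta> * D n) sequentially"
proof -
  have "\<delta> / 4 > 0" using assms by simp
  from ev_K[OF this] ev_D ev_L[of 1] show ?thesis
  proof eventually_elim
    case (elim n)
    have "1 * L n \<le> L n * L n" using elim by (intro mult_right_mono) auto
    then have "L n \<le> \<delta> / 4 * K n" using elim(1) unfolding power2_eq_square by linarith
    then have "4 * L n * D n \<le> 4 * (\<delta> / 4 * K n) * D n" using D_nonneg by (intro mult_right_mono mult_left_mono) auto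
    then have "K n * K n \<le> K n * (\<delta> * D n)" using elim by (simp add: power2_eq_square mult_ac)
    then show ?case using K_pos[of n] by (subst (asm) mult_le_cancel_left_pos) auto
  qed
qed

text \<open>From \<open>\<mu>\<^sup>2 = 2 * L / \<rho>\<close> the difference of
  \<open>\<mu>\<^sup>2\<close> and \<open>2 * L\<close> is
  \<open>O(L * \<bar>\<rho> - 1\<bar>)\<close>, and dividing by
  \<open>\<mu> + sqrt (2 * L) \<ge> sqrt L\<close> leaves a bounded quantity. This is the form in
  which the scale of \<open>m\<close> is used: the hub sits a bounded number of standard deviations
  from \<open>sqrt (2 * L)\<close>.\<close>

lemma ev_mu: "eventually (\<lambda>n. \<bar>\<mu> n - sqrt (2 * L n)\<bar> \<le> 4 * (\<bar>\<gamma>\<bar> + 1) \<and> \<mu> n \<ge> sqrt (L n)) sequentially"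
  using ev_rho ev_rho_near ev_L[of 1] ev_D_ge[of 1]
proof eventually_elim
  case (elim n)
  have rp: "\<rho> n > 0" using elim by linarith
  have mu2: "(\<mu> n)\<^sup>2 = 2 * L n / \<rho> n"
    using elim K_pos[of n] rp by (simp add: \<mu>_def power_divide \<rho>_def D_nonneg)
  have mupos: "\<mu> n > 0" using elim K_pos[of n] by (simp add: \<mu>_def)
  have "L n \<le> 2 * L n / \<rho> n" using elim rp mult_left_mono[of "\<rho> n" 2 "L n"] by (simp add: field_simps)
  then have "sqrt (L n) \<le> sqrt ((\<mu> n)\<^sup>2)" unfolding mu2 by simp
  then have mug: "sqrt (L n) \<le> \<mu> n" using mupos by simp
  have sL: "sqrt (L n) \<ge> 1" "sqrt (L n) * sqrt (L n) = L n" using elim by auto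
  have "(\<mu> n - sqrt (2 * L n)) * (\<mu> n + sqrt (2 * L n)) = (\<mu> n)\<^sup>2 - 2 * L n"
    using elim by (simp add: algebra_simps power2_eq_square)
  also have "\<dots> = - (2 * L n * (\<rho> n - 1) / \<rho> n)" unfolding mu2 using rp by (simp add: field_simps)
  finally have "\<bar>(\<mu> n - sqrt (2 * L n)) * (\<mu> n + sqrt (2 * L n))\<bar> = \<bar>2 * L n * (\<rho> n - 1) / \<rho> n\<bar>"
    by simp
  moreover have "\<mu> n + sqrt (2 * L n) > 0" using mupos elim by (intro add_pos_nonneg) auto
  moreover have "L n \<ge> 0" using elim by simp
  ultimately have "\<bar>\<mu> n - sqrt (2 * L n)\<bar> * (\<mu> n + sqrt (2 * L n)) = 2 * L n * \<bar>\<rho> n - 1\<bar> / \<rho> n"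
    using rp by (simp only: abs_mult abs_divide abs_of_pos abs_of_nonneg abs_numeral)
  also have "\<dots> \<le> 2 * L n * \<bar>\<rho> n - 1\<bar> / (1 / 2)"
    using elim by (intro divide_left_mono) auto
  also have "\<dots> = 4 * sqrt (L n) * (sqrt (L n) * \<bar>\<rho> n - 1\<bar>)" using sL(2) by (simp add: mult.assoc[symmetric])
  also have "\<dots> \<le> 4 * sqrt (L n) * (\<bar>\<gamma>\<bar> + 1)" using elim sL by (intro mult_left_mono) (auto simp: abs_mult)
  finally have "\<bar>\<mu> n - sqrt (2 * L n)\<bar> * (\<mu> n + sqrt (2 * L n)) \<le> 4 * (\<bar>\<gamma>\<bar> + 1) * sqrt (L n)"
    by (simp only: mult_ac)
  moreover have "\<bar>\<mu> n - sqrt (2 * L n)\<bar> * sqrt (L n) \<le> \<bar>\<mu> n - sqrt (2 * L n)\<bar> * (\<mu> n + sqrt (2 * L n))"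
    using mug elim by (intro mult_left_mono) (auto simp: add_increasing2)
  ultimately have "\<bar>\<mu> n - sqrt (2 * L n)\<bar> * sqrt (L n) \<le> 4 * (\<bar>\<gamma>\<bar> + 1) * sqrt (L n)" by linarith
  then have "\<bar>\<mu> n - sqrt (2 * L n)\<bar> \<le> 4 * (\<bar>\<gamma>\<bar> + 1)" using sL by (subst (asm) mult_le_cancel_right_pos) auto
  with mug show ?case by simp
qed

text \<open>The squares differ by \<open>ln L / \<alpha>\<close>, and dividing by
  \<open>sqrt (2 * L)\<close> makes this vanish. So the correction is invisible to the weights and
  to the hub law; the exact value of \<open>(x n)\<^sup>2\<close> is kept for the union
  bound.\<close>

lemma ev_x:
  assumes "\<delta> > 0"
  shows "eventually (\<lambda>n. sqrt (2 * L n) - \<delta> \<le> x n \<and> x n \<le> sqrt (2 * L n) \<and> sqrt (L n) \<le> x n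
           \<and> (x n)\<^sup>2 = 2 * L n - (1 / \<alpha>) * ln (L n)) sequentially"
proof -
  have "((\<lambda>L::real. ln L / sqrt (2 * L)) \<longlongrightarrow> 0) at_top" by real_asymp
  from filterlim_compose[OF this L_at_top]
  have "eventually (\<lambda>n. ln (L n) / sqrt (2 * L n) < \<delta>) sequentially"
    using assms by (rule order_tendstoD)
  with ev_L[of 1] show ?thesis
  proof eventually_elim
    case (elim n)
    let ?q = "(1 / \<alpha>) * ln (L n)"
    have q: "0 \<le> ?q" "?q \<le> ln (L n)" using elim alpha by (auto simp: divide_le_eq mult_le_cancel_left1)
    have lL: "ln (L n) \<le> L n" using ln_le_minus_one[of "L n"] elim by linarith
    have s0: "sqrt (2 * L n) > 0" using elim by simp
    have ss: "sqrt (2 * L n) * sqrt (2 * L n) = 2 * L n" using elim by simp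
    have x2: "(x n)\<^sup>2 = 2 * L n - ?q" unfolding x_def using q lL elim by simp
    have xu: "x n \<le> sqrt (2 * L n)" unfolding x_def using q by simp
    have xl: "sqrt (L n) \<le> x n" unfolding x_def using q lL by simp
    have x0: "x n \<ge> 0" using xl elim order_trans[of 0 "sqrt (L n)" "x n"] by simp
    have "(sqrt (2 * L n) - x n) * sqrt (2 * L n) \<le> (sqrt (2 * L n) - x n) * (sqrt (2 * L n) + x n)"
      using xu x0 by (intro mult_left_mono) auto
    also have "\<dots> = ?q" using ss x2 by (simp add: algebra_simps power2_eq_square)
    also have "\<dots> \<le> ln (L n)" by (rule q)
    also have "\<dots> \<le> \<delta> * sqrt (2 * L n)" using elim s0 by (simp add: divide_less_eq)
    finally have "sqrt (2 * L n) - x n \<le> \<delta>" using s0 by (subst (asm) mult_le_cancel_right_pos) auto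
    with x2 xu xl show ?case by simp
  qed
qed

end

subsection \<open>Upper tail of the degrees\<close>

context planted_regime
begin

lemma sqrt_D_sq: "sqrt (D n) * sqrt (D n) = D n"
  using D_nonneg by simp

lemma sigma_eq: "pp n \<le> 1 \<Longrightarrow> \<sigma> n = sqrt (D n) * sqrt (1 - pp n)"
  by (simp add: \<sigma>_def real_sqrt_mult)

lemma sqrt_one_minus_pp:
  assumes "pp n \<le> 1 / 2"
  shows "1 - pp n \<le> sqrt (1 - pp n)" "sqrt (1 - pp n) \<le> 1" "1 / 2 \<le> sqrt (1 - pp n)"
proof -
  have "(1 - pp n)\<^sup>2 \<le> 1 - pp n"
    using assms pp_nonneg[of n] mult_left_mono[of "1 - pp n" 1 "1 - pp n"] by (simp add: power2_eq_square)
  then show 1: "1 - pp n \<le> sqrt (1 - pp n)" by (rule real_le_rsqrt)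
  show "sqrt (1 - pp n) \<le> 1" using pp_nonneg[of n] by simp
  show "1 / 2 \<le> sqrt (1 - pp n)" using 1 assms by linarith
qed

lemma sqrt_D_L:
  assumes "L n * D n \<le> (K n)\<^sup>2" "L n \<ge> 0"
  shows "sqrt (D n) * sqrt (L n) \<le> K n"
proof -
  have "sqrt (L n * D n) \<le> sqrt ((K n)\<^sup>2)" using assms by (intro real_sqrt_le_mono)
  then show ?thesis using K_pos[of n] by (simp add: real_sqrt_mult mult.commute)
qed

lemma ev_Y: "eventually (\<lambda>n. sqrt (D n) / 2 * sqrt (L n) \<le> \<sigma> n * x n \<and> \<sigma> n * x n \<le> 2 * K n
     \<and> \<sigma> n \<le> sqrt (D n) \<and> \<sigma> n \<ge> sqrt (D n) / 2) sequentially"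
  using ev_x[OF zero_less_one] ev_pp_half ev_D ev_L[of 1]
proof eventually_elim
  case (elim n)
  note sp = sqrt_one_minus_pp[OF elim(2)]
  have sD: "sqrt (D n) \<ge> 0" using D_nonneg by simp
  have s: "\<sigma> n = sqrt (D n) * sqrt (1 - pp n)" using elim by (intro sigma_eq) simp
  have s1: "\<sigma> n \<le> sqrt (D n)" unfolding s using sp sD by (simp add: mult_left_le)
  have s2: "sqrt (D n) / 2 \<le> \<sigma> n" unfolding s using mult_left_mono[OF sp(3) sD] by simp
  have x0: "0 \<le> sqrt (L n)" "sqrt (L n) \<le> x n" "x n \<le> sqrt (2 * L n)" using elim by auto
  then have x1: "0 \<le> x n" by linarith
  have "\<sigma> n * x n \<le> sqrt (D n) * sqrt (2 * L n)" using s1 x0 x1 sD by (intro mult_mono) auto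
  also have "\<dots> = sqrt 2 * (sqrt (D n) * sqrt (L n))" by (simp add: real_sqrt_mult)
  also have "\<dots> \<le> 2 * (sqrt (D n) * sqrt (L n))"
    using sqrt2_less_2 sD x0 by (intro mult_right_mono) auto
  also have "\<dots> \<le> 2 * K n" using sqrt_D_L[of n] elim by simp
  finally have "\<sigma> n * x n \<le> 2 * K n" .
  moreover have "sqrt (D n) / 2 * sqrt (L n) \<le> \<sigma> n * x n"
    using s2 x0 sD order_trans[OF _ s2, of 0] by (intro mult_mono) auto
  ultimately show ?case using s1 s2 by simp
qed

lemma n1_m_N: "real n \<ge> 2 \<Longrightarrow> real (n - 1) * real (m n) = D n * N n"
  by (simp add: D_def real_N_pairs of_nat_diff)

lemma ev_n1_le_m: "eventually (\<lambda>n. real n \<le> real (m n)) sequentially"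
  using ev_D_ge[of 2] ev_n[of 1]
proof eventually_elim
  case (elim n)
  have "2 * real n \<le> D n * real n" using elim by (intro mult_right_mono) auto
  moreover have "real (m n) = D n * real n / 2" using elim by (intro m_D) simp
  ultimately show ?case by linarith
qed

lemma ev_m_small: "eventually (\<lambda>n. real (m n) + 2 * real n \<le> N n / 2) sequentially"
  using ev_Dn[of "1/8", simplified] ev_n[of 40]
proof eventually_elim
  case (elim n)
  have "D n * real n \<le> (real n / 8) * real n" using elim by (intro mult_right_mono) auto
  moreover have "real (m n) = D n * real n / 2" using elim by (intro m_D) simp
  ultimately have "real (m n) \<le> (real n / 8) * real n / 2" by linarith
  moreover have "40 * real n \<le> real n * real n" using elim by (intro mult_right_mono) auto
  ultimately show ?case by (simp add: real_N_pairs algebra_simps)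
qed

text \<open>As \<open>D\<close> is of smaller order than \<open>n\<close>, both \<open>n - 1\<close>
  and \<open>N - (n - 1) - m\<close> eventually exceed any fixed multiple of \<open>D\<close>, so
  the window radius \<open>A\<close> may be any constant.\<close>

lemma ev_shape:
  assumes A: "A \<ge> 1"
  shows "eventually (\<lambda>n. gaussian_shape (hypergeom (N_pairs n) (n - 1) (m n)) (D n) (sqrt (D n)) A (n - 1)) sequentially"
proof -
  have "1 / (2 * (3 * A + 4)) > 0" using A by simp
  from ev_Dn[OF this] ev_n1_le_m ev_m_small ev_n[of 2] ev_D_ge[of 4] show ?thesis
  proof eventually_elim
    case (elim n)
    have DA: "(3 * A + 4) * D n \<le> real n / 2"
      using elim A mult_left_mono[OF elim(1), of "3 * A + 4"] by (simp add: field_simps)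
    have r1: "real (n - 1) = real n - 1" using elim by (simp add: of_nat_diff)
    show ?case
    proof (rule hypergeom_gaussian_shape)
      show "n - 1 \<le> m n" using elim by simp
      have "real (n - 1 + m n) \<le> real (N_pairs n)" using elim r1 by simp
      then show "n - 1 + m n \<le> N_pairs n" by linarith
      show "real (n - 1) * real (m n) = D n * N n" using elim by (intro n1_m_N)
      show "D n = sqrt (D n) * sqrt (D n)" by (simp only: sqrt_D_sq)
      show "2 \<le> sqrt (D n)" using real_sqrt_le_mono[OF elim(5)] by simp
      show "(3 * A + 4) * D n \<le> real (n - 1)" using DA r1 elim by linarith
      show "(3 * A + 4) * D n \<le> N n - real (n - 1) - real (m n)" using DA r1 elim by linarith
    qed (rule A)
  qed
qed

definition "tail n = (\<Sum>d\<le>n - 1. hypergeom (N_pairs n) (n - 1) (m n) d * indicator {d. t_star \<alpha> n (m n) \<le> real d} d)"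

lemma tail_nonneg: "tail n \<ge> 0"
  unfolding tail_def by (intro sum_nonneg mult_nonneg_nonneg hypergeom_nonneg) auto

text \<open>Since \<open>(x n)\<^sup>2 / 2 = L - ln L / (2 * \<alpha>)\<close>, the Gaussian factor
  times \<open>n\<close> is of order \<open>L powr (1 / (2 * \<alpha>))\<close>, and the Mills
  factor contributes \<open>1 / sqrt L\<close>. The product vanishes because
  \<open>\<alpha> > 1\<close>.\<close>

lemma n_tail_lim: "(\<lambda>n. real n * tail n) \<longlonglongrightarrow> 0"
proof -
  \<comment> \<open>\<open>16 * exp 4\<close> is \<open>4 * exp ((A + 3) * A)\<close> at
    \<open>A = 1\<close>, times 4 from \<open>2 * D / Y\<close> with
    \<open>Y \<ge> sqrt D / 2 * sqrt L\<close>. The 3 collects errors of at most 1 each: the cubic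
    term, \<open>Y / (2 * D)\<close>, and the factor \<open>1 - pp\<close> in the variance.\<close>
  let ?C = "16 * exp 4 * exp (3::real)"
  have "((\<lambda>L::real. ?C * (exp (ln L / (2 * \<alpha>)) / sqrt L)) \<longlongrightarrow> 0) at_top"
  proof -
    have a: "1 / (2 * \<alpha>) - 1 / 2 < 0" using alpha by (simp add: field_simps)
    have "((\<lambda>L::real. L powr (1 / (2 * \<alpha>) - 1 / 2)) \<longlongrightarrow> 0) at_top"
      using a by (rule tendsto_neg_powr) (rule filterlim_ident)
    then have "((\<lambda>L::real. ?C * (L powr (1 / (2 * \<alpha>) - 1 / 2))) \<longlongrightarrow> 0) at_top"
      by (rule tendsto_mult_right_zero)
    then show ?thesis
    proof (rule Lim_transform_eventually)
      show "eventually (\<lambda>L::real. ?C * (L powr (1 / (2 * \<alpha>) - 1 / 2)) = ?C * (exp (ln L / (2 * \<alpha>)) / sqrt L)) at_top"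
        using eventually_gt_at_top[of 0]
      proof eventually_elim
        case (elim L)
        have "L powr (1 / (2 * \<alpha>) - 1 / 2) = L powr (1 / (2 * \<alpha>)) / sqrt L"
          using elim by (simp add: powr_diff powr_half_sqrt)
        moreover have "L powr (1 / (2 * \<alpha>)) = exp (ln L / (2 * \<alpha>))" using elim by (simp add: powr_def)
        ultimately show ?case by simp
      qed
    qed
  qed
  from filterlim_compose[OF this L_at_top]
  have lim: "(\<lambda>n. ?C * (exp (ln (L n) / (2 * \<alpha>)) / sqrt (L n))) \<longlonglongrightarrow> 0" .
  have "eventually (\<lambda>n. real n * tail n \<le> ?C * (exp (ln (L n) / (2 * \<alpha>)) / sqrt (L n))) sequentially"
    using ev_shape[OF order_refl] ev_Y ev_x[OF zero_less_one] ev_pp[OF zero_less_one] ev_pp_half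
      ev_KD[of "1/3", simplified] ev_K3[of "1/27", simplified] ev_D_ge[of 4] ev_L[of 1] ev_n[of 2]
  proof eventually_elim
    case (elim n)
    interpret gaussian_shape "hypergeom (N_pairs n) (n - 1) (m n)" "D n" "sqrt (D n)" 1 "n - 1" by fact
    define Y where "Y = \<sigma> n * x n"
    have sD: "sqrt (D n) \<ge> 2" by (rule r_ge)
    have sL: "sqrt (L n) \<ge> 1" using elim by simp
    have Yl: "sqrt (D n) / 2 * sqrt (L n) \<le> Y" and Yu: "Y \<le> 2 * K n" using elim by (auto simp: Y_def)
    have Y1: "Y \<ge> 1"
    proof -
      have "1 * 1 \<le> sqrt (D n) / 2 * sqrt (L n)" using sD sL D_nonneg[of n] by (intro mult_mono) auto
      then show ?thesis using Yl by simp
    qed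
    have K1: "K n \<ge> 1" by (rule K_pos)
    have YD: "Y + 1 \<le> 3 * K n" using Yu K1 by linarith
    have YD': "Y + 1 \<le> D n" using YD elim by simp
    have e1: "(Y + 1) ^ 3 / (D n)\<^sup>2 \<le> 1"
    proof -
      have "(Y + 1) ^ 3 \<le> (3 * K n) ^ 3" using YD Y1 by (intro power_mono) auto
      also have "\<dots> = 27 * K n ^ 3" by (simp add: power_mult_distrib)
      also have "\<dots> \<le> (D n)\<^sup>2" using elim by simp
      finally show ?thesis using D_ge by (simp add: divide_le_eq)
    qed
    have e2: "Y * (Y - 1) / (2 * D n) \<ge> L n - ln (L n) / (2 * \<alpha>) - 2"
    proof -
      have "\<sigma> n * \<sigma> n = D n * (1 - pp n)" unfolding \<sigma>_def using elim D_nonneg[of n] by simp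
      then have "Y * Y = D n * (1 - pp n) * (x n)\<^sup>2" by (simp add: Y_def power2_eq_square mult_ac)
      then have "Y * Y / (2 * D n) = (1 - pp n) * (x n)\<^sup>2 / 2" using D_ge by simp
      also have "\<dots> = (x n)\<^sup>2 / 2 - pp n * (x n)\<^sup>2 / 2"
        by (simp add: left_diff_distrib diff_divide_distrib)
      also have "\<dots> \<ge> (x n)\<^sup>2 / 2 - pp n * (2 * L n) / 2"
      proof -
        have "0 \<le> (1 / \<alpha>) * ln (L n)" using elim alpha by simp
        then have "(x n)\<^sup>2 \<le> 2 * L n" using elim by simp
        then have "pp n * (x n)\<^sup>2 \<le> pp n * (2 * L n)" using pp_nonneg by (intro mult_left_mono)
        then show ?thesis by simp
      qed
      finally have "Y * Y / (2 * D n) \<ge> L n - ln (L n) / (2 * \<alpha>) - L n * pp n"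
        using elim by (simp add: diff_divide_distrib mult.commute)
      moreover have "Y / (2 * D n) \<le> 1" using YD' D_ge by (simp add: divide_le_eq)
      moreover have "Y * (Y - 1) / (2 * D n) = Y * Y / (2 * D n) - Y / (2 * D n)"
        by (simp add: algebra_simps diff_divide_distrib)
      ultimately show ?thesis using elim by linarith
    qed
    have "tail n = sum (hypergeom (N_pairs n) (n - 1) (m n)) {d. d \<le> n - 1 \<and> D n + Y \<le> real d}"
      unfolding tail_def t_star_eq Y_def[symmetric]
      by (intro sum.mono_neutral_cong_right) (auto simp: indicator_def)
    also have "\<dots> \<le> 4 * exp ((1 + 3) * 1) / sqrt (D n) * (2 * D n / Y)
        * exp (- (Y * (Y - 1) / (2 * D n)) + (Y + 1) ^ 3 / (D n)\<^sup>2)"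
      by (rule tail_le[OF Y1 YD'])
    also have "\<dots> \<le> 4 * exp 4 / sqrt (D n) * (2 * D n / (sqrt (D n) / 2 * sqrt (L n)))
        * exp (3 - L n + ln (L n) / (2 * \<alpha>))"
    proof (intro mult_mono divide_left_mono)
      show "exp (- (Y * (Y - 1) / (2 * D n)) + (Y + 1) ^ 3 / (D n)\<^sup>2) \<le> exp (3 - L n + ln (L n) / (2 * \<alpha>))"
        using e1 e2 by simp
      show "0 < Y * (sqrt (D n) / 2 * sqrt (L n))" using Y1 elim by (intro mult_pos_pos) auto
    qed (use Yl sD sL D_ge Y1 elim in auto)
    also have "4 * exp 4 / sqrt (D n) * (2 * D n / (sqrt (D n) / 2 * sqrt (L n))) = 16 * exp 4 / sqrt (L n)"
    proof -
      have "4 * c / r * (2 * (r * r) / (r / 2 * l)) = 16 * c / l" if "r \<noteq> 0" for r c l :: real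
        using that by simp
      from this[of "sqrt (D n)" "exp 4" "sqrt (L n)"] show ?thesis unfolding sqrt_D_sq using elim by simp
    qed
    also have "exp (3 - L n + ln (L n) / (2 * \<alpha>)) = exp 3 * exp (ln (L n) / (2 * \<alpha>)) / real n"
      using elim by (simp add: exp_add exp_diff)
    finally have "tail n \<le> ?C * (exp (ln (L n) / (2 * \<alpha>)) / sqrt (L n)) / real n" by simp
    then show ?case using elim by (simp add: field_simps)
  qed
  then show ?thesis
    by (intro tendsto_sandwich[OF _ _ tendsto_const lim]) (auto simp: tail_nonneg)
qed

text \<open>The value of \<open>c\<close> in \<open>likelihood_bounds\<close>. With the floor,
  integers below the threshold are at most \<open>cutoff n\<close>, and integers beyond
  \<open>cutoff n\<close> are at least the threshold, so \<open>tail\<close> also bounds the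
  truncation error.\<close>

definition "cutoff n = nat \<lfloor>t_star \<alpha> n (m n)\<rfloor>"

lemma ev_cut: "eventually (\<lambda>n. real (cutoff n) \<le> 2 * D n \<and> t_star \<alpha> n (m n) \<ge> 0) sequentially"
  using ev_Y ev_KD[of "1/2", simplified]
proof eventually_elim
  case (elim n)
  have "0 \<le> sqrt (D n) / 2 * sqrt (L n)" using D_nonneg[of n]
    by (cases "n = 0") auto
  then have t: "0 \<le> t_star \<alpha> n (m n)" "t_star \<alpha> n (m n) \<le> 2 * D n"
    unfolding t_star_eq using elim D_nonneg[of n] by linarith+
  then show ?case unfolding cutoff_def by linarith
qed

text \<open>With \<open>c \<le> 2 * D\<close>, \<open>m = D * n / 2\<close> and \<open>N\<close>
  about \<open>n\<^sup>2 / 2\<close>, each of the error terms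
  \<open>c\<^sup>2 * N / (n\<^sup>2 * m)\<close>, \<open>c\<^sup>2 / m\<close> and
  \<open>c\<^sup>2 / N\<close> is \<open>O(D / n)\<close>. The constants 32 and 64 are
  generous.\<close>

lemma pair_error_lim:
  assumes "\<delta> > 0"
  shows "eventually (\<lambda>n. pair_error n (m n) (cutoff n) \<le> 1 + \<delta>) sequentially"
proof -
  have "(\<lambda>n. D n / real n) \<longlonglongrightarrow> 0"
  proof (rule tendsto_sandwich[OF _ _ tendsto_const LD_over_n])
    show "eventually (\<lambda>n. D n / real n \<le> L n * D n / real n) sequentially"
      using ev_L[of 1]
    proof eventually_elim
      case (elim n)
      have "1 * D n \<le> L n * D n" using elim D_nonneg by (intro mult_right_mono) auto
      then show ?case by (simp add: divide_right_mono)
    qed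
  qed (simp add: D_nonneg)
  then have "(\<lambda>n. (1 + 32 * (D n / real n))\<^sup>2 * exp (64 * (D n / real n))) \<longlonglongrightarrow> (1 + 32 * 0)\<^sup>2 * exp (64 * 0)"
    by (intro tendsto_intros)
  then have lim: "eventually (\<lambda>n. (1 + 32 * (D n / real n))\<^sup>2 * exp (64 * (D n / real n)) < 1 + \<delta>) sequentially"
    using assms by (intro order_tendstoD(2)) auto
  from lim ev_cut ev_Dn[of "1/16", simplified] ev_n[of 32] ev_m_small ev_n1_le_m show ?thesis
  proof eventually_elim
    case (elim n)
    define c where "c = real (cutoff n)"
    have n: "real n \<ge> 32" using elim by simp
    have c: "0 \<le> c" "c \<le> 2 * D n" "c \<le> real n / 8" using elim by (auto simp: c_def)
    have mD: "real (m n) = D n * real n / 2" using n by (intro m_D) simp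
    have m0: "real (m n) > 0" using elim n by linarith
    have cm: "2 * c \<le> real (m n) / 2" using mult_left_mono[of 32 "real n" "D n"] D_nonneg[of n] n c mD by linarith
    have c2: "c\<^sup>2 \<le> 8 * (D n / real n) * real (m n)"
    proof -
      have "c\<^sup>2 \<le> (2 * D n)\<^sup>2" using c by (intro power_mono) auto
      also have "\<dots> = 8 * (D n / real n) * real (m n)" unfolding mD using n by (simp add: power2_eq_square)
      finally show ?thesis .
    qed
    have pos: "real (m n) / 2 \<le> real (m n) - 2 * c" "N n / 2 \<le> N n - 2 * real n - real (m n)" "real (m n) \<le> N n"
      using cm elim n by linarith+
    have d1: "c\<^sup>2 * N n / ((real n - 2 - c)\<^sup>2 * (real (m n) - 2 * c)) \<le> 32 * (D n / real n)"
    proof -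
      have "N n \<le> (real n)\<^sup>2 / 2" using n by (simp add: real_N_pairs power2_eq_square algebra_simps)
      then have "c\<^sup>2 * N n \<le> (8 * (D n / real n) * real (m n)) * ((real n)\<^sup>2 / 2)"
        using c2 D_nonneg[of n] by (intro mult_mono) auto
      moreover have "(3 / 4 * real n)\<^sup>2 * (real (m n) / 2) \<le> (real n - 2 - c)\<^sup>2 * (real (m n) - 2 * c)"
        using pos c n m0 by (intro mult_mono power_mono) auto
      moreover have "0 < (3 / 4 * real n)\<^sup>2 * (real (m n) / 2)" using n m0 by simp
      ultimately have "c\<^sup>2 * N n / ((real n - 2 - c)\<^sup>2 * (real (m n) - 2 * c))
          \<le> (8 * (D n / real n) * real (m n)) * ((real n)\<^sup>2 / 2) / ((3 / 4 * real n)\<^sup>2 * (real (m n) / 2))"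
        using D_nonneg[of n] by (intro frac_le) auto
      also have "\<dots> = 128 / 9 * (D n / real n)" using n m0 by (simp add: power2_eq_square)
      also have "\<dots> \<le> 32 * (D n / real n)" using D_nonneg[of n] by (intro mult_right_mono) auto
      finally show ?thesis .
    qed
    have d2: "c * (c / (real (m n) - 2 * c)) \<le> 16 * (D n / real n)"
    proof -
      have "c * c / (real (m n) - 2 * c) \<le> (8 * (D n / real n) * real (m n)) / (real (m n) / 2)"
        using c2 pos m0 D_nonneg[of n] by (intro frac_le) (auto simp: power2_eq_square)
      then show ?thesis using m0 by simp
    qed
    have d3: "c * (c / (N n - 2 * real n - real (m n))) \<le> 16 * (D n / real n)"
    proof -
      have "c * c / (N n - 2 * real n - real (m n)) \<le> (8 * (D n / real n) * real (m n)) / (real (m n) / 2)"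
        using c2 pos m0 D_nonneg[of n] by (intro frac_le) (auto simp: power2_eq_square)
      then show ?thesis using m0 by simp
    qed
    let ?u = "c / (real (m n) - 2 * c)" and ?v = "c / (N n - 2 * real n - real (m n))"
    have uv: "?u \<ge> 0" "?v \<ge> 0" using pos c m0 by (auto intro!: divide_nonneg_nonneg)
    have "((1 + ?u) * (1 + ?v)) ^ cutoff n \<le> (exp ?u * exp ?v) ^ cutoff n"
      using uv by (intro power_mono mult_mono exp_ge_add_one_self) auto
    also have "\<dots> = exp (c * (?u + ?v))"
      by (simp add: exp_of_nat_mult[symmetric] mult_exp_exp c_def)
    also have "\<dots> \<le> exp (64 * (D n / real n))"
    proof -
      have "0 \<le> D n / real n" using D_nonneg[of n] by simp
      then show ?thesis unfolding exp_le_cancel_iff distrib_left using d2 d3 by linarith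
    qed
    finally have "pair_error n (m n) (cutoff n) \<le> (1 + 32 * (D n / real n))\<^sup>2 * exp (64 * (D n / real n))"
      unfolding pair_error_def c_def[symmetric] using d1 uv pos m0
      by (intro mult_mono power_mono add_left_mono) auto
    then show ?case using elim by simp
  qed
qed

end

subsection \<open>The weight of a single vertex\<close>

lemma binomial_ratio_eq_prod:
  assumes "k \<le> a" "k \<le> b"
  shows "real (a choose k) / real (b choose k) = (\<Prod>i<k. (real a - real i) / (real b - real i))"
proof -
  have "real (a choose k) / real (b choose k)
      = (\<Prod>i<k. real (a - i) / real (k - i)) / (\<Prod>i<k. real (b - i) / real (k - i))"
    using assms by (simp add: binomial_altdef_of_nat lessThan_atLeast0)
  also have "\<dots> = (\<Prod>i<k. (real a - real i) / (real b - real i))"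
    unfolding prod_dividef[symmetric] using assms by (intro prod.cong) (auto simp: of_nat_diff)
  finally show ?thesis .
qed

text \<open>Replacing \<open>(N choose m) / ((N - k) choose (m - k))\<close> by
  \<open>(N choose k) / (m choose k)\<close> leaves \<open>k\<close> factors, each close to
  \<open>(d - i) / D\<close>.\<close>

lemma hub_weight_eq_prod:
  assumes "k \<le> d" "k \<le> n - 1" "k \<le> m" "m \<le> N_pairs n"
  shows "real n * hub_weight n m k d = (if n = 0 then 0 else
     (\<Prod>i<k. ((real d - real i) / (real (n - 1) - real i)) * ((real (N_pairs n) - real i) / (real m - real i))))"
proof -
  let ?N = "N_pairs n"
  have "(?N choose m) * (m choose k) = (?N choose k) * ((?N - k) choose (m - k))"
    using assms by (intro choose_mult) auto
  then have "real (?N choose m) * real (m choose k) = real (?N choose k) * real ((?N - k) choose (m - k))"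
    unfolding of_nat_mult[symmetric] by simp
  moreover have "real (m choose k) > 0" "real ((?N - k) choose (m - k)) > 0" using assms by auto
  ultimately have r: "real (?N choose m) / real ((?N - k) choose (m - k)) = real (?N choose k) / real (m choose k)"
    by (simp add: field_simps)
  have "real n * hub_weight n m k d = (if n = 0 then 0 else
      (real (d choose k) / real ((n - 1) choose k)) * (real (?N choose m) / real ((?N - k) choose (m - k))))"
    by (simp add: hub_weight_def)
  also have "\<dots> = (if n = 0 then 0 else
     (\<Prod>i<k. ((real d - real i) / (real (n - 1) - real i)) * ((real ?N - real i) / (real m - real i))))"
    unfolding r prod.distrib using assms binomial_ratio_eq_prod[of k d "n - 1"] binomial_ratio_eq_prod[of k ?N m]
    by simp
  finally show ?thesis .
qed

lemma sum_lessThan_real: "(\<Sum>i<k. real i) = real k * (real k - 1) / 2"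
  by (induction k) (auto simp: field_simps)

lemma exp_le_one_plus:
  fixes z :: real
  assumes "\<bar>z\<bar> \<le> 1 / 2"
  shows "exp (z - 2 * z\<^sup>2) \<le> 1 + z"
proof (cases "z \<ge> 0")
  case True
  have "z - z\<^sup>2 \<le> ln (1 + z)" using True assms by (intro ln_one_plus_pos_lower_bound) auto
  then have "z - 2 * z\<^sup>2 \<le> ln (1 + z)" using zero_le_power2[of z] by linarith
  then have "exp (z - 2 * z\<^sup>2) \<le> exp (ln (1 + z))" by simp
  then show ?thesis using True by simp
next
  case False
  have "- (- z) - 2 * (- z)\<^sup>2 \<le> ln (1 - (- z))" using False assms by (intro ln_one_minus_pos_lower_bound) auto
  then have "exp (z - 2 * z\<^sup>2) \<le> exp (ln (1 + z))" by simp
  then show ?thesis using assms by simp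
qed

text \<open>Applying \<open>1 + z \<le> exp z\<close> to \<open>(d - i) / D\<close> gives a bound
  without quadratic error and for every \<open>d\<close>. The terms \<open>- i / D\<close> sum to
  \<open>- k\<^sup>2 / (2 * D) + k / (2 * D)\<close>, and the corrections for sampling without
  replacement cost \<open>4 * k / (n - 1)\<close> per factor.\<close>

lemma hub_weight_le:
  fixes D :: real
  assumes D: "D > 0" "real (n - 1) * real m = D * real (N_pairs n)"
    and k: "2 * k \<le> n - 1" "0 < n - 1" "n - 1 \<le> m" "m \<le> N_pairs n"
  shows "real n * hub_weight n m k d
       \<le> exp (real k * (real d - D) / D - (real k)\<^sup>2 / (2 * D) + real k / (2 * D) + 4 * (real k)\<^sup>2 / real (n - 1))"
proof (cases "k \<le> d")
  case True
  define M where "M = real (n - 1)"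
  let ?N = "real (N_pairs n)"
  have N0: "?N > 0" using k by simp
  have M0: "M > 0" using k by (simp add: M_def)
  have m0: "real m > 0" using k by simp
  have "real n * hub_weight n m k d
      = (\<Prod>i<k. ((real d - real i) / (M - real i)) * ((?N - real i) / (real m - real i)))"
    unfolding M_def using True k hub_weight_eq_prod[of k d n m] by simp
  also have "\<dots> \<le> (\<Prod>i<k. exp ((real d - real i) / D - 1 + 4 * real k / M))"
  proof (intro prod_mono conjI)
    fix i assume i: "i \<in> {..<k}"
    have iM: "2 * real i \<le> M" "2 * real i \<le> real m" "real i \<le> ?N" "real i \<le> real d" "real i \<le> real k"
      using i k True by (auto simp: M_def)
    have mM: "M \<le> real m" using k by (simp add: M_def)
    have p: "M - real i \<ge> M / 2" "real m - real i \<ge> M / 2" using iM mM by linarith+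
    show "0 \<le> ((real d - real i) / (M - real i)) * ((?N - real i) / (real m - real i))"
      using iM p M0 by (intro mult_nonneg_nonneg divide_nonneg_nonneg) auto
    have f: "1 + real i / (M - real i) = M / (M - real i)" "1 + real i / (real m - real i) = real m / (real m - real i)"
      using p M0 by (auto simp: field_simps)
    have fb: "real i / (M - real i) \<le> 2 * real k / M" "real i / (real m - real i) \<le> 2 * real k / M"
      using frac_le[of "real k" "real i" "M / 2" "M - real i"] frac_le[of "real k" "real i" "M / 2" "real m - real i"] iM p M0
      by (simp_all add: mult.commute)
    have "((real d - real i) / (M - real i)) * ((?N - real i) / (real m - real i))
        = ((real d - real i) * (?N - real i) / (M * real m)) * ((M / (M - real i)) * (real m / (real m - real i)))"
      using M0 m0 by simp
    also have "\<dots> = ((real d - real i) / D) * ((?N - real i) / ?N) * ((1 + real i / (M - real i)) * (1 + real i / (real m - real i)))"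
      unfolding f D(2)[folded M_def] by simp
    also have "\<dots> \<le> (exp ((real d - real i) / D - 1) * 1) * (exp (2 * real k / M) * exp (2 * real k / M))"
    proof (intro mult_mono)
      show "(real d - real i) / D \<le> exp ((real d - real i) / D - 1)"
        using exp_ge_add_one_self[of "(real d - real i) / D - 1"] by simp
      show "(?N - real i) / ?N \<le> 1" using N0 by simp
      show "1 + real i / (M - real i) \<le> exp (2 * real k / M)"
        using exp_ge_add_one_self[of "2 * real k / M"] fb by linarith
      show "1 + real i / (real m - real i) \<le> exp (2 * real k / M)"
        using exp_ge_add_one_self[of "2 * real k / M"] fb by linarith
    qed (use iM p M0 N0 D in auto)
    also have "\<dots> = exp ((real d - real i) / D - 1 + (2 * real k / M + 2 * real k / M))"
      by (simp only: exp_add mult_1_right)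
    also have "2 * real k / M + 2 * real k / M = 4 * real k / M" by simp
    finally show "((real d - real i) / (M - real i)) * ((?N - real i) / (real m - real i))
        \<le> exp ((real d - real i) / D - 1 + 4 * real k / M)" .
  qed
  also have "\<dots> = exp (\<Sum>i<k. (real d - real i) / D - 1 + 4 * real k / M)" by (simp add: exp_sum)
  also have "(\<Sum>i<k. (real d - real i) / D - 1 + 4 * real k / M)
      = real k * (real d / D - 1 + 4 * real k / M) - (\<Sum>i<k. real i) / D"
    by (simp add: diff_divide_distrib sum.distrib sum_subtractf sum_divide_distrib algebra_simps)
  also have "\<dots> = real k * (real d - D) / D - (real k)\<^sup>2 / (2 * D) + real k / (2 * D) + 4 * (real k)\<^sup>2 / M"
    unfolding sum_lessThan_real using D(1) M0 by (simp add: field_simps power2_eq_square)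
  finally show ?thesis by (simp only: M_def)
next
  case False
  then show ?thesis by (simp add: hub_weight_eq_0)
qed

text \<open>The reverse estimate \<open>exp (z - 2 * z\<^sup>2) \<le> 1 + z\<close> needs
  \<open>\<bar>z\<bar> \<le> 1 / 2\<close>, so \<open>b\<close> bounds
  \<open>\<bar>d - i - D\<bar>\<close> over all \<open>i < k\<close>. The quadratic loss
  \<open>2 * k * b\<^sup>2 / D\<^sup>2\<close> is of order \<open>k^3 / D^2\<close> when
  \<open>b\<close> is of order \<open>k\<close>; this is where \<open>ev_K3\<close> is
  needed.\<close>

lemma hub_weight_ge:
  fixes D b :: real
  assumes D: "D > 0" "real (n - 1) * real m = D * real (N_pairs n)"
    and k: "2 * k \<le> n - 1" "0 < n - 1" "n - 1 \<le> m" "m \<le> N_pairs n" "k \<le> d"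
    and b: "real d - D \<le> b" "- b \<le> real d - D - real k" "b \<le> D / 2"
  shows "exp (real k * (real d - D) / D - (real k)\<^sup>2 / (2 * D) - 2 * real k * b\<^sup>2 / D\<^sup>2 - 2 * (real k)\<^sup>2 / real (N_pairs n))
       \<le> real n * hub_weight n m k d"
proof -
  define M where "M = real (n - 1)"
  let ?N = "real (N_pairs n)"
  have N0: "?N > 0" using k by simp
  have M0: "M > 0" using k by (simp add: M_def)
  have m0: "real m > 0" using k by simp
  have b0: "0 \<le> b" using b by linarith
  let ?c = "2 * b\<^sup>2 / D\<^sup>2 + 2 * real k / ?N"
  have "real k * (real d - D) / D - (real k)\<^sup>2 / (2 * D) - 2 * real k * b\<^sup>2 / D\<^sup>2 - 2 * (real k)\<^sup>2 / ?N
      \<le> real k * (real d / D - 1 - ?c) - (\<Sum>i<k. real i) / D"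
  proof -
    have "real k * (real d / D - 1 - ?c) - (\<Sum>i<k. real i) / D
        = real k * (real d - D) / D - (real k)\<^sup>2 / (2 * D) + real k / (2 * D) - 2 * real k * b\<^sup>2 / D\<^sup>2 - 2 * (real k)\<^sup>2 / ?N"
      unfolding sum_lessThan_real using D(1) N0 by (simp add: field_simps power2_eq_square)
    moreover have "real k / (2 * D) \<ge> 0" using D by simp
    ultimately show ?thesis by linarith
  qed
  also have "\<dots> = (\<Sum>i<k. (real d - real i) / D - 1 - ?c)"
    by (simp add: diff_divide_distrib sum.distrib sum_subtractf sum_divide_distrib algebra_simps)
  finally have "exp (real k * (real d - D) / D - (real k)\<^sup>2 / (2 * D) - 2 * real k * b\<^sup>2 / D\<^sup>2 - 2 * (real k)\<^sup>2 / ?N)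
      \<le> exp (\<Sum>i<k. (real d - real i) / D - 1 - ?c)" by simp
  also have "\<dots> = (\<Prod>i<k. exp ((real d - real i) / D - 1 - ?c))" by (simp add: exp_sum)
  also have "\<dots> \<le> (\<Prod>i<k. ((real d - real i) / (M - real i)) * ((?N - real i) / (real m - real i)))"
  proof (intro prod_mono conjI)
    fix i assume i: "i \<in> {..<k}"
    have iM: "2 * real i \<le> M" "2 * real i \<le> real m" "real i \<le> ?N" "real i \<le> real d" "real i \<le> real k" "2 * real k \<le> ?N"
      using i k by (auto simp: M_def)
    have p: "M - real i > 0" "real m - real i > 0" using iM m0 M0 by linarith+
    define z where "z = (real d - real i) / D - 1"
    have zD: "z = (real d - real i - D) / D" using D by (simp add: z_def field_simps)
    have ab: "\<bar>real d - real i - D\<bar> \<le> b" using b iM by linarith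
    have "\<bar>z\<bar> \<le> b / D" unfolding zD using ab D by (simp add: divide_right_mono abs_divide)
    moreover have "b / D \<le> 1 / 2" using b D by (simp add: field_simps)
    ultimately have z: "\<bar>z\<bar> \<le> 1 / 2" "z\<^sup>2 \<le> b\<^sup>2 / D\<^sup>2"
      using power_mono[of "\<bar>z\<bar>" "b / D" 2] by (linarith, simp add: power_divide)
    have zz: "exp (z - 2 * b\<^sup>2 / D\<^sup>2) \<le> 1 + z"
    proof -
      have "exp (z - 2 * b\<^sup>2 / D\<^sup>2) \<le> exp (z - 2 * z\<^sup>2)" using z by simp
      also have "\<dots> \<le> 1 + z" using z by (intro exp_le_one_plus)
      finally show ?thesis .
    qed
    have NN: "exp (- (2 * real k / ?N)) \<le> (?N - real i) / ?N"
    proof -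
      have q: "0 \<le> real k / ?N" "real k / ?N \<le> 1 / 2" using iM N0 by (auto simp: field_simps)
      have "exp (- (real k / ?N) - 2 * (- (real k / ?N))\<^sup>2) \<le> 1 + - (real k / ?N)"
        using q by (intro exp_le_one_plus) auto
      moreover have "2 * (real k / ?N)\<^sup>2 \<le> real k / ?N"
        using q mult_left_mono[OF q(2) q(1)] by (simp add: power2_eq_square)
      then have "exp (- (2 * real k / ?N)) \<le> exp (- (real k / ?N) - 2 * (- (real k / ?N))\<^sup>2)"
        by (simp add: power2_eq_square)
      moreover have "1 + - (real k / ?N) \<le> (?N - real i) / ?N" using iM N0 by (simp add: field_simps)
      ultimately show ?thesis by linarith
    qed
    have f: "1 \<le> M / (M - real i)" "1 \<le> real m / (real m - real i)" using p by (auto simp: field_simps)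
    have "exp ((real d - real i) / D - 1 - ?c) = exp (z - 2 * b\<^sup>2 / D\<^sup>2) * exp (- (2 * real k / ?N)) * (1 * 1)"
      by (simp add: z_def mult_exp_exp algebra_simps)
    also have "\<dots> \<le> ((1 + z) * ((?N - real i) / ?N)) * ((M / (M - real i)) * (real m / (real m - real i)))"
    proof (intro mult_mono zz NN f)
      show z1: "0 \<le> 1 + z" using z by linarith
      show "0 \<le> (1 + z) * ((?N - real i) / ?N)" using z1 iM N0 by (intro mult_nonneg_nonneg) auto
    qed (use p m0 in auto)
    also have "\<dots> = ((real d - real i) / D) * ((?N - real i) / ?N) * ((M / (M - real i)) * (real m / (real m - real i)))"
      by (simp add: z_def)
    also have "\<dots> = ((real d - real i) * (?N - real i) / (M * real m)) * ((M / (M - real i)) * (real m / (real m - real i)))"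
      unfolding D(2)[folded M_def] by simp
    also have "\<dots> = ((real d - real i) / (M - real i)) * ((?N - real i) / (real m - real i))"
      using M0 m0 by simp
    finally show "exp ((real d - real i) / D - 1 - ?c) \<le> ((real d - real i) / (M - real i)) * ((?N - real i) / (real m - real i))" .
  qed simp
  also have "\<dots> = real n * hub_weight n m k d"
    unfolding M_def using k hub_weight_eq_prod[of k d n m] by simp
  finally show ?thesis .
qed

context planted_regime
begin

text \<open>In the coordinate \<open>y = (d - D) / sqrt D\<close> the main exponent of the two
  weight bounds becomes \<open>\<mu> * y - \<mu>\<^sup>2 / 2\<close>, the log-likelihood ratio of a
  Gaussian shifted by \<open>\<mu>\<close>.\<close>

lemma mu_facts:
  assumes "D n > 0"
  shows "K n * (sqrt (D n) * y) / D n = \<mu> n * y" "(K n)\<^sup>2 / (2 * D n) = (\<mu> n)\<^sup>2 / 2"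
proof -
  have "c * (r * y) / (r * r) = c / r * y" if "r \<noteq> 0" for c r :: real
    using that by simp
  from this[of "sqrt (D n)" "K n"] show "K n * (sqrt (D n) * y) / D n = \<mu> n * y"
    unfolding sqrt_D_sq \<mu>_def using assms by simp
  show "(K n)\<^sup>2 / (2 * D n) = (\<mu> n)\<^sup>2 / 2" unfolding \<mu>_def using assms by (simp add: power_divide)
qed

lemma ev_basic: "eventually (\<lambda>n. 2 * k n \<le> n - 1 \<and> 0 < n - 1 \<and> n - 1 \<le> m n \<and> m n \<le> N_pairs n
    \<and> 8 * (K n)\<^sup>2 \<le> real (n - 1) \<and> real (n - 1) \<le> N n) sequentially"
  using ev_Kn[of "1/16", simplified] ev_n[of 32] ev_n1_le_m ev_m_small
proof eventually_elim
  case (elim n)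
  have n1: "real (n - 1) = real n - 1" using elim by (simp add: of_nat_diff)
  have K2: "8 * (K n)\<^sup>2 \<le> real (n - 1)" using elim n1 by simp
  have "K n * 1 \<le> K n * K n" using K_pos[of n] by (intro mult_left_mono) auto
  then have "2 * K n \<le> real (n - 1)" using K2 K_pos[of n] unfolding power2_eq_square by linarith
  then have "real (2 * k n) \<le> real (n - 1)" by simp
  then have "2 * k n \<le> n - 1" by linarith
  moreover have "real (m n) \<le> N n" "real (n - 1) \<le> N n" using elim n1 by linarith+
  moreover have "0 < n - 1" "n - 1 \<le> m n" using elim by auto
  ultimately show ?case using K2 by simp
qed

text \<open>Completing the square, \<open>\<mu> * sqrt (2 * L) - \<mu>\<^sup>2 / 2 - L = - (\<mu> -
  sqrt (2 * L))\<^sup>2 / 2 \<le> 0\<close>. So \<open>\<epsilon>\<close> below the threshold the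
  exponent is at most \<open>L - \<mu> * \<epsilon> + 1\<close>, where the 1 covers two error terms,
  and \<open>\<mu> * \<epsilon>\<close> is unbounded.\<close>

lemma hub_weight_small:
  assumes "\<epsilon> > 0" "\<epsilon> \<le> 1" "\<eta> > 0"
  shows "eventually (\<lambda>n. \<forall>d. real d < t_star \<alpha> n (m n) - \<epsilon> * \<sigma> n \<longrightarrow> hub_weight n (m n) (k n) d \<le> \<eta>) sequentially"
  using ev_basic ev_KD[OF zero_less_one] ev_Y ev_x[OF zero_less_one] ev_mu ev_L[of "max 1 (((1 - ln \<eta>) / \<epsilon>)\<^sup>2)"]
    ev_D_ge[of 4] ev_n[of 32]
proof eventually_elim
  case (elim n)
  show ?case
  proof (intro allI impI)
    fix d assume d: "real d < t_star \<alpha> n (m n) - \<epsilon> * \<sigma> n"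
    have n0: "real n > 0" using elim by simp
    have D0: "D n > 0" using elim by simp
    have L1: "L n \<ge> 1" using elim by simp
    have sL: "(1 - ln \<eta>) / \<epsilon> \<le> sqrt (L n)" using elim by (intro real_le_rsqrt) simp
    have x1: "x n \<ge> 1"
    proof -
      have "1 \<le> sqrt (L n)" using L1 by simp
      then show ?thesis using elim by linarith
    qed
    have y: "real d - D n \<le> sqrt (D n) * (sqrt (2 * L n) - \<epsilon>)"
    proof -
      have "real d - D n \<le> \<sigma> n * (x n - \<epsilon>)" using d unfolding t_star_eq by (simp add: algebra_simps)
      also have "\<dots> \<le> sqrt (D n) * (sqrt (2 * L n) - \<epsilon>)"
        using elim x1 assms D0 by (intro mult_mono) auto
      finally show ?thesis .
    qed
    have "real n * hub_weight n (m n) (k n) d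
        \<le> exp (K n * (real d - D n) / D n - (K n)\<^sup>2 / (2 * D n) + K n / (2 * D n) + 4 * (K n)\<^sup>2 / real (n - 1))"
      using elim D0 by (intro hub_weight_le n1_m_N) auto
    also have "\<dots> \<le> exp (L n + ln \<eta>)"
      unfolding exp_le_cancel_iff
    proof -
      have "K n * (real d - D n) / D n \<le> K n * (sqrt (D n) * (sqrt (2 * L n) - \<epsilon>)) / D n"
        using y K_pos[of n] D0 by (intro divide_right_mono mult_left_mono) auto
      also have "\<dots> = \<mu> n * (sqrt (2 * L n) - \<epsilon>)" by (rule mu_facts(1)[OF D0])
      finally have a: "K n * (real d - D n) / D n \<le> \<mu> n * (sqrt (2 * L n) - \<epsilon>)" .
      have bb: "K n / (2 * D n) \<le> 1 / 2" using elim D0 by (simp add: field_simps)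
      have c: "4 * (K n)\<^sup>2 / real (n - 1) \<le> 1 / 2" using elim by (simp add: field_simps)
      have "\<mu> n * sqrt (2 * L n) - (\<mu> n)\<^sup>2 / 2 - L n = - (\<mu> n - sqrt (2 * L n))\<^sup>2 / 2"
        using L1 by (simp add: power2_diff real_sqrt_pow2 field_simps)
      then have e: "\<mu> n * sqrt (2 * L n) - (\<mu> n)\<^sup>2 / 2 - L n \<le> 0" by simp
      have "(1 - ln \<eta>) / \<epsilon> \<le> \<mu> n" using sL elim by linarith
      then have f: "1 - ln \<eta> \<le> \<mu> n * \<epsilon>" using assms by (simp add: divide_le_eq)
      show "K n * (real d - D n) / D n - (K n)\<^sup>2 / (2 * D n) + K n / (2 * D n) + 4 * (K n)\<^sup>2 / real (n - 1) \<le> L n + ln \<eta>"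
      proof -
        have "K n * (real d - D n) / D n - (K n)\<^sup>2 / (2 * D n) + K n / (2 * D n) + 4 * (K n)\<^sup>2 / real (n - 1)
            \<le> \<mu> n * (sqrt (2 * L n) - \<epsilon>) - (\<mu> n)\<^sup>2 / 2 + 1 / 2 + 1 / 2"
          unfolding mu_facts(2)[OF D0] by (intro add_mono diff_mono a bb c order_refl)
        also have "\<dots> \<le> L n + ln \<eta>" unfolding right_diff_distrib using e f by linarith
        finally show ?thesis .
      qed
    qed
    also have "\<dots> = real n * \<eta>" using assms n0 by (simp add: exp_add)
    finally show "hub_weight n (m n) (k n) d \<le> \<eta>" using n0 by simp
  qed
qed

text \<open>The same square now counts against the estimate, but by \<open>ev_mu\<close> it costs at
  most \<open>C / 2\<close>, which \<open>\<mu> * \<epsilon> / 2\<close> eventually exceeds. Half of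
  \<open>\<epsilon>\<close> is spent before: \<open>\<epsilon> / 4\<close> on \<open>x\<close>
  against \<open>sqrt (2 * L)\<close> and \<open>\<epsilon> / 4\<close> on the factor
  \<open>1 - pp\<close>. The estimate is made only at the first integer \<open>d1\<close> above the
  window, as \<open>hub_weight_ge\<close> requires \<open>d\<close> near \<open>D\<close>;
  monotonicity does the rest.\<close>

lemma hub_weight_large:
  assumes "\<epsilon> > 0" "\<epsilon> \<le> 1"
  shows "eventually (\<lambda>n. \<forall>d. t_star \<alpha> n (m n) + \<epsilon> * \<sigma> n \<le> real d \<longrightarrow> 1 \<le> hub_weight n (m n) (k n) d) sequentially"
proof -
  define C where "C = (4 * (\<bar>\<gamma>\<bar> + 1))\<^sup>2"
  have e12: "\<epsilon> / 12 > 0" "\<epsilon> / 4 > 0" using assms by auto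
  show ?thesis
    using ev_basic ev_KD[of "1/8", simplified] ev_K3[of "1/64", simplified] ev_Y ev_x[OF e12(2)] ev_mu ev_D
      ev_L[of "max 1 (((C + 2) / \<epsilon>)\<^sup>2)"] ev_D_ge[of 4] ev_n[of 32] ev_pp[OF e12(1)] ev_pp_half
  proof eventually_elim
    case (elim n)
    have n0: "real n > 0" using elim by simp
    have D0: "D n > 0" using elim by simp
    have L1: "L n \<ge> 1" using elim by simp
    have sL1: "sqrt (L n) \<ge> 1" using L1 by simp
    have sL: "(C + 2) / \<epsilon> \<le> sqrt (L n)" using elim by (intro real_le_rsqrt) simp
    have sD: "sqrt (D n) \<le> K n"
    proof -
      have "sqrt (D n) * 1 \<le> sqrt (D n) * sqrt (L n)" using sL1 D0 by (intro mult_left_mono) auto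
      also have "\<dots> \<le> K n" using elim L1 by (intro sqrt_D_L) auto
      finally show ?thesis by simp
    qed
    define s' where "s' = t_star \<alpha> n (m n) + \<epsilon> * \<sigma> n"
    define d1 where "d1 = nat \<lceil>s'\<rceil>"
    have s'D: "s' - D n = \<sigma> n * (x n + \<epsilon>)" by (simp add: s'_def t_star_eq algebra_simps)
    have s0: "0 \<le> \<sigma> n" using elim D0 by (meson divide_nonneg_nonneg order_trans real_sqrt_ge_zero less_imp_le zero_le_numeral)
    have x0: "0 \<le> x n" using elim sL1 by linarith
    have y0: "0 \<le> s' - D n" unfolding s'D using s0 x0 assms by simp
    have d1: "s' \<le> real d1" "real d1 \<le> s' + 1" unfolding d1_def using y0 D0 by linarith+
    have y4: "s' - D n \<le> 3 * K n"
    proof -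
      have "\<epsilon> * \<sigma> n \<le> 1 * sqrt (D n)" using assms elim s0 by (intro mult_mono) auto
      then show ?thesis using elim sD by (simp add: s'_def t_star_eq)
    qed
    have K1: "K n \<ge> 1" by (rule K_pos)
    \<comment> \<open>The upper end of the window is at most \<open>3 * K n\<close> above
      \<open>D n\<close>, and rounding up adds at most 1. Subtracting up to \<open>K n\<close> stays
      within the same radius.\<close>
    let ?b = "4 * K n"
    have "exp (K n * (real d1 - D n) / D n - (K n)\<^sup>2 / (2 * D n) - 2 * K n * ?b\<^sup>2 / (D n)\<^sup>2 - 2 * (K n)\<^sup>2 / N n)
        \<le> real n * hub_weight n (m n) (k n) d1"
    proof (rule hub_weight_ge)
      show "real d1 - D n \<le> ?b" using d1 y4 K1 by linarith
      show "- ?b \<le> real d1 - D n - K n" using d1 y0 K1 by linarith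
      show "?b \<le> D n / 2" using elim by simp
      have "K n \<le> real d1" using elim d1 y0 D0 by linarith
      then show "k n \<le> d1" by simp
      show "real (n - 1) * real (m n) = D n * N n" using elim by (intro n1_m_N) simp
    qed (use elim D0 in auto)
    moreover have "exp (L n) \<le> exp (K n * (real d1 - D n) / D n - (K n)\<^sup>2 / (2 * D n) - 2 * K n * ?b\<^sup>2 / (D n)\<^sup>2 - 2 * (K n)\<^sup>2 / N n)"
      unfolding exp_le_cancel_iff
    proof -
      have b1: "2 * K n * ?b\<^sup>2 / (D n)\<^sup>2 \<le> 1 / 2"
      proof -
        have "2 * K n * ?b\<^sup>2 = 32 * K n ^ 3" by (simp add: power2_eq_square power3_eq_cube)
        then show ?thesis using elim D0 by (simp add: divide_le_eq)
      qed
      have b2: "2 * (K n)\<^sup>2 / N n \<le> 1 / 2"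
      proof -
        have "8 * (K n)\<^sup>2 \<le> N n" "N n > 0" using elim by linarith+
        then show ?thesis by (simp add: divide_le_eq)
      qed
      have "\<mu> n * (sqrt (2 * L n) + \<epsilon> / 2) = K n * (sqrt (D n) * (sqrt (2 * L n) + \<epsilon> / 2)) / D n"
        by (rule mu_facts(1)[OF D0, symmetric])
      also have "\<dots> \<le> K n * (real d1 - D n) / D n"
      proof (intro divide_right_mono mult_left_mono)
        note sp = sqrt_one_minus_pp[of n]
        have sg: "\<sigma> n = sqrt (D n) * sqrt (1 - pp n)" using elim by (intro sigma_eq) simp
        have xL: "x n + \<epsilon> \<le> 3 * L n"
        proof -
          have "sqrt (2 * L n) \<le> 2 * L n" using L1 by (intro real_le_lsqrt) (auto simp: power2_eq_square)
          moreover have "x n \<le> sqrt (2 * L n)" using elim by simp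
          ultimately show ?thesis using L1 assms by linarith
        qed
        have "pp n * (x n + \<epsilon>) \<le> pp n * (3 * L n)" using xL pp_nonneg by (intro mult_left_mono)
        moreover have "L n * pp n \<le> \<epsilon> / 12" by fact
        moreover have "pp n * (3 * L n) = 3 * (L n * pp n)" by simp
        ultimately have "pp n * (x n + \<epsilon>) \<le> \<epsilon> / 4" by linarith
        then have "sqrt (2 * L n) + \<epsilon> / 2 \<le> (1 - pp n) * (x n + \<epsilon>)"
          using elim by (simp add: algebra_simps)
        also have "\<dots> \<le> sqrt (1 - pp n) * (x n + \<epsilon>)" using sp elim x0 assms by (intro mult_right_mono) auto
        finally have "sqrt (D n) * (sqrt (2 * L n) + \<epsilon> / 2) \<le> sqrt (D n) * (sqrt (1 - pp n) * (x n + \<epsilon>))"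
          using D0 by (intro mult_left_mono) auto
        also have "\<dots> = s' - D n" unfolding s'D sg by simp
        also have "\<dots> \<le> real d1 - D n" using d1 by simp
        finally show "sqrt (D n) * (sqrt (2 * L n) + \<epsilon> / 2) \<le> real d1 - D n" .
      qed (use D0 in auto)
      finally have a: "\<mu> n * (sqrt (2 * L n) + \<epsilon> / 2) \<le> K n * (real d1 - D n) / D n" .
      have "\<mu> n * sqrt (2 * L n) - (\<mu> n)\<^sup>2 / 2 - L n = - (\<mu> n - sqrt (2 * L n))\<^sup>2 / 2"
        using L1 by (simp add: power2_diff real_sqrt_pow2 field_simps)
      moreover have "(\<mu> n - sqrt (2 * L n))\<^sup>2 \<le> C"
        unfolding C_def using elim power_mono[of "\<bar>\<mu> n - sqrt (2 * L n)\<bar>" "4 * (\<bar>\<gamma>\<bar> + 1)" 2] by simp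
      ultimately have e: "\<mu> n * sqrt (2 * L n) - (\<mu> n)\<^sup>2 / 2 - L n \<ge> - C / 2" by simp
      have "(C + 2) / \<epsilon> \<le> \<mu> n" using sL elim by linarith
      then have f: "C + 2 \<le> \<mu> n * \<epsilon>" using assms by (simp add: divide_le_eq)
      have "\<mu> n * (sqrt (2 * L n) + \<epsilon> / 2) = \<mu> n * sqrt (2 * L n) + \<mu> n * \<epsilon> / 2" by (simp add: algebra_simps)
      then show "L n \<le> K n * (real d1 - D n) / D n - (K n)\<^sup>2 / (2 * D n) - 2 * K n * ?b\<^sup>2 / (D n)\<^sup>2 - 2 * (K n)\<^sup>2 / N n"
        using a b1 b2 e f mu_facts(2)[OF D0] by linarith
    qed
    ultimately have "exp (L n) \<le> real n * hub_weight n (m n) (k n) d1" by linarith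
    then have "real n \<le> real n * hub_weight n (m n) (k n) d1" using n0 by simp
    then have w1: "1 \<le> hub_weight n (m n) (k n) d1" using n0 by simp
    show ?case
    proof (intro allI impI)
      fix d assume "t_star \<alpha> n (m n) + \<epsilon> * \<sigma> n \<le> real d"
      then have "d1 \<le> d" unfolding d1_def s'_def[symmetric] by linarith
      then show "1 \<le> hub_weight n (m n) (k n) d" using w1 hub_weight_mono order_trans by blast
    qed
  qed
qed

end

subsection \<open>The degree of the hub\<close>

context planted_regime
begin

text \<open>The mean of the hub's degree without its \<open>k\<close> planted edges.\<close>

definition "D1 n = real (n - 1 - k n) * real (m n - k n) / real (N_pairs n - k n)"

text \<open>Planting lowers the mean of the remaining degree by at most
  \<open>2 * K * D / (n - 1)\<close>. This is below \<open>sqrt D\<close>, because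
  \<open>sqrt D \<le> K\<close> and \<open>2 * K\<^sup>2 \<le> n - 1\<close>; so \<open>D\<close>
  and \<open>D1\<close> are interchangeable at the scale of a standard deviation.\<close>

lemma ev_D1: "eventually (\<lambda>n. D1 n \<le> D n \<and> D n \<le> D1 n + sqrt (D n) \<and> sqrt (D n) \<le> 2 * sqrt (D1 n) \<and> 4 \<le> D1 n) sequentially"
  using ev_basic ev_D ev_D_ge[of 8] ev_L[of 1] ev_n[of 32]
proof eventually_elim
  case (elim n)
  let ?M = "real (n - 1)"
  have kk: "2 * K n \<le> ?M" using elim by (metis of_nat_le_iff of_nat_mult of_nat_numeral)
  have M0: "?M > 0" using elim by simp
  have mM: "?M \<le> real (m n)" "real (m n) \<le> N n" using elim by auto
  have K1: "K n \<ge> 1" by (rule K_pos)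
  have D1e: "D1 n = (?M - K n) * (real (m n) - K n) / (N n - K n)"
  proof -
    have "real (n - 1 - k n) = ?M - K n" "real (m n - k n) = real (m n) - K n" "real (N_pairs n - k n) = N n - K n"
      using elim by (intro of_nat_diff; linarith)+
    then show ?thesis by (simp only: D1_def)
  qed
  have De: "?M * real (m n) = D n * N n" using elim by (intro n1_m_N) simp
  have N0: "N n > 0" "N n - K n > 0" using kk mM M0 by linarith+
  have D0: "D n \<ge> 8" using elim by simp
  have Deq: "D n = ?M * real (m n) / N n" using De N0 by (simp add: field_simps)
  have up: "D1 n \<le> D n"
  proof -
    have "(real (m n) - K n) / (N n - K n) \<le> real (m n) / N n"
      using N0 mM K1 by (simp add: field_simps)
    then have "(?M - K n) * ((real (m n) - K n) / (N n - K n)) \<le> ?M * (real (m n) / N n)"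
      using kk mM K1 N0 M0 by (intro mult_mono) auto
    then show ?thesis by (simp add: D1e Deq)
  qed
  have sD1: "sqrt (D n) \<le> K n"
  proof -
    have "sqrt (D n) * 1 \<le> sqrt (D n) * sqrt (L n)" using elim D0 by (intro mult_left_mono) auto
    also have "\<dots> \<le> K n" using elim by (intro sqrt_D_L) auto
    finally show ?thesis by simp
  qed
  have low: "D n \<le> D1 n + sqrt (D n)"
  proof -
    have "(?M - K n) * (real (m n) - K n) / N n \<le> D1 n"
      unfolding D1e using kk mM N0 K1 by (intro divide_left_mono mult_nonneg_nonneg mult_pos_pos) auto
    moreover have "(?M - K n) * (real (m n) - K n) \<ge> ?M * real (m n) - 2 * K n * real (m n)"
    proof -
      have "K n * ?M \<le> K n * real (m n)" using mM K1 by (intro mult_left_mono) auto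
      moreover have "0 \<le> K n * K n" by simp
      moreover have "(?M - K n) * (real (m n) - K n) = ?M * real (m n) - K n * ?M - K n * real (m n) + K n * K n"
        by algebra
      ultimately show ?thesis by linarith
    qed
    then have "(?M * real (m n) - 2 * K n * real (m n)) / N n \<le> (?M - K n) * (real (m n) - K n) / N n"
      using N0 by (intro divide_right_mono) auto
    ultimately have "D n - 2 * K n * real (m n) / N n \<le> D1 n" by (simp add: Deq diff_divide_distrib)
    moreover have "2 * K n * real (m n) / N n \<le> sqrt (D n)"
    proof -
      have "2 * K n * real (m n) / N n = 2 * K n * D n / ?M" using Deq M0 by simp
      also have "\<dots> = (2 * K n * sqrt (D n) / ?M) * sqrt (D n)"
        using sqrt_D_sq[of n] by (simp add: mult.assoc)
      also have "\<dots> \<le> 1 * sqrt (D n)"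
      proof (intro mult_right_mono)
        have "2 * K n * sqrt (D n) \<le> 2 * K n * K n" using sD1 K1 by (intro mult_left_mono) auto
        also have "\<dots> \<le> ?M" using elim by (simp add: power2_eq_square)
        finally show "2 * K n * sqrt (D n) / ?M \<le> 1" using M0 by simp
      qed (use D0 in auto)
      finally show ?thesis by simp
    qed
    ultimately show ?thesis by linarith
  qed
  have s2: "2 \<le> sqrt (D n)" using real_sqrt_le_mono[of 4 "D n"] D0 by simp
  have "2 * sqrt (D n) \<le> sqrt (D n) * sqrt (D n)" using s2 D_nonneg[of n] by (intro mult_right_mono) auto
  then have half: "D n \<le> 2 * D1 n" using low sqrt_D_sq[of n] by linarith
  then have "sqrt (D n) \<le> sqrt (4 * D1 n)" using D0 by (intro real_sqrt_le_mono) auto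
  then have "sqrt (D n) \<le> 2 * sqrt (D1 n)" by (simp add: real_sqrt_mult)
  then show ?case using up low half D0 by simp
qed

lemma ev_hub_shape:
  assumes A: "A \<ge> 1"
  shows "eventually (\<lambda>n. gaussian_shape (hypergeom (N_pairs n - k n) (n - 1 - k n) (m n - k n)) (D1 n) (sqrt (D1 n)) A (n - 1 - k n)
      \<and> (3 * A + 4) * D1 n \<le> real (n - 1 - k n)) sequentially"
proof -
  have "1 / (4 * (3 * A + 4)) > 0" using A by simp
  from ev_Dn[OF this] ev_D1 ev_basic ev_m_small ev_n[of 32] show ?thesis
  proof eventually_elim
    case (elim n)
    have DA: "(3 * A + 4) * D1 n \<le> real n / 4"
    proof -
      have le: "(3 * A + 4) * D1 n \<le> (3 * A + 4) * (1 / (4 * (3 * A + 4)) * real n)"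
        using elim A by (intro mult_left_mono) auto
      have "c * (1 / (4 * c) * y) = y / 4" if "c \<noteq> 0" for c y :: real using that by simp
      moreover have "3 * A + 4 \<noteq> 0" using A by linarith
      ultimately have "(3 * A + 4) * (1 / (4 * (3 * A + 4)) * real n) = real n / 4" by blast
      with le show ?thesis by linarith
    qed
    have rr: "real (n - 1 - k n) = real n - 1 - K n" "real (m n - k n) = real (m n) - K n" "real (N_pairs n - k n) = N n - K n"
      using elim by (auto simp: of_nat_diff)
    have n1: "real (n - 1) = real n - 1" using elim by (simp add: of_nat_diff)
    have k2: "2 * K n \<le> real n - 1" using elim n1 by (metis of_nat_le_iff of_nat_mult of_nat_numeral)
    have a: "(3 * A + 4) * D1 n \<le> real (n - 1 - k n)" using DA rr k2 elim by linarith
    have D1nn: "D1 n \<ge> 0" using elim by simp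
    have "gaussian_shape (hypergeom (N_pairs n - k n) (n - 1 - k n) (m n - k n)) (D1 n) (sqrt (D1 n)) A (n - 1 - k n)"
    proof (rule hypergeom_gaussian_shape)
      show "n - 1 - k n \<le> m n - k n" using elim by auto
      have "real (n - 1 + m n) \<le> real (N_pairs n)" using elim n1 by simp
      then show "n - 1 - k n + (m n - k n) \<le> N_pairs n - k n" using elim by linarith
      have "N n - K n > 0" using k2 elim by linarith
      then show "real (n - 1 - k n) * real (m n - k n) = D1 n * real (N_pairs n - k n)"
        unfolding D1_def using rr by simp
      show "D1 n = sqrt (D1 n) * sqrt (D1 n)" using D1nn by simp
      have "4 \<le> D1 n" using elim by simp
      then show "2 \<le> sqrt (D1 n)" using real_sqrt_le_mono[of 4 "D1 n"] by simp
      have "real n \<ge> 32" "real (m n) + 2 * real n \<le> N n / 2" using elim by auto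
      then show "(3 * A + 4) * D1 n \<le> real (N_pairs n - k n) - real (n - 1 - k n) - real (m n - k n)"
        using DA rr k2 by linarith
    qed (fact A a)+
    with a show ?case by simp
  qed
qed

text \<open>The hub law is pointwise at most \<open>4 * exp 4 / sqrt D1\<close>, and the window
  holds at most \<open>2 * \<epsilon> * sqrt D + 1\<close> integers. The 1 is absorbed into
  \<open>\<epsilon> * sqrt D / 2\<close> once \<open>sqrt D \<ge> 2 / \<epsilon>\<close>; the last
  factor 2 compares \<open>sqrt D\<close> with \<open>sqrt D1\<close>.\<close>

lemma hub_law_window:
  assumes "\<epsilon> > 0" "\<epsilon> \<le> 1"
  shows "eventually (\<lambda>n. (\<Sum>d\<le>n - 1. hub_law n (m n) (k n) d
      * indicator {d. t_star \<alpha> n (m n) - \<epsilon> * \<sigma> n \<le> real d \<and> real d < t_star \<alpha> n (m n) + \<epsilon> * \<sigma> n} d)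
      \<le> (20 * exp 4) * \<epsilon>) sequentially"
  using ev_hub_shape[OF order_refl] ev_D1 ev_basic ev_Y ev_D_ge[of "4 * (1 / \<epsilon>)\<^sup>2"] ev_L[of 1]
proof eventually_elim
  case (elim n)
  interpret gaussian_shape "hypergeom (N_pairs n - k n) (n - 1 - k n) (m n - k n)" "D1 n" "sqrt (D1 n)" 1 "n - 1 - k n"
    using elim by simp
  define s s' where "s = t_star \<alpha> n (m n) - \<epsilon> * \<sigma> n" and "s' = t_star \<alpha> n (m n) + \<epsilon> * \<sigma> n"
  let ?C = "4 * exp 4 / sqrt (D1 n)"
  let ?S = "{d. d \<le> n - 1 \<and> s \<le> real d \<and> real d < s'}"
  have le: "hub_law n (m n) (k n) d \<le> ?C" if "d \<le> n - 1" for d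
  proof (cases "k n \<le> d")
    case True
    have "hub_law n (m n) (k n) d = hypergeom (N_pairs n - k n) (n - 1 - k n) (m n - k n) (d - k n)"
      unfolding hub_law_def using True that elim by (intro hub_weight_hypergeom) auto
    then show ?thesis using pmf_le[of "d - k n"] by simp
  next
    case False
    then have "hub_law n (m n) (k n) d = 0" by (simp add: hub_law_def hub_weight_eq_0)
    moreover have "0 \<le> ?C" using D_ge by simp
    ultimately show ?thesis by simp
  qed
  have sD: "0 \<le> sqrt (D n)" "0 < sqrt (D1 n)" using r_ge D_nonneg[of n] by (auto simp only: real_sqrt_ge_zero)
  have sg: "0 \<le> \<sigma> n" using elim sD by linarith
  have fin: "finite ?S" by simp
  have cardS: "real (card ?S) \<le> 2 * \<epsilon> * sqrt (D n) + 1"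
  proof (cases "?S = {}")
    case True
    then show ?thesis using assms sD by (simp only: card.empty) simp
  next
    case False
    define a b where "a = Min ?S" and "b = Max ?S"
    have ab: "a \<in> ?S" "b \<in> ?S" "?S \<subseteq> {a..b}"
      unfolding a_def b_def using Min_in[OF fin False] Max_in[OF fin False] fin by auto
    have "real (card ?S) \<le> real (card {a..b})" using ab(3) by (simp add: card_mono del: card_atLeastAtMost)
    also have "a \<le> b" using ab by auto
    then have "real (card {a..b}) = real b - real a + 1" by (simp add: of_nat_diff)
    also have "\<dots> \<le> (s' - s) + 1" using ab by auto
    also have "s' - s = 2 * \<epsilon> * \<sigma> n" by (simp add: s_def s'_def)
    also have "2 * \<epsilon> * \<sigma> n + 1 \<le> 2 * \<epsilon> * sqrt (D n) + 1" using elim assms by simp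
    finally show ?thesis .
  qed
  have "(\<Sum>d\<le>n - 1. hub_law n (m n) (k n) d * indicator {d. s \<le> real d \<and> real d < s'} d)
      = (\<Sum>d\<in>?S. hub_law n (m n) (k n) d)"
    by (intro sum.mono_neutral_cong_right) (auto simp: indicator_def)
  also have "\<dots> \<le> real (card ?S) * ?C" using le by (intro sum_bounded_above) auto
  also have "\<dots> \<le> (2 * \<epsilon> * sqrt (D n) + 1) * ?C" using cardS sD by (intro mult_right_mono) auto
  also have "\<dots> \<le> (2 * \<epsilon> * sqrt (D n) + \<epsilon> * sqrt (D n) / 2) * ?C"
  proof (intro mult_right_mono add_left_mono)
    have "sqrt (4 * (1 / \<epsilon>)\<^sup>2) \<le> sqrt (D n)" using elim by (intro real_sqrt_le_mono) simp
    then have "2 / \<epsilon> \<le> sqrt (D n)" using assms by (simp add: real_sqrt_mult)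
    then show "1 \<le> \<epsilon> * sqrt (D n) / 2" using assms by (simp add: field_simps)
  qed (use sD in auto)
  also have "\<dots> = 10 * exp 4 * \<epsilon> * (sqrt (D n) / sqrt (D1 n))" by (simp add: field_simps)
  also have "\<dots> \<le> 10 * exp 4 * \<epsilon> * 2"
  proof (intro mult_left_mono)
    show "sqrt (D n) / sqrt (D1 n) \<le> 2" using elim sD by (simp add: divide_le_eq)
  qed (use assms in auto)
  finally show ?case by (simp add: s_def s'_def mult_ac)
qed

text \<open>The threshold exceeds the mean \<open>K + D1\<close> of the hub's degree by at most
  \<open>(A - 1) * r\<close>. Between \<open>(A - 1) * r\<close> and \<open>A * r\<close> above that
  mean lie at least \<open>r / 2\<close> integers, each of mass at least
  \<open>e / (22 * r)\<close>. A constant mass is enough.\<close>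

lemma hub_law_upper_mass:
  obtains c0 where "c0 > 0"
    "eventually (\<lambda>n. c0 \<le> (\<Sum>d\<le>n - 1. hub_law n (m n) (k n) d * indicator {d. t_star \<alpha> n (m n) \<le> real d} d)) sequentially"
proof -
  define C where "C = 4 * (\<bar>\<gamma>\<bar> + 1)"
  \<comment> \<open>\<open>C\<close> is the distance of \<open>\<mu>\<close> from
    \<open>sqrt (2 * L)\<close>, the \<open>+ 1\<close> pays for \<open>D\<close> against
    \<open>D1\<close>, and the factor 2 for \<open>sqrt D \<le> 2 * sqrt D1\<close>. The final 2
    leaves room for a stretch of length \<open>r\<close> past the threshold.\<close>
  define A where "A = 2 * (C + 1) + 2"
  define e where "e = exp (- (A + 3) * A)"
  have C0: "C \<ge> 4" by (simp add: C_def)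
  have A1: "A \<ge> 1" using C0 by (simp add: A_def)
  have "eventually (\<lambda>n. e / 44 \<le> (\<Sum>d\<le>n - 1. hub_law n (m n) (k n) d * indicator {d. t_star \<alpha> n (m n) \<le> real d} d)) sequentially"
    using ev_hub_shape[OF A1] ev_D1 ev_basic ev_Y ev_x[OF zero_less_one] ev_mu ev_L[of 1] ev_D_ge[of 4]
  proof eventually_elim
    case (elim n)
    interpret gaussian_shape "hypergeom (N_pairs n - k n) (n - 1 - k n) (m n - k n)" "D1 n" "sqrt (D1 n)" A "n - 1 - k n"
      using elim by simp
    define r where "r = sqrt (D1 n)"
    let ?h = "hypergeom (N_pairs n - k n) (n - 1 - k n) (m n - k n)"
    have r2: "r \<ge> 2" unfolding r_def by (rule r_ge)
    have D1r: "D1 n = r * r" unfolding r_def by (rule D_eq)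
    have D0: "D n > 0" using elim by simp
    have t_le: "t_star \<alpha> n (m n) \<le> K n + (D1 n + (A - 1) * r)"
    proof -
      have sDn: "0 \<le> sqrt (D n)" using D0 by simp
      have x0: "0 \<le> x n"
      proof -
        have "0 \<le> sqrt (L n)" using elim by simp
        then show ?thesis using elim by linarith
      qed
      have "\<sigma> n * x n \<le> sqrt (D n) * sqrt (2 * L n)" using elim sDn x0 by (intro mult_mono) auto
      moreover have "K n = sqrt (D n) * \<mu> n" using D0 by (simp add: \<mu>_def)
      ultimately have "\<sigma> n * x n - K n \<le> sqrt (D n) * (sqrt (2 * L n) - \<mu> n)" by (simp add: algebra_simps)
      also have "\<dots> \<le> sqrt (D n) * C"
      proof (intro mult_left_mono sDn)
        have "\<bar>\<mu> n - sqrt (2 * L n)\<bar> \<le> C" using elim unfolding C_def by simp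
        then show "sqrt (2 * L n) - \<mu> n \<le> C" by linarith
      qed
      finally have "t_star \<alpha> n (m n) - K n \<le> D1 n + (C + 1) * sqrt (D n)"
        unfolding t_star_eq using elim by (simp add: algebra_simps)
      also have "(C + 1) * sqrt (D n) \<le> (C + 1) * (2 * r)" unfolding r_def using elim C0 by (intro mult_left_mono) auto
      also have "\<dots> \<le> (A - 1) * r" unfolding A_def using r2 by (simp add: algebra_simps)
      finally show ?thesis by simp
    qed
    define a b where "a = nat \<lceil>D1 n + (A - 1) * r\<rceil>" and "b = nat \<lfloor>D1 n + A * r\<rfloor>"
    have pos: "0 \<le> D1 n" "0 \<le> (A - 1) * r" "0 \<le> A * r" "(A - 1) * r \<ge> 1" "A * r = (A - 1) * r + r"
      using D1r r2 C0 mult_mono[of 1 "A - 1" 1 r] by (auto simp: A_def algebra_simps)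
    have a: "D1 n + (A - 1) * r \<le> real a" "real a < D1 n + (A - 1) * r + 1"
      unfolding a_def using pos by linarith+
    have b: "real b \<le> D1 n + A * r" "D1 n + A * r < real b + 1"
      unfolding b_def using pos by linarith+
    have ab: "a \<le> b" using a b pos r2 by linarith
    have hge: "e / (22 * r) \<le> ?h d" if "d \<in> {a..b}" for d
      unfolding e_def r_def
    proof (rule pmf_ge)
      show "D1 n + 1 \<le> real d" using that a pos by auto
      show "real d \<le> D1 n + A * sqrt (D1 n)" using that b by (auto simp: r_def)
    qed
    have bn: "b \<le> n - 1 - k n"
    proof -
      have "A * r \<le> A * D1 n" using A1 r2 D1r by (intro mult_left_mono) auto
      moreover have "(3 * A + 4) * D1 n = A * D1 n + D1 n + (2 * A + 3) * D1 n" by (simp add: algebra_simps)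
      moreover have "0 \<le> (2 * A + 3) * D1 n" using A1 pos by simp
      ultimately have "real b \<le> real (n - 1 - k n)" using b elim by linarith
      then show ?thesis by simp
    qed
    have "e / 44 = (r / 2) * (e / (22 * r))" using r2 by simp
    also have "\<dots> \<le> real (card {a..b}) * (e / (22 * r))"
      using a b ab pos r2 by (intro mult_right_mono) (auto simp: of_nat_diff e_def)
    also have "\<dots> \<le> (\<Sum>d\<in>{a..b}. ?h d)" using hge by (intro sum_bounded_below) auto
    also have "\<dots> = (\<Sum>d\<in>{a..b}. hub_law n (m n) (k n) (d + k n) * indicator {d. t_star \<alpha> n (m n) \<le> real d} (d + k n))"
    proof (intro sum.cong refl)
      fix d assume d: "d \<in> {a..b}"
      then have dn: "d + k n \<le> n - 1" using bn elim by auto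
      have "t_star \<alpha> n (m n) \<le> real (d + k n)" using t_le a d by auto
      moreover have "hub_law n (m n) (k n) (d + k n) = ?h (d + k n - k n)"
        unfolding hub_law_def using dn elim by (intro hub_weight_hypergeom) auto
      ultimately show "?h d = hub_law n (m n) (k n) (d + k n) * indicator {d. t_star \<alpha> n (m n) \<le> real d} (d + k n)"
        by simp
    qed
    also have "\<dots> = (\<Sum>d\<in>(\<lambda>d. d + k n) ` {a..b}. hub_law n (m n) (k n) d * indicator {d. t_star \<alpha> n (m n) \<le> real d} d)"
      by (subst sum.reindex) (auto simp: inj_on_def)
    also have "\<dots> \<le> (\<Sum>d\<le>n - 1. hub_law n (m n) (k n) d * indicator {d. t_star \<alpha> n (m n) \<le> real d} d)"
    proof (intro sum_mono2)
      show "(\<lambda>d. d + k n) ` {a..b} \<subseteq> {..n - 1}" using bn elim by auto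
    qed (auto simp: hub_law_nonneg)
    finally show ?case .
  qed
  moreover have "e / 44 > 0" by (simp add: e_def)
  ultimately show thesis using that by blast
qed

text \<open>One small \<open>\<epsilon>\<close> is at once window width, weight bound and tail
  bound, and controls the window mass up to a constant; only \<open>c0\<close> stays fixed as
  \<open>\<epsilon>\<close> shrinks.\<close>

lemma ev_likelihood_bounds:
  assumes "\<epsilon> > 0" "\<epsilon> \<le> 1 / 4" "c0 > 0"
    and "eventually (\<lambda>n. c0 \<le> (\<Sum>d\<le>n - 1. hub_law n (m n) (k n) d * indicator {d. t_star \<alpha> n (m n) \<le> real d} d)) sequentially"
  shows "eventually (\<lambda>n. likelihood_bounds n (m n) (k n) (cutoff n) (t_star \<alpha> n (m n) - \<epsilon> * \<sigma> n)
     (t_star \<alpha> n (m n)) (t_star \<alpha> n (m n) + \<epsilon> * \<sigma> n) \<epsilon> \<epsilon> \<epsilon> (20 * exp 4 * \<epsilon>) c0) sequentially"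
proof -
  have e1: "\<epsilon> \<le> 1" using assms by simp
  have tl: "eventually (\<lambda>n. real n * tail n < \<epsilon>) sequentially"
    using order_tendstoD(2)[OF n_tail_lim assms(1)] .
  show ?thesis
    using assms(4) tl hub_weight_small[OF assms(1) e1 assms(1)] hub_weight_large[OF assms(1) e1]
      hub_law_window[OF assms(1) e1] ev_basic ev_cut ev_m_small ev_n[of 32] ev_Dn[of "1/16", simplified] ev_Y ev_D_ge[of 4]
  proof eventually_elim
    case (elim n)
    have t0: "t_star \<alpha> n (m n) \<ge> 0" using elim by simp
    have sg: "\<sigma> n \<ge> 0"
    proof -
      have "0 \<le> sqrt (D n) / 2" using D_nonneg[of n] by simp
      then show ?thesis using elim by linarith
    qed
    have c1: "real (cutoff n) \<le> 2 * D n" using elim by simp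
    have mD: "real (m n) = D n * real n / 2" using elim by (intro m_D) simp
    have "32 * D n \<le> D n * real n" using elim mult_right_mono[of 32 "real n" "D n"] by (simp add: mult.commute)
    then have c2: "2 * cutoff n < m n" using c1 mD elim by linarith
    show ?case
    proof
      show "k n \<le> n - 1" "n - 1 \<le> m n" using elim by auto
      show "2 * cutoff n < m n" by (rule c2)
      show "m n + 2 * n < N_pairs n" using elim by linarith
      show "cutoff n + 2 < n" using c1 elim by linarith
      show "t_star \<alpha> n (m n) - \<epsilon> * \<sigma> n \<le> t_star \<alpha> n (m n)" "t_star \<alpha> n (m n) \<le> t_star \<alpha> n (m n) + \<epsilon> * \<sigma> n"
        using sg assms by auto
      show "hub_weight n (m n) (k n) d \<le> \<epsilon>" if "real d < t_star \<alpha> n (m n) - \<epsilon> * \<sigma> n" for d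
        using elim that by blast
      show "d \<le> cutoff n" if "real d < t_star \<alpha> n (m n) - \<epsilon> * \<sigma> n" for d
      proof -
        have "real d < t_star \<alpha> n (m n)" using that sg assms mult_nonneg_nonneg[of \<epsilon> "\<sigma> n"] by linarith
        then show ?thesis unfolding cutoff_def by linarith
      qed
      show "1 \<le> hub_weight n (m n) (k n) d" if "t_star \<alpha> n (m n) + \<epsilon> * \<sigma> n \<le> real d" for d
        using elim that by blast
      show "real n * (\<Sum>d\<le>n - 1. hypergeom (N_pairs n) (n - 1) (m n) d * indicator {d. t_star \<alpha> n (m n) \<le> real d} d) \<le> \<epsilon>"
        using elim unfolding tail_def by simp
      have "(\<Sum>d\<le>n - 1. hypergeom (N_pairs n) (n - 1) (m n) d * indicator {cutoff n<..} d) \<le> tail n"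
        unfolding tail_def
      proof (intro sum_mono mult_left_mono hypergeom_nonneg)
        fix d
        have "t_star \<alpha> n (m n) \<le> real d" if "cutoff n < d" using that t0 unfolding cutoff_def by linarith
        then show "indicator {cutoff n<..} d \<le> (indicator {d. t_star \<alpha> n (m n) \<le> real d} d :: real)"
          by (auto simp: indicator_def)
      qed
      also have "\<dots> \<le> real n * tail n" using tail_nonneg[of n] elim mult_right_mono[of 1 "real n" "tail n"] by simp
      finally show "(\<Sum>d\<le>n - 1. hypergeom (N_pairs n) (n - 1) (m n) d * indicator {cutoff n<..} d) \<le> \<epsilon>"
        using elim by simp
      show "\<epsilon> < 1 / 2" using assms by simp
      show "(\<Sum>d\<le>n - 1. hub_law n (m n) (k n) d * indicator {d. t_star \<alpha> n (m n) - \<epsilon> * \<sigma> n \<le> real d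
          \<and> real d < t_star \<alpha> n (m n) + \<epsilon> * \<sigma> n} d) \<le> 20 * exp 4 * \<epsilon>" using elim by simp
      show "c0 > 0" by fact
      show "c0 \<le> (\<Sum>d\<le>n - 1. hub_law n (m n) (k n) d * indicator {d. t_star \<alpha> n (m n) \<le> real d} d)" using elim by simp
      show "0 \<le> \<epsilon>" using assms by simp
    qed
  qed
qed

definition "sym_diff_event n =
  ({G. LR n (m n) (k n) G \<ge> 1} - {G. real (max_degree n G) \<ge> t_star \<alpha> n (m n)})
  \<union> ({G. real (max_degree n G) \<ge> t_star \<alpha> n (m n)} - {G. LR n (m n) (k n) G \<ge> 1})"

text \<open>The constant has to be chosen before \<open>\<eta>\<close>; it is determined by
  \<open>c0\<close> alone.\<close>

lemma ev_sym_diff: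
  obtains C where "C > 0" "\<And>\<eta>. 0 < \<eta> \<Longrightarrow> \<eta> \<le> 1 / 2 \<Longrightarrow>
     eventually (\<lambda>n. measure_pmf.prob (P0 n (m n)) (sym_diff_event n) \<le> C * \<eta>
       \<and> measure_pmf.prob (P1 n (m n) (k n)) (sym_diff_event n) \<le> C * \<eta>) sequentially"
proof -
  obtain c0 where c0: "c0 > 0"
    "eventually (\<lambda>n. c0 \<le> (\<Sum>d\<le>n - 1. hub_law n (m n) (k n) d * indicator {d. t_star \<alpha> n (m n) \<le> real d} d)) sequentially"
    by (rule hub_law_upper_mass)
  define C1 where "C1 = 2 + 2 / c0 * (20 * exp 4) + 4 / c0\<^sup>2 * 8"
  have C10: "C1 > 0" unfolding C1_def using c0 by (intro add_pos_nonneg) auto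
  define C where "C = C1 + 9 + 20 * exp 4"
  have "eventually (\<lambda>n. measure_pmf.prob (P0 n (m n)) (sym_diff_event n) \<le> C * \<eta>
       \<and> measure_pmf.prob (P1 n (m n) (k n)) (sym_diff_event n) \<le> C * \<eta>) sequentially"
    if eta: "0 < \<eta>" "\<eta> \<le> 1 / 2" for \<eta>
  proof -
    \<comment> \<open>With \<open>M = 1 / \<eta>\<close> in \<open>P1_sym_diff\<close>, the terms
      \<open>M * \<epsilon>\<close> and \<open>1 / M\<close> both become multiples of
      \<open>\<eta>\<close>.\<close>
    define \<epsilon> where "\<epsilon> = \<eta>\<^sup>2"
    have ee: "\<epsilon> > 0" "\<epsilon> \<le> 1 / 4" "\<epsilon> \<le> \<eta>"
      using eta power_mono[of \<eta> "1/2" 2] mult_left_mono[of \<eta> 1 \<eta>] by (auto simp: \<epsilon>_def power2_eq_square)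
    from ev_likelihood_bounds[OF ee(1,2) c0] pair_error_lim[OF ee(1)] show ?thesis
    proof eventually_elim
      case (elim n)
      interpret likelihood_bounds n "m n" "k n" "cutoff n" "t_star \<alpha> n (m n) - \<epsilon> * \<sigma> n"
        "t_star \<alpha> n (m n)" "t_star \<alpha> n (m n) + \<epsilon> * \<sigma> n" \<epsilon> \<epsilon> \<epsilon> "20 * exp 4 * \<epsilon>" c0 by fact
      have ev: "(A - B) \<union> (B - A) = sym_diff_event n"
        by (simp add: A_def B_def sym_diff_event_def)
      have v: "var \<le> 8 * \<epsilon>"
      proof -
        have "pair_error n (m n) (cutoff n) / (1 - 2 * \<epsilon>) \<le> (1 + \<epsilon>) / (1 - 2 * \<epsilon>)"
          using elim ee by (intro divide_right_mono) auto
        \<comment> \<open>The restriction \<open>\<epsilon> \<le> 1 / 4\<close> makes this linear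
          bound valid; with \<open>\<omega> = \<epsilon>\<close> it gives the 8 in
          \<open>C1\<close>.\<close>
        also have "\<dots> \<le> 1 + 7 * \<epsilon>"
        proof -
          have "0 \<le> \<epsilon> * (4 - 14 * \<epsilon>)" using ee by (intro mult_nonneg_nonneg) auto
          then have "1 + \<epsilon> \<le> (1 + 7 * \<epsilon>) * (1 - 2 * \<epsilon>)" by (simp add: algebra_simps)
          then show ?thesis using ee by (simp add: divide_le_eq)
        qed
        finally show ?thesis by (simp add: var_def)
      qed
      have b0: "2 * \<epsilon> + 2 / c0 * (20 * exp 4 * \<epsilon>) + 4 / c0\<^sup>2 * var \<le> C1 * \<epsilon>"
      proof -
        have "4 / c0\<^sup>2 * var \<le> 4 / c0\<^sup>2 * (8 * \<epsilon>)" using v by (intro mult_left_mono) auto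
        then show ?thesis by (simp add: C1_def algebra_simps)
      qed
      have "measure_pmf.prob (P0 n (m n)) (sym_diff_event n) \<le> C1 * \<epsilon>"
        using P0_sym_diff b0 unfolding ev by linarith
      also have "\<dots> \<le> C * \<eta>" using ee C10 eta unfolding C_def by (intro mult_mono) auto
      finally have p0: "measure_pmf.prob (P0 n (m n)) (sym_diff_event n) \<le> C * \<eta>" .
      have "measure_pmf.prob (P1 n (m n) (k n)) (sym_diff_event n)
          \<le> 1 / \<eta> * (2 * \<epsilon> + 2 / c0 * (20 * exp 4 * \<epsilon>) + 4 / c0\<^sup>2 * var) + (1 + var) / (1 / \<eta>) + 20 * exp 4 * \<epsilon>"
        using P1_sym_diff[of "1 / \<eta>"] eta unfolding ev by simp
      also have "\<dots> \<le> 1 / \<eta> * (C1 * \<epsilon>) + (1 + 8) / (1 / \<eta>) + 20 * exp 4 * \<eta>"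
      proof (intro add_mono mult_left_mono divide_right_mono b0)
        show "var \<le> 8" using v ee by linarith
      qed (use eta ee in auto)
      also have "\<dots> = C * \<eta>" using eta by (simp add: C_def \<epsilon>_def power2_eq_square field_simps)
      finally show ?case using p0 by simp
    qed
  qed
  moreover have "C > 0" using C10 by (simp add: C_def add_pos_pos)
  ultimately show thesis using that by blast
qed

lemma sym_diff_lim:
  "(\<lambda>n. measure_pmf.prob (P0 n (m n)) (sym_diff_event n)) \<longlonglongrightarrow> 0"
  "(\<lambda>n. measure_pmf.prob (P1 n (m n) (k n)) (sym_diff_event n)) \<longlonglongrightarrow> 0"
proof -
  obtain C where C: "C > 0" and ev: "\<And>\<eta>. 0 < \<eta> \<Longrightarrow> \<eta> \<le> 1 / 2 \<Longrightarrow>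
     eventually (\<lambda>n. measure_pmf.prob (P0 n (m n)) (sym_diff_event n) \<le> C * \<eta>
       \<and> measure_pmf.prob (P1 n (m n) (k n)) (sym_diff_event n) \<le> C * \<eta>) sequentially"
    using ev_sym_diff by blast
  have small: "eventually (\<lambda>n. measure_pmf.prob (P0 n (m n)) (sym_diff_event n) < e
       \<and> measure_pmf.prob (P1 n (m n) (k n)) (sym_diff_event n) < e) sequentially" if "e > 0" for e
  proof -
    define \<eta> where "\<eta> = min (1 / 2) (e / (2 * C))"
    have eta: "0 < \<eta>" "\<eta> \<le> 1 / 2" using C that by (auto simp: \<eta>_def)
    have "C * \<eta> \<le> C * (e / (2 * C))" using C by (intro mult_left_mono) (auto simp: \<eta>_def)
    then have "C * \<eta> < e" using C that by simp
    with ev[OF eta] show ?thesis by (auto elim!: eventually_mono)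
  qed
  show "(\<lambda>n. measure_pmf.prob (P0 n (m n)) (sym_diff_event n)) \<longlonglongrightarrow> 0"
    by (rule tendstoI, drule small, erule eventually_mono) simp
  show "(\<lambda>n. measure_pmf.prob (P1 n (m n) (k n)) (sym_diff_event n)) \<longlonglongrightarrow> 0"
    by (rule tendstoI, drule small, erule eventually_mono) simp
qed

end

theorem mainTheorem2:
  fixes \<gamma> \<alpha> :: real and k m :: "nat \<Rightarrow> nat"
  assumes "\<alpha> > 1"
    and "\<forall>n. k n > 0"
    and "(\<lambda>n. (ln (real n))\<^sup>2 / real (k n)) \<longlonglongrightarrow> 0"
    and "(\<lambda>n. real (k n) / sqrt (real n)) \<longlonglongrightarrow> 0"
    and "\<forall>n. m n = nat (round (real (k n) ^ 2 * real n / (4 * ln (real n))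
                                 * (1 + \<gamma> / sqrt (ln (real n)))))"
  defines "A \<equiv> \<lambda>n. {G. LR n (m n) (k n) G \<ge> 1}"
    and "B \<equiv> \<lambda>n. {G. real (max_degree n G) \<ge> t_star \<alpha> n (m n)}"
  shows "(\<lambda>n. measure_pmf.prob (P0 n (m n)) ((A n - B n) \<union> (B n - A n))) \<longlonglongrightarrow> 0
       \<and> (\<lambda>n. measure_pmf.prob (P1 n (m n) (k n)) ((A n - B n) \<union> (B n - A n))) \<longlonglongrightarrow> 0"
proof -
  interpret planted_regime \<gamma> \<alpha> k m
    by (rule planted_regime.intro) (use assms(1-5) in blast)+
  have "(A n - B n) \<union> (B n - A n) = sym_diff_event n" for n
    by (simp only: A_def B_def sym_diff_event_def)
  then show ?thesis by (simp only: sym_diff_lim conj_absorb)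
qed

end
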